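(* Let $0\le\theta\le1$, $\Delta t>0$, and let $\mathbf{B}_0\in H(\mathrm{div};\Omega)$ be the initial condition on the magnetic field, with $\mathbf{B}_h^0=\mathcal{I}^{\mathcal{E}_h}(\mathbf{B}_0)$. For $n=0,\dots,N-1$ let the discrete fields at time level $n+1$ be produced by the Newton-type iteration of the context, $$x_h^{(m+1)}=x_h^{(m)}+\delta x_h^{(m)},\qquad DG(x_h^{(m)})\,\delta x_h^{(m)}=-G(x_h^{(m)}),\qquad 0\le m\le M-1,$$ and denote by $\mathbf{B}_h^{n+1,(m)}$ and $\delta\mathbf{B}_h^{n+1,(m)}$ the magnetic components of $x_h^{(m)}$ and $\delta x_h^{(m)}$, with $\mathbf{B}_h^{n+1}=\mathbf{B}_h^{n+1,(M)}$. If $\mathrm{div}\,\mathbf{B}_0=0$, then the updates satisfy $$\mathrm{div}\,\delta\mathbf{B}_h^{n,(m)}=0\qquad\text{for all }1\le n\le N,\ 0\le m\le M-1,$$ implying that $$\mathrm{div}\,\mathbf{B}_h^n=0\qquad\text{for all }0\le n\le N.$$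
   Context: Notation. $\Omega\subset\mathbb{R}^2$ is open, bounded, connected and polygonal; $\Omega_h$ is a finite mesh of polygonal cells $P$ with $\overline\Omega=\bigcup\overline P$, such that, with $h_P$ the diameter of $P$ and some $\rho>0$ independent of the mesh size $h$, each $P$ is star-shaped with respect to every point of some disk of radius $\rho h_P$ and each edge of $P$ has length at least $\rho h_P$. $\mathbb{P}_k$: polynomials of degree $\le k$; $e$: edges; $\mathbf{n}$: unit normals. For scalar $D$, $\mathbf{rot}\,D=(\partial_yD,-\partial_xD)^T$; for vectors, $\mathrm{rot}\,\mathbf{C}=\partial_xC_y-\partial_yC_x$, $\mathrm{div}\,\mathbf{C}=\partial_xC_x+\partial_yC_y$, $\mathbf{v}\times\mathbf{B}=v_xB_y-v_yB_x$. $H(\mathbf{rot};\omega)$, $H(\mathrm{div};\omega)$, $H(\mathrm{rot};\omega)$ are the $L^2(\omega)$ functions/fields with square-integrable $\mathbf{rot}$, $\mathrm{div}$, $\mathrm{rot}$. $(\cdot,\cdot)_P$ is the $L^2(P)$ inner product, $\|\cdot\|_{0,P}$ its norm, $L^2_0$ the zero-mean functions. $R_e,R_m>0$ are the viscous and magnetic Reynolds numbers. Spaces. $\mathcal{V}_h$: functions in $H(\mathbf{rot};\Omega)$ whose restriction to each $P$ lies in $\mathcal{V}_h(P)=\{D\in H(\mathbf{rot};P):D|_{\partial P}\in C(\partial P),\,D|_e\in\mathbb{P}_1(e)\,\forall e\subset\partial P,\,\mathrm{rot}\,\mathbf{rot}\,D=0\}$; degrees of freedom (dofs): vertex values. $\mathcal{V}_{h,0}$: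 those vanishing on $\partial\Omega$. $\mathcal{E}_h$: fields in $H(\mathrm{div};\Omega)$ whose restriction to each $P$ lies in $\mathcal{E}_h(P)=\{\mathbf{C}\in H(\mathrm{div};P)\cap H(\mathrm{rot};P):\mathrm{div}\,\mathbf{C}\in\mathbb{P}_0(P),\,\mathrm{rot}\,\mathbf{C}=0,\,\mathbf{C}|_e\cdot\mathbf{n}\in\mathbb{P}_0(e)\,\forall e\subset\partial P\}$; dofs: edge averages of the normal component. $\mathcal{P}_h$: piecewise constants on $\Omega_h$; $\mathcal{P}_{h,0}=\mathcal{P}_h\cap L^2_0(\Omega)$; dofs of $\mathcal{P}_{h,0}$: cell integrals. $\mathcal{TV}_h$: fields in $[H^1(\Omega)]^2$ whose restriction to each $P$ lies in $\mathcal{TV}_h(P)$, where, with $\mathcal{G}_2^\perp(P)$ the $L^2$-orthogonal complement of $\nabla\mathbb{P}_3(P)$ in $[\mathbb{P}_2(P)]^2$, $\mathbf{U}_h(P)=\{\mathbf{v}\in[H^1(P)]^2:\mathbf{v}|_{\partial P}$ continuous and quadratic on each edge, $\mathrm{div}\,\mathbf{v}\in\mathbb{P}_0(P)$, $-\Delta\mathbf{v}-\nabla s=\mathbf{g}^\perp$ for some $s\in L^2_0(P)$, $\mathbf{g}^\perp\in\mathcal{G}_2^\perp(P)\}$ and $\mathcal{TV}_h(P)=\{\mathbf{v}\in\mathbf{U}_h(P):(\mathbf{v}-\Pi^\nabla_P\mathbf{v},\mathbf{g}^\perp)_P=0$ for all $\mathbf{g}^\perp\in\mathcal{G}_2^\perp(P)/\mathbb{R}^2\}$;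 dofs: values at vertices and edge midpoints. $\mathcal{TV}_{h,0}$: those vanishing on $\partial\Omega$. Here, with $\mathbf{P}(P)=\{\mathbf{q}\in[\mathbb{P}_2(P)]^2:\mathrm{div}\,\mathbf{q}\in\mathbb{P}_0(P)\}$, $\Pi^\nabla_P\mathbf{v}\in\mathbf{P}(P)$ is defined by $(\nabla\Pi^\nabla_P\mathbf{v},\nabla\mathbf{q})_P=(\nabla\mathbf{v},\nabla\mathbf{q})_P$ for all $\mathbf{q}\in\mathbf{P}(P)$ and equality of the sums of the values of $\Pi^\nabla_P\mathbf{v}$ and $\mathbf{v}$ at all vertices and edge midpoints of $P$. Inner products (all sums over cells). On $\mathcal{V}_h$: $(E,D)_{\mathcal{V}_h}=\sum_P[(\Pi_PE,\Pi_PD)_P+\mathcal{S}^{\mathsf v}((1-\Pi_P)E,(1-\Pi_P)D)]$ with $\Pi_P:\mathcal{V}_h(P)\to\mathbb{P}_1(P)$ a reconstruction operator that depends only on the vertex values, reproduces $\mathbb{P}_1(P)$ and is $L^2$-bounded uniformly in $h$. On $\mathcal{E}_h$: $(\mathbf{B},\mathbf{C})_{\mathcal{E}_h}=\sum_P[(\Pi^0_P\mathbf{B},\Pi^0_P\mathbf{C})_P+\mathcal{S}^{\mathsf e}((1-\Pi^0_P)\mathbf{B},(1-\Pi^0_P)\mathbf{C})]$ with $\Pi_P^0$ the $L^2$ projection onto $[\mathbb{P}_0(P)]^2$. On $\mathcal{P}_h$: the $L^2(\Omega)$ inner product. On $\mathcal{TV}_h$: $(\mathbf{u},\mathbf{v})_{\mathcal{TV}_h}=\sum_P[(\Pi^0_P\mathbf{u},\Pi^0_P\mathbf{v})_P+\mathcal{S}^{\mathcal{TV}_h}_P((1-\Pi^0_P)\mathbf{u},(1-\Pi^0_P)\mathbf{v})]$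 with here $\Pi^0_P$ the $L^2$ projection onto $\mathbf{P}(P)$, and the semi-inner product $[\mathbf{u},\mathbf{v}]_{\mathcal{TV}_h}=\sum_P[(\nabla\Pi^\nabla_P\mathbf{u},\nabla\Pi^\nabla_P\mathbf{v})_P+\mathcal{T}^{\mathcal{TV}_h}_P(\nabla(1-\Pi^\nabla_P)\mathbf{u},\nabla(1-\Pi^\nabla_P)\mathbf{v})]$. Each $\mathcal{S}$ is a continuous bilinear form with $s_*\|w\|_{0,P}^2\le\mathcal{S}(w,w)\le s^*\|w\|_{0,P}^2$ on the kernel of the corresponding projector, and $t_*\|\nabla\mathbf{w}\|_{0,P}^2\le\mathcal{T}^{\mathcal{TV}_h}_P(\nabla\mathbf{w},\nabla\mathbf{w})\le t^*\|\nabla\mathbf{w}\|_{0,P}^2$ on the kernel of $\Pi^\nabla_P$, with positive constants independent of $h$. The norms induced by $(\cdot,\cdot)_{\mathcal{V}_h}$, $(\cdot,\cdot)_{\mathcal{E}_h}$, $(\cdot,\cdot)_{\mathcal{TV}_h}$ are equivalent to the $L^2(\Omega)$ norm. Interpolation. $\mathcal{I}^{\mathcal{V}_h}$, $\mathcal{I}^{\mathcal{TV}_h}$ and $\mathcal{I}^{\mathcal{E}_h}:H(\mathrm{div};\Omega)\to\mathcal{E}_h$ return the function of $\mathcal{V}_h$, $\mathcal{TV}_h$, resp. $\mathcal{E}_h$, with the same dofs as the argument; in particular $\int_e\mathcal{I}^{\mathcal{E}_h}(\mathbf{C})\cdot\mathbf{n}\,d\ell=\int_e\mathbf{C}\cdot\mathbf{n}\,d\ell$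 for all mesh edges. $\Pi^{RT}$ is, cell by cell, the $L^2$ projection of $\mathcal{E}_h(P)$ onto $\mathrm{RT}_0(P)=\{(a,b)^T+c(x,y)^T:a,b,c\in\mathbb{R}\}$; the vertex evaluations of the magnetic field needed in $\mathcal{I}^{\mathcal{V}_h}(\mathbf{v}\times\Pi^{RT}\mathbf{B})$ are extracted from this projection. The map $G$ at time step $n\to n+1$. $\mathcal{X}_{h,0}$ is the linear space of column vectors of dofs of elements of $\mathcal{TV}_{h,0}\times\mathcal{E}_h\times\mathcal{V}_{h,0}\times\mathcal{P}_{h,0}$, with the Euclidean product. $\mathbf{u}_b,E_b$ are extensions to $\Omega$ of the boundary data, and $\mathbf{f}_h$ is a given discrete load. For $x_h\leftrightarrow(\hat{\mathbf{u}}_h,\mathbf{B}_h,\hat E_h,p_h)$ put $\mathbf{u}_h=\hat{\mathbf{u}}_h+\mathcal{I}^{\mathcal{TV}_h}(\mathbf{u}_b(t^{n+1}))$, $E_h=\hat E_h+\mathcal{I}^{\mathcal{V}_h}(E_b(t^{n+\theta}))$, $\mathbf{u}_h^\theta=(1-\theta)\mathbf{u}_h^n+\theta\mathbf{u}_h$, $\mathbf{B}_h^\theta=(1-\theta)\mathbf{B}_h^n+\theta\mathbf{B}_h$, $J_h=E_h+\mathcal{I}^{\mathcal{V}_h}(\mathbf{u}_h^\theta\times\Pi^{RT}\mathbf{B}_h^\theta)$, where $t^{n}=n\Delta t$, $t^{n+\theta}=(n+\theta)\Delta t$. Then $G(x_h)$ is defined by requiring, for all $y_h\leftrightarrow(\mathbf{v}_h,\mathbf{C}_h,D_h,q_h)$,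 $$\begin{aligned}G(x_h)\cdot y_h=&\Big(\tfrac{\mathbf{u}_h-\mathbf{u}_h^n}{\Delta t},\mathbf{v}_h\Big)_{\mathcal{TV}_h}+R_e^{-1}[\mathbf{u}_h^\theta,\mathbf{v}_h]_{\mathcal{TV}_h}+\big(J_h,\mathcal{I}^{\mathcal{V}_h}(\mathbf{v}_h\times\Pi^{RT}\mathbf{B}_h^\theta)\big)_{\mathcal{V}_h}-(p_h,\mathrm{div}\,\mathbf{v}_h)_{\mathcal{P}_h}-(\mathbf{f}_h,\mathbf{v}_h)_{\mathcal{TV}_h}\\&+(\mathrm{div}\,\mathbf{u}_h^\theta,q_h)_{\mathcal{P}_h}+\theta R_m^{-1}\Big(\tfrac{\mathbf{B}_h-\mathbf{B}_h^n}{\Delta t},\mathbf{C}_h\Big)_{\mathcal{E}_h}+\theta R_m^{-1}(\mathbf{rot}\,E_h,\mathbf{C}_h)_{\mathcal{E}_h}+(J_h,D_h)_{\mathcal{V}_h}-R_m^{-1}(\mathbf{B}_h^\theta,\mathbf{rot}\,D_h)_{\mathcal{E}_h}.\end{aligned}$$ The terms tested with $\mathbf{C}_h$ are the discrete Faraday law $\big(\tfrac{\mathbf{B}_h-\mathbf{B}_h^n}{\Delta t},\mathbf{C}_h\big)_{\mathcal{E}_h}+(\mathbf{rot}\,E_h,\mathbf{C}_h)_{\mathcal{E}_h}=0$ multiplied by $\theta R_m^{-1}$, which is regarded as an equivalent expression of that law. The finite-difference Jacobian action is $DG(x_h)\delta x_h=\big(G(x_h+\epsilon\,\delta x_h)-G(x_h)\big)/\epsilon$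 with $\epsilon=10^{-7}$. The iteration. $\mathbf{u}_h^0=\mathcal{I}^{\mathcal{TV}_h}(\mathbf{u}_0)$ for a given initial velocity $\mathbf{u}_0$, and $\hat{\mathbf{u}}_h^n=\mathbf{u}_h^n-\mathcal{I}^{\mathcal{TV}_h}(\mathbf{u}_b(t^n))$. At each time step the initial guess $x_h^{(0)}$ is the vector of dofs of $(\hat{\mathbf{u}}_h^n,\mathbf{B}_h^n,\hat E_h^{n-1+\theta},p_h^{n-1+\theta})$ if $n>0$ and of $(\hat{\mathbf{u}}_h^0,\mathbf{B}_h^0,0,0)$ if $n=0$. After $M$ iterations, $(\hat{\mathbf{u}}_h^{n+1},\mathbf{B}_h^{n+1},\hat E_h^{n+\theta},p_h^{n+\theta})$ is the tuple with dofs $x_h^{(M)}$.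
   Formalization: For θ=0 the Faraday terms in G carry factor 1 instead of θ/R_m=0 (with factor 0 the magnetic update is unconstrained and the claim fails); edge integrals of general H(div) fields, undefined classically, are any edge values that agree with integrable normal traces and sum to the cell integral of div. *)

theory Defs
  imports "HOL-Analysis.Analysis"
begin

type_synonym pt = "real^2"
type_synonym scal = "pt \<Rightarrow> real"
type_synonym vect = "pt \<Rightarrow> real^2"
type_synonym tens = "pt \<Rightarrow> real^2^2"
type_synonym cell = "pt list"
type_synonym edge = "pt \<times> pt"


section \<open>Smooth functions and classical differential operators\<close>

definition pd :: "2 \<Rightarrow> scal \<Rightarrow> scal" where
  "pd i f x = frechet_derivative f (at x) (axis i 1)"

primrec C_class :: "nat \<Rightarrow> scal \<Rightarrow> bool" where
  "C_class 0 f \<longleftrightarrow> continuous_on UNIV f"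
| "C_class (Suc k) f \<longleftrightarrow> f differentiable_on UNIV \<and> (\<forall>i. C_class k (pd i f))"

definition smooth :: "scal \<Rightarrow> bool" where
  "smooth f \<longleftrightarrow> (\<forall>k. C_class k f)"

definition smooth_vec :: "vect \<Rightarrow> bool" where
  "smooth_vec \<psi> \<longleftrightarrow> (\<forall>i. smooth (\<lambda>x. \<psi> x $ i))"

definition test_fun :: "pt set \<Rightarrow> scal \<Rightarrow> bool" where
  "test_fun U \<phi> \<longleftrightarrow> smooth \<phi> \<and> compact (closure {x. \<phi> x \<noteq> 0}) \<and> closure {x. \<phi> x \<noteq> 0} \<subseteq> U"

definition test_vec :: "pt set \<Rightarrow> vect \<Rightarrow> bool" where
  "test_vec U \<psi> \<longleftrightarrow> (\<forall>i. test_fun U (\<lambda>x. \<psi> x $ i))"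

definition grad :: "scal \<Rightarrow> vect" where
  "grad f x = (\<chi> i. pd i f x)"

definition jac :: "vect \<Rightarrow> tens" where
  "jac v x = (\<chi> i. grad (\<lambda>y. v y $ i) x)"

definition cdiv :: "vect \<Rightarrow> scal" where
  "cdiv v x = pd 1 (\<lambda>y. v y $ 1) x + pd 2 (\<lambda>y. v y $ 2) x"

definition crot :: "vect \<Rightarrow> scal" where
  "crot v x = pd 1 (\<lambda>y. v y $ 2) x - pd 2 (\<lambda>y. v y $ 1) x"

definition crotv :: "scal \<Rightarrow> vect" where
  "crotv f x = vector [pd 2 f x, - pd 1 f x]"


section \<open>Square integrable functions and weak differential operators\<close>

text \<open>Elements of the Lebesgue and Sobolev spaces are represented by functions on the whole plane, of
  which only the values almost everywhere on the set under consideration matter.\<close>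

definition L2 :: "pt set \<Rightarrow> (pt \<Rightarrow> 'b::euclidean_space) \<Rightarrow> bool" where
  "L2 U f \<longleftrightarrow> set_borel_measurable lebesgue U f \<and> set_integrable lebesgue U (\<lambda>x. (norm (f x))\<^sup>2)"

definition l2 :: "pt set \<Rightarrow> (pt \<Rightarrow> 'b::euclidean_space) \<Rightarrow> (pt \<Rightarrow> 'b) \<Rightarrow> real" where
  "l2 U f g = (LINT x:U|lebesgue. f x \<bullet> g x)"

definition l2norm :: "pt set \<Rightarrow> (pt \<Rightarrow> 'b::euclidean_space) \<Rightarrow> real" where
  "l2norm U f = sqrt (l2 U f f)"

definition weak_grad :: "pt set \<Rightarrow> scal \<Rightarrow> vect \<Rightarrow> bool" where
  "weak_grad U f F \<longleftrightarrow> (\<forall>\<psi>. test_vec U \<psi> \<longrightarrow> l2 U f (cdiv \<psi>) = - l2 U F \<psi>)"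

definition weak_rotv :: "pt set \<Rightarrow> scal \<Rightarrow> vect \<Rightarrow> bool" where
  "weak_rotv U D F \<longleftrightarrow> (\<forall>\<psi>. test_vec U \<psi> \<longrightarrow> l2 U D (crot \<psi>) = l2 U F \<psi>)"

definition weak_div :: "pt set \<Rightarrow> vect \<Rightarrow> scal \<Rightarrow> bool" where
  "weak_div U C d \<longleftrightarrow> (\<forall>\<phi>. test_fun U \<phi> \<longrightarrow> l2 U C (grad \<phi>) = - l2 U d \<phi>)"

definition weak_rot :: "pt set \<Rightarrow> vect \<Rightarrow> scal \<Rightarrow> bool" where
  "weak_rot U C w \<longleftrightarrow> (\<forall>\<phi>. test_fun U \<phi> \<longrightarrow> l2 U C (crotv \<phi>) = l2 U w \<phi>)"

definition H1 :: "pt set \<Rightarrow> scal set" where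
  "H1 U = {f. L2 U f \<and> (\<exists>F. L2 U F \<and> weak_grad U f F)}"

definition H1_vec :: "pt set \<Rightarrow> vect set" where
  "H1_vec U = {v. \<forall>i. (\<lambda>x. v x $ i) \<in> H1 U}"

definition Hrotv :: "pt set \<Rightarrow> scal set" where
  "Hrotv U = {D. L2 U D \<and> (\<exists>F. L2 U F \<and> weak_rotv U D F)}"

definition Hdiv :: "pt set \<Rightarrow> vect set" where
  "Hdiv U = {C. L2 U C \<and> (\<exists>d. L2 U d \<and> weak_div U C d)}"

definition Hrot :: "pt set \<Rightarrow> vect set" where
  "Hrot U = {C. L2 U C \<and> (\<exists>w. L2 U w \<and> weak_rot U C w)}"

text \<open>Weak derivatives are unique almost everywhere, so the representative picked below is
  immaterial.\<close>

definition wgrad :: "pt set \<Rightarrow> scal \<Rightarrow> vect" where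
  "wgrad U f = (SOME F. L2 U F \<and> weak_grad U f F)"

definition wjac :: "pt set \<Rightarrow> vect \<Rightarrow> tens" where
  "wjac U v x = (\<chi> i. wgrad U (\<lambda>y. v y $ i) x)"

definition wrotv :: "pt set \<Rightarrow> scal \<Rightarrow> vect" where
  "wrotv U D = (SOME F. L2 U F \<and> weak_rotv U D F)"

definition wdiv :: "pt set \<Rightarrow> vect \<Rightarrow> scal" where
  "wdiv U C = (SOME d. L2 U d \<and> weak_div U C d)"


section \<open>Polynomials\<close>

definition poly2 :: "nat \<Rightarrow> scal set" where
  "poly2 k = {f. \<exists>a :: nat \<Rightarrow> nat \<Rightarrow> real. f = (\<lambda>x. \<Sum>i\<le>k. \<Sum>j\<le>k - i. a i j * (x $ 1) ^ i * (x $ 2) ^ j)}"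

definition poly2_vec :: "nat \<Rightarrow> vect set" where
  "poly2_vec k = {q. \<forall>i. (\<lambda>x. q x $ i) \<in> poly2 k}"

text \<open>Quadratic fields with constant divergence.\<close>

definition PP :: "vect set" where
  "PP = {q \<in> poly2_vec 2. cdiv q \<in> poly2 0}"

definition RT0 :: "vect set" where
  "RT0 = {q. \<exists>a b c. q = (\<lambda>x. vector [a, b] + c *\<^sub>R x)}"

text \<open>\<open>L2\<close>-orthogonal projection onto a finite dimensional space \<open>W\<close> of polynomial fields; since a
  polynomial is determined by its values on a nonempty open set, the projection is a well-defined
  field on the whole plane and may be evaluated pointwise.\<close>

definition l2proj :: "pt set \<Rightarrow> vect set \<Rightarrow> vect \<Rightarrow> vect" where
  "l2proj U W f = (THE q. q \<in> W \<and> (\<forall>r\<in>W. l2 U q r = l2 U f r))"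


section \<open>Polygonal cells\<close>

text \<open>A cell is given by the list of its vertices in counterclockwise order; consecutive edges may be
  collinear, so hanging nodes are vertices.\<close>

definition edges :: "cell \<Rightarrow> edge set" where
  "edges P = set (zip P (rotate1 P))"

definition bdry :: "cell \<Rightarrow> pt set" where
  "bdry P = (\<Union>(a, b)\<in>edges P. closed_segment a b)"

definition region :: "cell \<Rightarrow> pt set" where
  "region P = inside (bdry P)"

definition polygon :: "cell \<Rightarrow> bool" where
  "polygon P \<longleftrightarrow> length P \<ge> 3 \<and> distinct P
     \<and> (\<forall>(a, b)\<in>edges P. \<forall>(c, d)\<in>edges P. (a, b) \<noteq> (c, d) \<longrightarrow>
           closed_segment a b \<inter> closed_segment c d \<subseteq> {a, b} \<inter> {c, d})
     \<and> (\<Sum>(a, b)\<in>edges P. a $ 1 * b $ 2 - a $ 2 * b $ 1) > 0"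

text \<open>Vertices and edge midpoints.\<close>

definition nodes :: "cell \<Rightarrow> pt set" where
  "nodes P = set P \<union> (\<lambda>(a, b). midpoint a b) ` edges P"

text \<open>The tangent turned clockwise: along a counterclockwise boundary this is the outward normal.\<close>

definition normal :: "edge \<Rightarrow> real^2" where
  "normal = (\<lambda>(a, b). (1 / dist a b) *\<^sub>R vector [b $ 2 - a $ 2, a $ 1 - b $ 1])"

definition edge_length :: "edge \<Rightarrow> real" where
  "edge_length = (\<lambda>(a, b). dist a b)"

definition edge_int :: "edge \<Rightarrow> scal \<Rightarrow> real" where
  "edge_int = (\<lambda>(a, b) f. dist a b * (LINT t:{0..1}|lborel. f (linepath a b t)))"

definition edge_integrable :: "edge \<Rightarrow> scal \<Rightarrow> bool" where
  "edge_integrable = (\<lambda>(a, b) f. set_integrable lborel {0..1} (\<lambda>t. f (linepath a b t)))"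

definition edge_poly :: "nat \<Rightarrow> edge \<Rightarrow> scal \<Rightarrow> bool" where
  "edge_poly k = (\<lambda>(a, b) f. \<exists>c :: nat \<Rightarrow> real. \<forall>t\<in>{0..1}. f (linepath a b t) = (\<Sum>i\<le>k. c i * t ^ i))"

definition shape_regular :: "real \<Rightarrow> cell \<Rightarrow> bool" where
  "shape_regular \<rho> P \<longleftrightarrow>
     (\<exists>c. ball c (\<rho> * diameter (region P)) \<subseteq> region P
        \<and> (\<forall>y\<in>ball c (\<rho> * diameter (region P)). \<forall>x\<in>region P. closed_segment y x \<subseteq> region P))
     \<and> (\<forall>e\<in>edges P. edge_length e \<ge> \<rho> * diameter (region P))"

definition polygonal_domain :: "pt set \<Rightarrow> bool" where
  "polygonal_domain U \<longleftrightarrow> open U \<and> bounded U \<and> connected U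
     \<and> (\<exists>S :: edge set. finite S \<and> frontier U = (\<Union>(a, b)\<in>S. closed_segment a b))"

definition mesh_of :: "pt set \<Rightarrow> real \<Rightarrow> cell set \<Rightarrow> bool" where
  "mesh_of U \<rho> T \<longleftrightarrow> finite T \<and> (\<forall>P\<in>T. polygon P \<and> region P \<subseteq> U \<and> shape_regular \<rho> P)
     \<and> (\<forall>P\<in>T. \<forall>Q\<in>T. P \<noteq> Q \<longrightarrow> region P \<inter> region Q = {})
     \<and> closure U = (\<Union>P\<in>T. closure (region P))"


section \<open>Traces\<close>

text \<open>\<open>g\<close> is the (continuous) trace on the cell boundary of the \<open>H1\<close> function \<open>D\<close>, expressed by Green's
  formula. A scalar function has a square integrable \<open>rotv\<close> iff it is in \<open>H1\<close>, so this also applies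
  to \<open>Hrotv\<close>.\<close>

definition is_trace :: "cell \<Rightarrow> scal \<Rightarrow> scal \<Rightarrow> bool" where
  "is_trace P D g \<longleftrightarrow> D \<in> H1 (region P) \<and> continuous_on (bdry P) g
     \<and> (\<forall>\<psi>. smooth_vec \<psi> \<longrightarrow>
          l2 (region P) D (cdiv \<psi>) + l2 (region P) (wgrad (region P) D) \<psi>
            = (\<Sum>e\<in>edges P. edge_int e (\<lambda>x. g x * (\<psi> x \<bullet> normal e))))"

definition is_trace_vec :: "cell \<Rightarrow> vect \<Rightarrow> vect \<Rightarrow> bool" where
  "is_trace_vec P v g \<longleftrightarrow> (\<forall>i. is_trace P (\<lambda>x. v x $ i) (\<lambda>x. g x $ i))"

text \<open>\<open>g e\<close> is, for each edge \<open>e\<close>, the outward normal component on \<open>e\<close> of the \<open>Hdiv\<close> field \<open>C\<close>, whose normal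
  trace (the functional on the left-hand side) is assumed to be an integrable function.\<close>

definition is_normal_trace :: "cell \<Rightarrow> vect \<Rightarrow> (edge \<Rightarrow> scal) \<Rightarrow> bool" where
  "is_normal_trace P C g \<longleftrightarrow> C \<in> Hdiv (region P) \<and> (\<forall>e\<in>edges P. edge_integrable e (g e))
     \<and> (\<forall>\<phi>. smooth \<phi> \<longrightarrow>
          l2 (region P) C (grad \<phi>) + l2 (region P) (wdiv (region P) C) \<phi>
            = (\<Sum>e\<in>edges P. edge_int e (\<lambda>x. g e x * \<phi> x)))"

text \<open>Degrees of freedom of fields on a mesh. Edge fluxes are indexed by directed edges, a flux being
  taken along \<open>normal\<close>.\<close>

definition vertex_values :: "cell set \<Rightarrow> scal \<Rightarrow> scal \<Rightarrow> bool" where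
  "vertex_values T D d \<longleftrightarrow> (\<forall>P\<in>T. \<exists>g. is_trace P D g \<and> (\<forall>x\<in>set P. g x = d x))"

definition node_values :: "cell set \<Rightarrow> vect \<Rightarrow> vect \<Rightarrow> bool" where
  "node_values T v d \<longleftrightarrow> (\<forall>P\<in>T. \<exists>g. is_trace_vec P v g \<and> (\<forall>x\<in>nodes P. g x = d x))"

definition edge_fluxes :: "cell set \<Rightarrow> vect \<Rightarrow> (edge \<Rightarrow> real) \<Rightarrow> bool" where
  "edge_fluxes T C d \<longleftrightarrow>
     (\<forall>P\<in>T. \<exists>g. is_normal_trace P C g \<and> (\<forall>e\<in>edges P. edge_int e (g e) = d e))"

text \<open>The values at the nodes as a function; off the nodes it is arbitrary.\<close>

definition node_val :: "cell set \<Rightarrow> vect \<Rightarrow> vect" where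
  "node_val T v = (SOME d. node_values T v d)"


section \<open>Local and global discrete spaces\<close>

definition VhP :: "cell \<Rightarrow> scal set" where
  "VhP P = {D \<in> Hrotv (region P).
     (\<exists>g. is_trace P D g \<and> (\<forall>e\<in>edges P. edge_poly 1 e g))
     \<and> weak_rot (region P) (wrotv (region P) D) (\<lambda>_. 0)}"

definition Vh :: "pt set \<Rightarrow> cell set \<Rightarrow> scal set" where
  "Vh U T = {D \<in> Hrotv U. \<forall>P\<in>T. D \<in> VhP P}"

definition Vh0 :: "pt set \<Rightarrow> cell set \<Rightarrow> scal set" where
  "Vh0 U T = {D \<in> Vh U T. \<forall>P\<in>T. \<exists>g. is_trace P D g \<and> (\<forall>x\<in>bdry P \<inter> frontier U. g x = 0)}"

definition EhP :: "cell \<Rightarrow> vect set" where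
  "EhP P = {C \<in> Hdiv (region P) \<inter> Hrot (region P).
     (\<exists>c. weak_div (region P) C (\<lambda>_. c)) \<and> weak_rot (region P) C (\<lambda>_. 0)
     \<and> (\<exists>c :: edge \<Rightarrow> real. is_normal_trace P C (\<lambda>e _. c e))}"

definition Eh :: "pt set \<Rightarrow> cell set \<Rightarrow> vect set" where
  "Eh U T = {C \<in> Hdiv U. \<forall>P\<in>T. C \<in> EhP P}"

definition Ph :: "cell set \<Rightarrow> scal set" where
  "Ph T = {q. \<forall>P\<in>T. \<exists>c. AE x in lebesgue. x \<in> region P \<longrightarrow> q x = c}"

definition Ph0 :: "pt set \<Rightarrow> cell set \<Rightarrow> scal set" where
  "Ph0 U T = {q \<in> Ph T. L2 U q \<and> (LINT x:U|lebesgue. q x) = 0}"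

text \<open>The \<open>L2\<close>-orthogonal complement of the gradients of cubics in the quadratic fields.\<close>

definition Gperp :: "cell \<Rightarrow> vect set" where
  "Gperp P = {g \<in> poly2_vec 2. \<forall>p\<in>poly2 3. l2 (region P) g (grad p) = 0}"

definition UhP :: "cell \<Rightarrow> vect set" where
  "UhP P = {v \<in> H1_vec (region P).
     (\<exists>g. is_trace_vec P v g \<and> (\<forall>e\<in>edges P. \<forall>i. edge_poly 2 e (\<lambda>x. g x $ i)))
     \<and> (\<exists>c. weak_div (region P) v (\<lambda>_. c))
     \<and> (\<exists>s g. L2 (region P) s \<and> (LINT x:region P|lebesgue. s x) = 0 \<and> g \<in> Gperp P
          \<and> (\<forall>\<psi>. test_vec (region P) \<psi> \<longrightarrow>
                l2 (region P) (wjac (region P) v) (jac \<psi>) + l2 (region P) s (cdiv \<psi>)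
                  = l2 (region P) g \<psi>))}"

definition is_PiNabla :: "cell \<Rightarrow> vect \<Rightarrow> vect \<Rightarrow> bool" where
  "is_PiNabla P v q \<longleftrightarrow> q \<in> PP
     \<and> (\<forall>r\<in>PP. l2 (region P) (jac q) (jac r) = l2 (region P) (wjac (region P) v) (jac r))
     \<and> (\<exists>g. is_trace_vec P v g \<and> (\<Sum>x\<in>nodes P. q x) = (\<Sum>x\<in>nodes P. g x))"

definition PiNabla :: "cell \<Rightarrow> vect \<Rightarrow> vect" where
  "PiNabla P v = (THE q. is_PiNabla P v q)"

text \<open>Constants are gradients, so every element of \<open>Gperp P\<close> is orthogonal to the constants and passing
  to the quotient by the constants leaves \<open>Gperp P\<close> unchanged.\<close>

definition TVhP :: "cell \<Rightarrow> vect set" where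
  "TVhP P = {v \<in> UhP P. \<exists>q. is_PiNabla P v q \<and> (\<forall>g\<in>Gperp P. l2 (region P) (\<lambda>x. v x - q x) g = 0)}"

definition TVh :: "pt set \<Rightarrow> cell set \<Rightarrow> vect set" where
  "TVh U T = {v \<in> H1_vec U. \<forall>P\<in>T. v \<in> TVhP P}"

definition TVh0 :: "pt set \<Rightarrow> cell set \<Rightarrow> vect set" where
  "TVh0 U T = {v \<in> TVh U T. \<forall>P\<in>T. \<exists>g. is_trace_vec P v g \<and> (\<forall>x\<in>bdry P \<inter> frontier U. g x = 0)}"


section \<open>Data of the scheme\<close>

text \<open>Besides the domain, the mesh, the physical and numerical parameters and the boundary data, the
  record holds:
  \<^item> \<open>PiV\<close>, the reconstruction operator; \<open>SV\<close>, \<open>SE\<close>, \<open>STV\<close>, \<open>TTV\<close>, the stabilising forms;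
  \<^item> \<open>vwt x P\<close>, the weight of the cell \<open>P\<close> in the extraction of a value at the vertex \<open>x\<close> from the
    cellwise polynomial field \<open>\<Pi>\<^sup>R\<^sup>T B\<close>, which is multivalued at \<open>x\<close>;
  \<^item> \<open>flux C e\<close>, the meaning of the integral over \<open>e\<close> of the normal component of \<open>C\<close>, for any field \<open>C\<close> in
    \<open>Hdiv\<close> of the domain (whose normal trace need not be a function);
  \<^item> \<open>IV\<close>, \<open>ITV\<close>, \<open>IE\<close>, the interpolation operators; the first two act on pointwise defined
    functions, of which they see only the values at the vertices, respectively nodes.\<close>

record scheme =
  Om :: "pt set"
  msh :: "cell set"
  Rey :: real
  Rmag :: real
  theta :: real
  dt :: real
  ub :: "real \<Rightarrow> vect"
  Eb :: "real \<Rightarrow> scal"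
  PiV :: "cell \<Rightarrow> scal \<Rightarrow> scal"
  SV :: "cell \<Rightarrow> scal \<Rightarrow> scal \<Rightarrow> real"
  SE :: "cell \<Rightarrow> vect \<Rightarrow> vect \<Rightarrow> real"
  STV :: "cell \<Rightarrow> vect \<Rightarrow> vect \<Rightarrow> real"
  TTV :: "cell \<Rightarrow> tens \<Rightarrow> tens \<Rightarrow> real"
  vwt :: "pt \<Rightarrow> cell \<Rightarrow> real"
  flux :: "vect \<Rightarrow> edge \<Rightarrow> real"
  IV :: "scal \<Rightarrow> scal"
  ITV :: "vect \<Rightarrow> vect"
  IE :: "vect \<Rightarrow> vect"

definition bilinear_on :: "(pt \<Rightarrow> 'b::real_vector) set \<Rightarrow> ((pt \<Rightarrow> 'b) \<Rightarrow> (pt \<Rightarrow> 'b) \<Rightarrow> real) \<Rightarrow> bool" where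
  "bilinear_on W S \<longleftrightarrow> (\<forall>f\<in>W. \<forall>g\<in>W. \<forall>k\<in>W. \<forall>a.
      S (\<lambda>x. a *\<^sub>R f x + g x) k = a * S f k + S g k
    \<and> S k (\<lambda>x. a *\<^sub>R f x + g x) = a * S k f + S k g)"

definition stabilising ::
  "pt set \<Rightarrow> (pt \<Rightarrow> 'b::euclidean_space) set \<Rightarrow> (pt \<Rightarrow> 'b) set \<Rightarrow> real \<Rightarrow> real
     \<Rightarrow> ((pt \<Rightarrow> 'b) \<Rightarrow> (pt \<Rightarrow> 'b) \<Rightarrow> real) \<Rightarrow> bool" where
  "stabilising U W K lo hi S \<longleftrightarrow> bilinear_on W S
     \<and> (\<exists>M. \<forall>f\<in>W. \<forall>g\<in>W. \<bar>S f g\<bar> \<le> M * l2norm U f * l2norm U g)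
     \<and> (\<forall>f\<in>K. lo * (l2norm U f)\<^sup>2 \<le> S f f \<and> S f f \<le> hi * (l2norm U f)\<^sup>2)"

definition consts0 :: "vect set" where
  "consts0 = {q. \<exists>c. q = (\<lambda>_. c)}"

definition gradients :: "cell \<Rightarrow> vect set \<Rightarrow> tens set" where
  "gradients P W = {F. L2 (region P) F \<and> (\<exists>w\<in>W. \<forall>i. weak_grad (region P) (\<lambda>x. w x $ i) (\<lambda>x. F x $ i))}"

definition reconstruction :: "cell \<Rightarrow> real \<Rightarrow> (scal \<Rightarrow> scal) \<Rightarrow> bool" where
  "reconstruction P c R \<longleftrightarrow>
     (\<forall>D\<in>VhP P. R D \<in> poly2 1 \<and> l2norm (region P) (R D) \<le> c * l2norm (region P) D)
     \<and> (\<forall>D\<in>VhP P. \<forall>E\<in>VhP P. \<forall>a. R (\<lambda>x. a * D x + E x) = (\<lambda>x. a * R D x + R E x))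
     \<and> (\<forall>D\<in>VhP P. \<forall>E\<in>VhP P. \<forall>d. vertex_values {P} D d \<and> vertex_values {P} E d \<longrightarrow> R D = R E)
     \<and> (\<forall>p\<in>poly2 1. R p = p)"

text \<open>On a cell boundary, edge fluxes are required to add up to the duality pairing of the normal trace with the
  constant 1, i.e. to the integral of the divergence over the cell.\<close>

definition flux_functional :: "pt set \<Rightarrow> cell set \<Rightarrow> (vect \<Rightarrow> edge \<Rightarrow> real) \<Rightarrow> bool" where
  "flux_functional U T fl \<longleftrightarrow> (\<forall>C\<in>Hdiv U.
       (\<forall>P\<in>T. \<forall>(a, b)\<in>edges P. fl C (b, a) = - fl C (a, b))
     \<and> (\<forall>P\<in>T. \<forall>g. is_normal_trace P C g \<longrightarrow> (\<forall>e\<in>edges P. fl C e = edge_int e (g e)))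
     \<and> (\<forall>P\<in>T. (\<Sum>e\<in>edges P. fl C e) = (LINT x:region P|lebesgue. wdiv U C x)))"

text \<open>\<open>\<rho>\<close> is the shape regularity constant, \<open>c\<close> the bound on the reconstruction operator and \<open>lo\<close>, \<open>hi\<close>
  are common lower and upper bounds for all stabilising forms.\<close>

definition admissible :: "scheme \<Rightarrow> real \<Rightarrow> real \<Rightarrow> real \<Rightarrow> real \<Rightarrow> bool" where
  "admissible s \<rho> c lo hi \<longleftrightarrow>
     polygonal_domain (Om s) \<and> \<rho> > 0 \<and> mesh_of (Om s) \<rho> (msh s)
     \<and> Rey s > 0 \<and> Rmag s > 0 \<and> c > 0 \<and> lo > 0 \<and> hi > 0
     \<and> (\<forall>P\<in>msh s.
          reconstruction P c (PiV s P)
        \<and> stabilising (region P) (VhP P) {D \<in> VhP P. PiV s P D = (\<lambda>_. 0)} lo hi (SV s P)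
        \<and> stabilising (region P) (EhP P) {C \<in> EhP P. l2proj (region P) consts0 C = (\<lambda>_. 0)} lo hi (SE s P)
        \<and> stabilising (region P) (TVhP P) {v \<in> TVhP P. l2proj (region P) PP v = (\<lambda>_. 0)} lo hi (STV s P)
        \<and> stabilising (region P) (gradients P (TVhP P)) (gradients P {v \<in> TVhP P. PiNabla P v = (\<lambda>_. 0)})
            lo hi (TTV s P))
     \<and> (\<forall>x\<in>(\<Union>P\<in>msh s. set P). (\<Sum>P\<in>{P \<in> msh s. x \<in> set P}. vwt s x P) = 1)
     \<and> (\<forall>f. IV s f \<in> Vh (Om s) (msh s) \<and> vertex_values (msh s) (IV s f) f)
     \<and> (\<forall>f. ITV s f \<in> TVh (Om s) (msh s) \<and> node_values (msh s) (ITV s f) f)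
     \<and> flux_functional (Om s) (msh s) (flux s)
     \<and> (\<forall>C\<in>Hdiv (Om s). IE s C \<in> Eh (Om s) (msh s) \<and> edge_fluxes (msh s) (IE s C) (flux s C))"


section \<open>Discrete inner products\<close>

definition ipV :: "scheme \<Rightarrow> scal \<Rightarrow> scal \<Rightarrow> real" where
  "ipV s E D = (\<Sum>P\<in>msh s. l2 (region P) (PiV s P E) (PiV s P D)
      + SV s P (\<lambda>x. E x - PiV s P E x) (\<lambda>x. D x - PiV s P D x))"

definition ipE :: "scheme \<Rightarrow> vect \<Rightarrow> vect \<Rightarrow> real" where
  "ipE s B C = (\<Sum>P\<in>msh s. let pr = l2proj (region P) consts0 in
      l2 (region P) (pr B) (pr C) + SE s P (\<lambda>x. B x - pr B x) (\<lambda>x. C x - pr C x))"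

definition ipTV :: "scheme \<Rightarrow> vect \<Rightarrow> vect \<Rightarrow> real" where
  "ipTV s u v = (\<Sum>P\<in>msh s. let pr = l2proj (region P) PP in
      l2 (region P) (pr u) (pr v) + STV s P (\<lambda>x. u x - pr u x) (\<lambda>x. v x - pr v x))"

definition semi_ipTV :: "scheme \<Rightarrow> vect \<Rightarrow> vect \<Rightarrow> real" where
  "semi_ipTV s u v = (\<Sum>P\<in>msh s. let pr = PiNabla P in
      l2 (region P) (jac (pr u)) (jac (pr v))
      + TTV s P (wjac (region P) (\<lambda>x. u x - pr u x)) (wjac (region P) (\<lambda>x. v x - pr v x)))"


section \<open>Vectors of degrees of freedom\<close>

datatype dof = TV_dof pt 2 | E_dof edge | V_dof pt | P_dof cell

type_synonym dofvec = "dof \<Rightarrow> real"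

text \<open>Each mesh edge carries one degree of freedom; its unit normal is fixed by directing the edge from
  its lexicographically smaller to its larger end point.\<close>

definition lex_less :: "pt \<Rightarrow> pt \<Rightarrow> bool" where
  "lex_less a b \<longleftrightarrow> a $ 1 < b $ 1 \<or> (a $ 1 = b $ 1 \<and> a $ 2 < b $ 2)"

definition dofs :: "cell set \<Rightarrow> dof set" where
  "dofs T = (\<Union>P\<in>T. {TV_dof x i | x i. x \<in> nodes P}
     \<union> {E_dof (a, b) | a b. lex_less a b \<and> ((a, b) \<in> edges P \<or> (b, a) \<in> edges P)}
     \<union> V_dof ` set P \<union> {P_dof P})"

definition edge_avg :: "dofvec \<Rightarrow> edge \<Rightarrow> real" where
  "edge_avg x = (\<lambda>(a, b). if lex_less a b then x (E_dof (a, b)) else - x (E_dof (b, a)))"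

type_synonym state = "vect \<times> vect \<times> scal \<times> scal"

definition states :: "scheme \<Rightarrow> state set" where
  "states s = TVh0 (Om s) (msh s) \<times> Eh (Om s) (msh s) \<times> Vh0 (Om s) (msh s) \<times> Ph0 (Om s) (msh s)"

text \<open>The correspondence between elements of the product space and column vectors. Vectors vanish
  off the finite index set \<open>dofs\<close>.\<close>

definition corr :: "scheme \<Rightarrow> dofvec \<Rightarrow> state \<Rightarrow> bool" where
  "corr s x w \<longleftrightarrow> w \<in> states s \<and> (\<forall>i. i \<notin> dofs (msh s) \<longrightarrow> x i = 0) \<and> (case w of (u, B, E, p) \<Rightarrow>
       node_values (msh s) u (\<lambda>z. \<chi> i. x (TV_dof z i))
     \<and> edge_fluxes (msh s) B (\<lambda>e. edge_length e * edge_avg x e)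
     \<and> vertex_values (msh s) E (\<lambda>z. x (V_dof z))
     \<and> (\<forall>P\<in>msh s. (LINT z:region P|lebesgue. p z) = x (P_dof P)))"

definition Xh0 :: "scheme \<Rightarrow> dofvec set" where
  "Xh0 s = {x. \<exists>w. corr s x w}"

definition edot :: "scheme \<Rightarrow> dofvec \<Rightarrow> dofvec \<Rightarrow> real" where
  "edot s x y = (\<Sum>i\<in>dofs (msh s). x i * y i)"


section \<open>The nonlinear map and the iteration\<close>

definition tn :: "scheme \<Rightarrow> nat \<Rightarrow> real" where
  "tn s n = real n * dt s"

definition tn_theta :: "scheme \<Rightarrow> nat \<Rightarrow> real" where
  "tn_theta s n = (real n + theta s) * dt s"

text \<open>Vertex values of the cross product of a velocity with the Raviart--Thomas projection of a magnetic field.\<close>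

definition cross_RT :: "scheme \<Rightarrow> vect \<Rightarrow> vect \<Rightarrow> scal" where
  "cross_RT s v B x =
     (let b = (\<Sum>P\<in>{P \<in> msh s. x \<in> set P}. vwt s x P *\<^sub>R l2proj (region P) RT0 B x);
          w = node_val (msh s) v x
      in w $ 1 * b $ 2 - w $ 2 * b $ 1)"

text \<open>The factor by which the discrete Faraday law is multiplied. For \<open>\<theta> = 0\<close> multiplication by \<open>\<theta> / Rmag\<close>
  would not give an equivalent expression of the law, which then enters unscaled.\<close>

definition faraday_factor :: "scheme \<Rightarrow> real" where
  "faraday_factor s = (if theta s = 0 then 1 else theta s / Rmag s)"

text \<open>The right-hand side of the equation defining \<open>G\<close>, at the step from \<open>n\<close> to \<open>n + 1\<close> with previous
  fields \<open>un\<close>, \<open>Bn\<close> and load \<open>f\<close>.\<close>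

definition residual :: "scheme \<Rightarrow> nat \<Rightarrow> vect \<Rightarrow> vect \<Rightarrow> vect \<Rightarrow> state \<Rightarrow> state \<Rightarrow> real" where
  "residual s n un Bn f = (\<lambda>(uhat, B, Ehat, p) (v, C, D, q).
     let u = (\<lambda>x. uhat x + ITV s (ub s (tn s (Suc n))) x);
         E = (\<lambda>x. Ehat x + IV s (Eb s (tn_theta s n)) x);
         u\<^sub>\<theta> = (\<lambda>x. (1 - theta s) *\<^sub>R un x + theta s *\<^sub>R u x);
         B\<^sub>\<theta> = (\<lambda>x. (1 - theta s) *\<^sub>R Bn x + theta s *\<^sub>R B x);
         J = (\<lambda>x. E x + IV s (cross_RT s u\<^sub>\<theta> B\<^sub>\<theta>) x)
     in ipTV s (\<lambda>x. (1 / dt s) *\<^sub>R (u x - un x)) v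
        + (1 / Rey s) * semi_ipTV s u\<^sub>\<theta> v
        + ipV s J (IV s (cross_RT s v B\<^sub>\<theta>))
        - l2 (Om s) p (wdiv (Om s) v)
        - ipTV s f v
        + l2 (Om s) (wdiv (Om s) u\<^sub>\<theta>) q
        + faraday_factor s * ipE s (\<lambda>x. (1 / dt s) *\<^sub>R (B x - Bn x)) C
        + faraday_factor s * ipE s (wrotv (Om s) E) C
        + ipV s J D
        - (1 / Rmag s) * ipE s B\<^sub>\<theta> (wrotv (Om s) D))"

definition defines_G ::
  "scheme \<Rightarrow> nat \<Rightarrow> vect \<Rightarrow> vect \<Rightarrow> vect \<Rightarrow> (dofvec \<Rightarrow> dofvec) \<Rightarrow> bool" where
  "defines_G s n un Bn f G \<longleftrightarrow> (\<forall>x\<in>Xh0 s. G x \<in> Xh0 s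
     \<and> (\<forall>w y w'. corr s x w \<and> corr s y w' \<longrightarrow> edot s (G x) y = residual s n un Bn f w w'))"

definition fd_eps :: real where
  "fd_eps = 1 / 10 ^ 7"

text \<open>Finite-difference Jacobian action.\<close>

definition DG :: "(dofvec \<Rightarrow> dofvec) \<Rightarrow> dofvec \<Rightarrow> dofvec \<Rightarrow> dofvec" where
  "DG G x \<delta> = (\<lambda>i. (G (\<lambda>j. x j + fd_eps * \<delta> j) i - G x i) / fd_eps)"

end

theory Submission
  imports Defs "HOL-Complex_Analysis.Winding_Numbers"
begin

text \<open>Among the terms of \<open>G\<close>, those tested with a magnetic field form the discrete Faraday law. It is affine in the
  unknowns, so a Newton-type step, even with a difference quotient in place of the derivative, solves it exactly:
  with \<open>B\<close>, \<open>E\<close> the fields of the iterate and \<open>C\<close>, \<open>D\<close> those of the update, \<open>C + B - Bn\<close> is \<open>- dt\<close> times the rotation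
  of the electric field after the update (\<open>newton_step_solenoidal\<close>). Rotations are solenoidal. So if \<open>Bn\<close> and \<open>B\<close>
  are solenoidal, so is \<open>C\<close>, and the statement follows by induction on the iterations and the time levels, starting
  from the interpolant of the initial field (\<open>solenoidal_interpolant\<close>).

  The argument rests on four facts.

  \<^item> The difference quotient evaluates \<open>G\<close> at \<open>x + fd_eps * \<delta>\<close>, where \<open>G\<close> is specified for vectors of degrees of freedom
    of discrete fields only. All discrete spaces are therefore shown to be linear (\<open>corr_combo\<close>). Weak derivatives
    are linear almost everywhere, by their uniqueness (\<open>fundamental_lemma\<close>).

  \<^item> The discrete inner product of the edge space is definite (\<open>ipE_definite\<close>), so that the law tested with edge fields
    holds as an equation of fields. The stabilising form acts on a field minus its mean, which lies in the local edge
    space because constants do (\<open>constants_in_EhP\<close>). This is the divergence theorem on a polygon. The polygon is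
    decomposed into signed triangles with apex \<open>0\<close> over its edges; the sum of their signed indicator functions is
    the winding number, which by the Jordan curve theorem is constant inside the polygon and \<open>0\<close> outside; the
    orientation of the cells makes the constant \<open>1\<close>.

  \<^item> The rotation maps the vertex space into the edge space (\<open>wrotv_in_Eh\<close>): the residual of the law is an edge field
    and may serve as its own test field.

  \<^item> The divergence of an edge field is determined by its fluxes through the cell boundaries (\<open>solenoidal_iff_fluxes\<close>).
    Thus being solenoidal is a linear condition on the vector of degrees of freedom, common to all fields with these
    degrees of freedom.\<close>

section \<open>Square integrable functions\<close>

lemma L2_inner_integrable:
  fixes f g :: "pt \<Rightarrow> 'b::euclidean_space"
  assumes "L2 U f" "L2 U g"
  shows "set_integrable lebesgue U (\<lambda>x. f x \<bullet> g x)"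
proof -
  have [measurable]: "(\<lambda>x. indicat_real U x *\<^sub>R f x) \<in> borel_measurable lebesgue"
      "(\<lambda>x. indicat_real U x *\<^sub>R g x) \<in> borel_measurable lebesgue"
    using assms by (auto simp: L2_def set_borel_measurable_def)
  have "set_integrable lebesgue U (\<lambda>x. (norm (f x))\<^sup>2 + (norm (g x))\<^sup>2)"
    using assms unfolding L2_def by (intro set_integral_add) auto
  then have i: "integrable lebesgue (\<lambda>x. indicator U x *\<^sub>R ((norm (f x))\<^sup>2 + (norm (g x))\<^sup>2))"
    by (simp add: set_integrable_def)
  have "(\<lambda>x. (indicat_real U x *\<^sub>R f x) \<bullet> (indicat_real U x *\<^sub>R g x)) \<in> borel_measurable lebesgue"
    by measurable
  also have "(\<lambda>x. (indicat_real U x *\<^sub>R f x) \<bullet> (indicat_real U x *\<^sub>R g x))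
      = (\<lambda>x. indicator U x *\<^sub>R (f x \<bullet> g x))"
    by (auto simp: indicator_def)
  finally have m: "(\<lambda>x. indicat_real U x *\<^sub>R (f x \<bullet> g x)) \<in> borel_measurable lebesgue" .
  have "norm (indicat_real U x *\<^sub>R (f x \<bullet> g x))
      \<le> norm (indicat_real U x *\<^sub>R ((norm (f x))\<^sup>2 + (norm (g x))\<^sup>2))" for x
  proof -
    have "\<bar>f x \<bullet> g x\<bar> \<le> norm (f x) * norm (g x)" by (rule Cauchy_Schwarz_ineq2)
    also have "\<dots> \<le> (norm (f x))\<^sup>2 + (norm (g x))\<^sup>2"
      using sum_squares_bound[of "norm (f x)" "norm (g x)"]
        mult_nonneg_nonneg[OF norm_ge_zero[of "f x"] norm_ge_zero[of "g x"]] by linarith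
    finally show ?thesis by (auto simp: indicator_def)
  qed
  then show ?thesis
    unfolding set_integrable_def by (intro Bochner_Integration.integrable_bound[OF i m]) auto
qed

text \<open>Linearity is stated throughout for combinations \<open>a *\<^sub>R f + g\<close>, the form in which bilinearity of the
  stabilising forms is given.\<close>

lemma L2_combo:
  fixes f g :: "pt \<Rightarrow> 'b::euclidean_space"
  assumes "L2 U f" "L2 U g"
  shows "L2 U (\<lambda>x. a *\<^sub>R f x + g x)"
proof -
  have [measurable]: "(\<lambda>x. indicat_real U x *\<^sub>R f x) \<in> borel_measurable lebesgue"
      "(\<lambda>x. indicat_real U x *\<^sub>R g x) \<in> borel_measurable lebesgue"
    using assms by (auto simp: L2_def set_borel_measurable_def)
  have "(\<lambda>x. a *\<^sub>R (indicat_real U x *\<^sub>R f x) + (indicat_real U x *\<^sub>R g x)) \<in> borel_measurable lebesgue"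
    by measurable
  then have 1: "set_borel_measurable lebesgue U (\<lambda>x. a *\<^sub>R f x + g x)"
    unfolding set_borel_measurable_def by (simp add: algebra_simps)
  have "set_integrable lebesgue U (\<lambda>x. a\<^sup>2 * (f x \<bullet> f x) + (2 * a) * (f x \<bullet> g x) + g x \<bullet> g x)"
    using L2_inner_integrable assms
    by (intro set_integral_add set_integrable_mult_right) auto
  also have "(\<lambda>x. a\<^sup>2 * (f x \<bullet> f x) + (2 * a) * (f x \<bullet> g x) + g x \<bullet> g x) = (\<lambda>x. (norm (a *\<^sub>R f x + g x))\<^sup>2)"
  proof
    fix x show "a\<^sup>2 * (f x \<bullet> f x) + 2 * a * (f x \<bullet> g x) + g x \<bullet> g x = (norm (a *\<^sub>R f x + g x))\<^sup>2"
      using inner_commute[of "g x" "f x"] unfolding power2_norm_eq_inner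
      by (simp add: inner_add_left inner_add_right power2_eq_square algebra_simps)
  qed
  finally show ?thesis using 1 by (simp add: L2_def)
qed

lemma L2_zero [simp]: "L2 U (\<lambda>_. 0 :: 'b::euclidean_space)"
  by (simp add: L2_def set_borel_measurable_def set_integrable_def)

lemma L2_scaleR: "L2 U f \<Longrightarrow> L2 U (\<lambda>x. a *\<^sub>R f x)"
  using L2_combo[of U f "\<lambda>_. 0" a] by simp

lemma L2_diff: "L2 U f \<Longrightarrow> L2 U g \<Longrightarrow> L2 U (\<lambda>x. f x - g x)"
  using L2_combo[of U g f "-1"] by simp

lemma l2_combo_left:
  assumes "L2 U f" "L2 U g" "L2 U h"
  shows "l2 U (\<lambda>x. a *\<^sub>R f x + g x) h = a * l2 U f h + l2 U g h"
proof -
  have "l2 U (\<lambda>x. a *\<^sub>R f x + g x) h = (LINT x:U|lebesgue. a * (f x \<bullet> h x) + g x \<bullet> h x)"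
    by (simp add: l2_def inner_add_left)
  also have "\<dots> = (LINT x:U|lebesgue. a * (f x \<bullet> h x)) + l2 U g h"
    unfolding l2_def
    by (intro set_integral_add set_integrable_mult_right L2_inner_integrable assms impI)
  finally show ?thesis by (simp add: l2_def)
qed

lemma l2_commute: "l2 U f g = l2 U g f"
  by (simp add: l2_def inner_commute)

lemma l2_combo_right:
  assumes "L2 U f" "L2 U g" "L2 U h"
  shows "l2 U h (\<lambda>x. a *\<^sub>R f x + g x) = a * l2 U h f + l2 U h g"
  using l2_combo_left[OF assms] by (simp add: l2_commute)

lemma l2_zero_left [simp]: "l2 U (\<lambda>_. 0) g = 0" and l2_zero_right [simp]: "l2 U g (\<lambda>_. 0) = 0"
  by (simp_all add: l2_def)

lemma l2_nonneg: "0 \<le> l2 U f f"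
  unfolding l2_def set_lebesgue_integral_def by (rule Bochner_Integration.integral_nonneg) (auto simp: indicator_def)

definition ae_eq :: "pt set \<Rightarrow> (pt \<Rightarrow> 'b) \<Rightarrow> (pt \<Rightarrow> 'b) \<Rightarrow> bool" where
  "ae_eq U f g \<longleftrightarrow> (AE x in lebesgue. x \<in> U \<longrightarrow> f x = g x)"

lemma ae_eq_refl [simp]: "ae_eq U f f" by (simp add: ae_eq_def)

lemma ae_eq_sym: "ae_eq U f g \<Longrightarrow> ae_eq U g f" by (auto simp: ae_eq_def elim: AE_mp)

lemma ae_eq_subset: "ae_eq U f g \<Longrightarrow> V \<subseteq> U \<Longrightarrow> ae_eq V f g"
  unfolding ae_eq_def by (auto elim!: AE_mp)

text \<open>Lebesgue measure is complete, so a change on a null set preserves measurability.\<close>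

lemma ae_eq_measurable:
  fixes f g :: "pt \<Rightarrow> 'b::euclidean_space"
  assumes "ae_eq U f g" "set_borel_measurable lebesgue U f"
  shows "set_borel_measurable lebesgue U g"
  unfolding set_borel_measurable_def
proof (rule borel_measurableI)
  fix S :: "'b set" assume "open S"
  let ?f = "\<lambda>x. indicat_real U x *\<^sub>R f x" and ?g = "\<lambda>x. indicat_real U x *\<^sub>R g x"
  have m: "?f -` S \<inter> space lebesgue \<in> sets lebesgue"
    using assms(2) \<open>open S\<close> unfolding set_borel_measurable_def
    by (intro measurable_sets[where A = borel]) auto
  have ae: "AE x in lebesgue. (x \<in> ?f -` S \<inter> space lebesgue) = (x \<in> ?g -` S \<inter> space lebesgue)"
    using assms(1) unfolding ae_eq_def by eventually_elim (auto simp: indicator_def)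
  show "?g -` S \<inter> space lebesgue \<in> sets lebesgue"
    by (rule completion.in_sets_AE[OF ae m]) simp
qed

lemma ae_eq_integral:
  fixes f g :: "pt \<Rightarrow> 'b::euclidean_space"
  assumes "ae_eq U f g"
  shows "(LINT x:U|lebesgue. f x) = (LINT x:U|lebesgue. g x)"
proof (cases "set_borel_measurable lebesgue U f")
  case True
  then have "set_borel_measurable lebesgue U g" using ae_eq_measurable assms by blast
  with True assms show ?thesis
    unfolding set_lebesgue_integral_def set_borel_measurable_def ae_eq_def
    by (intro integral_cong_AE) (auto elim!: AE_mp simp: indicator_def)
next
  \<comment> \<open>If one of the functions is not measurable, both integrals have the default value \<open>0\<close>.\<close>
  case False
  then have "\<not> set_borel_measurable lebesgue U g" using ae_eq_measurable ae_eq_sym assms by blast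
  with False have "\<not> integrable lebesgue (\<lambda>x. indicat_real U x *\<^sub>R f x)"
     "\<not> integrable lebesgue (\<lambda>x. indicat_real U x *\<^sub>R g x)"
    by (auto simp: set_borel_measurable_def)
  then show ?thesis by (simp add: set_lebesgue_integral_def not_integrable_integral_eq)
qed

lemma ae_eq_l2: "ae_eq U f f' \<Longrightarrow> ae_eq U g g' \<Longrightarrow> l2 U f g = l2 U f' g'"
  unfolding l2_def by (rule ae_eq_integral) (auto simp: ae_eq_def elim!: AE_mp)

lemma l2_self_eq_0:
  assumes "L2 U f" "l2 U f f = 0"
  shows "ae_eq U f (\<lambda>_. 0)"
proof -
  have "AE x in lebesgue. indicat_real U x *\<^sub>R (f x \<bullet> f x) = 0"
    using assms L2_inner_integrable[OF assms(1) assms(1)]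
    unfolding l2_def set_lebesgue_integral_def set_integrable_def
    by (subst (asm) integral_nonneg_eq_0_iff_AE) (auto simp: indicator_def)
  then show ?thesis unfolding ae_eq_def by (auto elim!: AE_mp simp: indicator_def)
qed

lemma L2_component: "L2 U v \<Longrightarrow> L2 U (\<lambda>x. v x $ i)"
  for v :: "pt \<Rightarrow> real^'n"
proof -
  assume a: "L2 U v"
  have [measurable]: "(\<lambda>x. indicat_real U x *\<^sub>R v x) \<in> borel_measurable lebesgue"
    using a by (auto simp: L2_def set_borel_measurable_def)
  have "(\<lambda>x. (indicat_real U x *\<^sub>R v x) \<bullet> axis i 1) \<in> borel_measurable lebesgue" by measurable
  then have m: "(\<lambda>x. indicat_real U x *\<^sub>R (v x $ i)) \<in> borel_measurable lebesgue"
    by (simp add: inner_axis)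
  have "(\<lambda>x. (indicat_real U x *\<^sub>R (v x $ i))\<^sup>2) \<in> borel_measurable lebesgue" using m by measurable
  also have "(\<lambda>x. (indicat_real U x *\<^sub>R (v x $ i))\<^sup>2) = (\<lambda>x. indicat_real U x *\<^sub>R (v x $ i)\<^sup>2)"
    by (auto simp: indicator_def)
  finally have m2: "(\<lambda>x. indicat_real U x *\<^sub>R (v x $ i)\<^sup>2) \<in> borel_measurable lebesgue" .
  have "integrable lebesgue (\<lambda>x. indicat_real U x *\<^sub>R (norm (v x))\<^sup>2)"
    using a by (auto simp: L2_def set_integrable_def)
  then have "integrable lebesgue (\<lambda>x. indicat_real U x *\<^sub>R (v x $ i)\<^sup>2)"
    using m2 by (rule Bochner_Integration.integrable_bound)
      (auto simp: indicator_def intro!: abs_le_square_iff[THEN iffD1] component_le_norm_cart power_mono)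
  then show ?thesis using m by (simp add: L2_def set_borel_measurable_def set_integrable_def)
qed

lemma L2_axis_vec: "L2 U f \<Longrightarrow> L2 U (\<lambda>x. axis i (f x) :: 'b^2)" for f :: "pt \<Rightarrow> 'b::euclidean_space"
proof -
  assume f: "L2 U f"
  have l: "linear (\<lambda>y. axis i y :: 'b^2)"
    by (rule linearI) (auto simp: axis_def vec_eq_iff)
  have "continuous_on UNIV (\<lambda>y. axis i y :: 'b^2)" using l by (simp add: linear_continuous_on linear_conv_bounded_linear)
  then have b: "(\<lambda>y. axis i y :: 'b^2) \<in> borel_measurable borel" by (rule borel_measurable_continuous_onI)
  have "(\<lambda>x. indicat_real U x *\<^sub>R f x) \<in> borel_measurable lebesgue"
    using f by (simp add: L2_def set_borel_measurable_def)
  from measurable_compose[OF this b]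
  have "(\<lambda>x. indicat_real U x *\<^sub>R (axis i (f x) :: 'b^2)) \<in> borel_measurable lebesgue"
    using linear_scale[OF l] by simp
  moreover have "norm (axis i y :: 'b^2) = norm y" for y
    using exhaust_2[of i] by (auto simp: norm_vec_def L2_set_def sum_2 axis_def)
  ultimately show ?thesis using f by (simp add: L2_def set_borel_measurable_def)
qed

lemma L2_vec:
  fixes v :: "pt \<Rightarrow> 'b::euclidean_space^2"
  assumes "\<And>i. L2 U (\<lambda>x. v x $ i)"
  shows "L2 U v"
proof -
  have "L2 U (\<lambda>x. 1 *\<^sub>R axis 1 (v x $ 1) + axis 2 (v x $ 2) :: 'b^2)"
    by (intro L2_combo L2_axis_vec assms)
  also have "(\<lambda>x. 1 *\<^sub>R axis 1 (v x $ 1) + axis 2 (v x $ 2) :: 'b^2) = v"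
    by (auto simp: fun_eq_iff vec_eq_iff forall_2 axis_def)
  finally show ?thesis .
qed

lemma L2_continuous:
  fixes f :: "pt \<Rightarrow> 'b::euclidean_space"
  assumes "continuous_on UNIV f" "bounded U" "U \<in> sets lebesgue"
  shows "L2 U f"
proof -
  have c: "compact (closure U)" using assms(2) by (simp add: compact_closure)
  have "f \<in> borel_measurable lebesgue"
    using assms(1) by (simp add: borel_measurable_continuous_onI measurable_completion)
  then have m: "set_borel_measurable lebesgue U f"
    using assms(3) unfolding set_borel_measurable_def by simp
  have "integrable lborel (\<lambda>x. indicator (closure U) x *\<^sub>R (norm (f x))\<^sup>2)"
    using assms(1) by (intro borel_integrable_compact c continuous_intros) (auto intro: continuous_on_subset)
  then have "set_integrable lebesgue (closure U) (\<lambda>x. (norm (f x))\<^sup>2)"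
    unfolding set_integrable_def by (subst integrable_completion) auto
  then have "set_integrable lebesgue U (\<lambda>x. (norm (f x))\<^sup>2)"
    by (rule set_integrable_subset) (use assms(3) closure_subset in auto)
  with m show ?thesis by (simp add: L2_def)
qed

section \<open>Smooth functions and test functions\<close>

lemma pd_eqI:
  assumes "(f has_derivative f') (at x)"
  shows "pd i f x = f' (axis i 1)"
  using frechet_derivative_at[OF assms] by (simp add: pd_def)

lemma differentiable_iff_on: "f differentiable_on UNIV \<longleftrightarrow> (\<forall>x. f differentiable (at x))"
  by (simp add: differentiable_on_def)

lemma pd_combo:
  assumes "f differentiable (at x)" "g differentiable (at x)"
  shows "pd i (\<lambda>x. a * f x + g x) x = a * pd i f x + pd i g x"
proof -
  have "((\<lambda>x. a * f x + g x) has_derivative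
      (\<lambda>h. a * frechet_derivative f (at x) h + frechet_derivative g (at x) h)) (at x)"
    by (rule has_derivative_add[OF has_derivative_mult_right]) (use assms[unfolded frechet_derivative_works] in blast)+
  from pd_eqI[OF this] show ?thesis by (simp add: pd_def)
qed

lemma pd_mult:
  assumes "f differentiable (at x)" "g differentiable (at x)"
  shows "pd i (\<lambda>x. f x * g x) x = f x * pd i g x + pd i f x * g x"
  using pd_eqI[OF has_derivative_mult[OF assms[unfolded frechet_derivative_works]]]
  by (simp add: pd_def)

lemma pd_const [simp]: "pd i (\<lambda>_. c) = (\<lambda>_. 0)"
  using pd_eqI[OF has_derivative_const] by blast

lemma pd_coord:
  assumes "(h has_real_derivative h') (at (x $ j))"
  shows "pd i (\<lambda>x. h (x $ j)) x = (if i = j then h' else 0)"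
    and "(\<lambda>x. h (x $ j)) differentiable (at x)"
proof -
  have D: "((\<lambda>x. h (x $ j)) has_derivative (\<lambda>y. (y $ j) * h')) (at x)"
    using has_derivative_compose[OF bounded_linear.has_derivative[OF bounded_linear_vec_nth has_derivative_ident]
        assms[unfolded has_field_derivative_def]]
    by (simp add: mult.commute)
  from pd_eqI[OF D, of i] show "pd i (\<lambda>x. h (x $ j)) x = (if i = j then h' else 0)"
    by (simp add: axis_def)
  from D show "(\<lambda>x. h (x $ j)) differentiable (at x)"
    unfolding differentiable_def by blast
qed

lemma C_class_Suc_differentiable: "C_class (Suc k) f \<Longrightarrow> f differentiable (at x)"
  by (simp add: differentiable_iff_on)

lemma C_class_SucD: "C_class (Suc k) f \<Longrightarrow> C_class k f"
  by (induction k arbitrary: f) (auto simp: differentiable_imp_continuous_on)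

lemma C_class_const [simp]: "C_class k (\<lambda>_. c)"
  by (induction k arbitrary: c) auto

lemma C_class_combo: "C_class k f \<Longrightarrow> C_class k g \<Longrightarrow> C_class k (\<lambda>x. a * f x + g x)"
proof (induction k arbitrary: f g)
  case 0 then show ?case by (auto intro!: continuous_intros)
next
  case (Suc k)
  then have d: "f differentiable (at x)" "g differentiable (at x)" for x
    using C_class_Suc_differentiable by blast+
  then have "pd i (\<lambda>x. a * f x + g x) = (\<lambda>x. a * pd i f x + pd i g x)" for i
    using pd_combo by blast
  with Suc d show ?case by (auto simp: differentiable_iff_on intro!: derivative_intros)
qed

lemma C_class_mult: "C_class k f \<Longrightarrow> C_class k g \<Longrightarrow> C_class k (\<lambda>x. f x * g x)"
proof (induction k arbitrary: f g)
  case 0 then show ?case by (auto intro!: continuous_intros)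
next
  case (Suc k)
  then have d: "f differentiable (at x)" "g differentiable (at x)" for x
    using C_class_Suc_differentiable by blast+
  then have "pd i (\<lambda>x. f x * g x) = (\<lambda>x. 1 * (f x * pd i g x) + pd i f x * g x)" for i
    using pd_mult by force
  moreover have "C_class k (\<lambda>x. 1 * (f x * pd i g x) + pd i f x * g x)" for i
    using Suc by (intro C_class_combo Suc.IH C_class_SucD[of k f] C_class_SucD[of k g]) auto
  ultimately show ?case
    using d by (auto simp: differentiable_iff_on intro!: derivative_intros)
qed

lemma smooth_pd: "smooth f \<Longrightarrow> smooth (pd i f)"
  unfolding smooth_def using C_class.simps(2) by blast

lemma smooth_continuous: "smooth f \<Longrightarrow> continuous_on S f"
  unfolding smooth_def using C_class.simps(1) continuous_on_subset by blast

lemma smooth_differentiable: "smooth f \<Longrightarrow> f differentiable (at x)"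
  unfolding smooth_def using C_class_Suc_differentiable by blast

lemma smooth_const [simp]: "smooth (\<lambda>_. c)" by (simp add: smooth_def)

lemma smooth_combo: "smooth f \<Longrightarrow> smooth g \<Longrightarrow> smooth (\<lambda>x. a * f x + g x)"
  by (simp add: smooth_def C_class_combo)

lemma smooth_add: "smooth f \<Longrightarrow> smooth g \<Longrightarrow> smooth (\<lambda>x. f x + g x)"
  using smooth_combo[of f g 1] by simp

lemma smooth_uminus: "smooth f \<Longrightarrow> smooth (\<lambda>x. - f x)"
  using smooth_combo[of f "\<lambda>_. 0" "-1"] by simp

lemma smooth_mult: "smooth f \<Longrightarrow> smooth g \<Longrightarrow> smooth (\<lambda>x. f x * g x)"
  by (simp add: smooth_def C_class_mult)

lemma smooth_coord: "smooth (\<lambda>x. x $ j)"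
  unfolding smooth_def
proof
  fix k show "C_class k (\<lambda>x. x $ j)"
  proof (cases k)
    case 0 then show ?thesis by (auto intro!: continuous_intros)
  next
    case (Suc k)
    have "pd i (\<lambda>x. x $ j) = (\<lambda>_. if i = j then 1 else 0)" for i
      using pd_coord(1)[of "\<lambda>t. t" 1] by (auto intro!: derivative_eq_intros)
    then show ?thesis using pd_coord(2)[of "\<lambda>t. t" 1]
      by (auto simp: Suc differentiable_iff_on intro!: derivative_eq_intros)
  qed
qed

lemma smooth_power: "smooth f \<Longrightarrow> smooth (\<lambda>x. f x ^ n)"
  by (induction n) (auto intro: smooth_mult)

lemma smooth_sum: "(\<And>i. i \<in> I \<Longrightarrow> smooth (f i)) \<Longrightarrow> smooth (\<lambda>x. \<Sum>i\<in>I. f i x)"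
  by (induction I rule: infinite_finite_induct) (auto intro: smooth_add)

lemma poly2_smooth: "p \<in> poly2 k \<Longrightarrow> smooth p"
  unfolding poly2_def by (auto intro!: smooth_sum smooth_mult smooth_power smooth_coord)

lemma has_derivative_pd:
  assumes "f differentiable (at x)"
  shows "(f has_derivative (\<lambda>h. h $ 1 * pd 1 f x + h $ 2 * pd 2 f x)) (at x)"
proof -
  let ?D = "frechet_derivative f (at x)"
  have D: "(f has_derivative ?D) (at x)" using assms by (simp add: frechet_derivative_works)
  then have l: "linear ?D" by (rule has_derivative_linear)
  have "?D h = h $ 1 * pd 1 f x + h $ 2 * pd 2 f x" for h
  proof -
    have "?D (h $ 1 *\<^sub>R axis 1 1 + h $ 2 *\<^sub>R axis 2 1) = h $ 1 * pd 1 f x + h $ 2 * pd 2 f x"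
      by (simp add: linear_add[OF l] linear_scale[OF l] pd_def)
    also have "h $ 1 *\<^sub>R axis 1 1 + h $ 2 *\<^sub>R axis 2 1 = h"
      by (auto simp: vec_eq_iff forall_2 axis_def)
    finally show ?thesis .
  qed
  then have "?D = (\<lambda>h. h $ 1 * pd 1 f x + h $ 2 * pd 2 f x)" by (rule ext)
  with D show ?thesis by simp
qed

lemma line_derivative:
  assumes "\<And>x. f differentiable (at x)"
  shows "((\<lambda>t. f (y + t *\<^sub>R v)) has_real_derivative (v $ 1 * pd 1 f (y + t *\<^sub>R v) + v $ 2 * pd 2 f (y + t *\<^sub>R v)))
           (at t within S)"
proof -
  have "((\<lambda>t. y + t *\<^sub>R v) has_derivative (\<lambda>t. t *\<^sub>R v)) (at t within S)"
    by (auto intro!: derivative_eq_intros)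
  from has_derivative_compose[OF this has_derivative_pd[OF assms]]
  show ?thesis
    unfolding has_field_derivative_def
    by (rule has_derivative_eq_rhs) (auto simp: algebra_simps)
qed

text \<open>The mean value theorem in direction \<open>i\<close> and then in direction \<open>j\<close>. The difference on the left is
  symmetric in \<open>i\<close> and \<open>j\<close>, which yields the symmetry of second derivatives as \<open>h\<close> tends to \<open>0\<close>.\<close>

lemma mixed_difference:
  assumes f: "smooth f" and h: "h > 0"
  obtains p where "dist p x \<le> 2 * h"
    "f (x + h *\<^sub>R axis i 1 + h *\<^sub>R axis j 1) - f (x + h *\<^sub>R axis i 1) - f (x + h *\<^sub>R axis j 1) + f x
       = h\<^sup>2 * pd j (pd i f) p"
proof -
  let ?e = "\<lambda>i. axis i 1 :: pt"
  have axis_line: "((\<lambda>t. g (y + t *\<^sub>R ?e k)) has_real_derivative pd k g (y + t *\<^sub>R ?e k)) (at t within S)"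
    if "smooth g" for g y t S k
    using line_derivative[of g y "?e k" t S] smooth_differentiable[OF that] exhaust_2[of k]
    by (auto simp: axis_def)
  let ?g = "\<lambda>t. f ((x + h *\<^sub>R ?e j) + t *\<^sub>R ?e i) - f (x + t *\<^sub>R ?e i)"
  have "(?g has_real_derivative (pd i f ((x + h *\<^sub>R ?e j) + t *\<^sub>R ?e i) - pd i f (x + t *\<^sub>R ?e i))) (at t)" for t
    by (intro DERIV_diff axis_line f)
  then obtain \<xi> where \<xi>: "0 < \<xi>" "\<xi> < h"
     "?g h - ?g 0 = (h - 0) * (pd i f ((x + h *\<^sub>R ?e j) + \<xi> *\<^sub>R ?e i) - pd i f (x + \<xi> *\<^sub>R ?e i))"
    using MVT2[OF h, of ?g "\<lambda>t. pd i f ((x + h *\<^sub>R ?e j) + t *\<^sub>R ?e i) - pd i f (x + t *\<^sub>R ?e i)"] by blast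
  let ?k = "\<lambda>t. pd i f ((x + \<xi> *\<^sub>R ?e i) + t *\<^sub>R ?e j)"
  have "(?k has_real_derivative pd j (pd i f) ((x + \<xi> *\<^sub>R ?e i) + t *\<^sub>R ?e j)) (at t)" for t
    by (intro axis_line smooth_pd f)
  then obtain \<eta> where \<eta>: "0 < \<eta>" "\<eta> < h"
     "?k h - ?k 0 = (h - 0) * pd j (pd i f) ((x + \<xi> *\<^sub>R ?e i) + \<eta> *\<^sub>R ?e j)"
    using MVT2[OF h, of ?k "\<lambda>t. pd j (pd i f) ((x + \<xi> *\<^sub>R ?e i) + t *\<^sub>R ?e j)"] by blast
  let ?p = "(x + \<xi> *\<^sub>R ?e i) + \<eta> *\<^sub>R ?e j"
  have "norm (\<xi> *\<^sub>R ?e i + \<eta> *\<^sub>R ?e j) \<le> norm (\<xi> *\<^sub>R ?e i) + norm (\<eta> *\<^sub>R ?e j)"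
    by (rule norm_triangle_ineq)
  then have "dist ?p x \<le> 2 * h" using \<xi> \<eta> by (simp add: dist_norm add.assoc)
  moreover have "f (x + h *\<^sub>R ?e i + h *\<^sub>R ?e j) - f (x + h *\<^sub>R ?e i) - f (x + h *\<^sub>R ?e j) + f x = ?g h - ?g 0"
    by (simp add: algebra_simps)
  moreover have "\<dots> = h * (?k h - ?k 0)" using \<xi>(3) by (simp add: algebra_simps)
  moreover have "\<dots> = h\<^sup>2 * pd j (pd i f) ?p" using \<eta>(3) by (simp add: power2_eq_square)
  ultimately show ?thesis using that by metis
qed

lemma mixed_partials:
  assumes f: "smooth f"
  shows "pd i (pd j f) = pd j (pd i f)"
proof
  fix x
  have "\<exists>p q. dist p x \<le> 2 * (1 / real (Suc n)) \<and> dist q x \<le> 2 * (1 / real (Suc n))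
      \<and> pd j (pd i f) p = pd i (pd j f) q" for n
  proof -
    have h: "1 / real (Suc n) > 0" by simp
    obtain p where p: "dist p x \<le> 2 * (1 / real (Suc n))"
      "f (x + (1 / real (Suc n)) *\<^sub>R axis i 1 + (1 / real (Suc n)) *\<^sub>R axis j 1)
        - f (x + (1 / real (Suc n)) *\<^sub>R axis i 1) - f (x + (1 / real (Suc n)) *\<^sub>R axis j 1) + f x
       = (1 / real (Suc n))\<^sup>2 * pd j (pd i f) p"
      using mixed_difference[OF f h, where i = i and j = j and x = x] .
    obtain q where q: "dist q x \<le> 2 * (1 / real (Suc n))"
      "f (x + (1 / real (Suc n)) *\<^sub>R axis j 1 + (1 / real (Suc n)) *\<^sub>R axis i 1)
        - f (x + (1 / real (Suc n)) *\<^sub>R axis j 1) - f (x + (1 / real (Suc n)) *\<^sub>R axis i 1) + f x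
       = (1 / real (Suc n))\<^sup>2 * pd i (pd j f) q"
      using mixed_difference[OF f h, where i = j and j = i and x = x] .
    have "(1 / real (Suc n))\<^sup>2 * pd j (pd i f) p = (1 / real (Suc n))\<^sup>2 * pd i (pd j f) q"
      unfolding p(2)[symmetric] q(2)[symmetric] by (simp add: add_ac)
    then have "pd j (pd i f) p = pd i (pd j f) q" using h by simp
    with p q show ?thesis by blast
  qed
  then obtain p q where pq: "\<And>n. dist (p n) x \<le> 2 * (1 / real (Suc n))"
      "\<And>n. dist (q n) x \<le> 2 * (1 / real (Suc n))" "\<And>n. pd j (pd i f) (p n) = pd i (pd j f) (q n)"
    by metis
  have z: "(\<lambda>n. 2 * (1 / real (Suc n))) \<longlonglongrightarrow> 0"
    using tendsto_mult_right_zero[OF LIMSEQ_inverse_real_of_nat, of 2] by (simp add: inverse_eq_divide)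
  have "(\<lambda>n. dist (p n) x) \<longlonglongrightarrow> 0" "(\<lambda>n. dist (q n) x) \<longlonglongrightarrow> 0"
    by (rule tendsto_sandwich[OF _ _ tendsto_const z]; intro always_eventually allI pq zero_le_dist)+
  then have "p \<longlonglongrightarrow> x" "q \<longlonglongrightarrow> x" using tendsto_dist_iff by blast+
  moreover have "isCont (pd j (pd i f)) x" "isCont (pd i (pd j f)) x"
    using smooth_continuous[OF smooth_pd[OF smooth_pd[OF f]], of UNIV]
    by (auto simp: continuous_on_eq_continuous_at)
  ultimately have "(\<lambda>n. pd j (pd i f) (p n)) \<longlonglongrightarrow> pd j (pd i f) x" "(\<lambda>n. pd i (pd j f) (q n)) \<longlonglongrightarrow> pd i (pd j f) x"
    by (auto intro: isCont_tendsto_compose)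
  then show "pd i (pd j f) x = pd j (pd i f) x"
    using pq(3) LIMSEQ_unique by auto
qed

lemma grad_component [simp]: "grad f x $ i = pd i f x" by (simp add: grad_def)

lemma crotv_component [simp]: "crotv f x $ 1 = pd 2 f x" "crotv f x $ 2 = - pd 1 f x"
  by (simp_all add: crotv_def)

lemma smooth_vec_grad: "smooth f \<Longrightarrow> smooth_vec (grad f)"
  by (simp add: smooth_vec_def smooth_pd)

lemma smooth_vec_crotv: "smooth f \<Longrightarrow> smooth_vec (crotv f)"
  by (simp add: smooth_vec_def forall_2 smooth_pd smooth_uminus)

lemma crot_grad: "smooth f \<Longrightarrow> crot (grad f) = (\<lambda>_. 0)"
  using mixed_partials[of f 1 2] by (auto simp: crot_def fun_eq_iff)

lemma pd_uminus: "smooth f \<Longrightarrow> pd i (\<lambda>x. - f x) x = - pd i f x"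
  using pd_combo[of f x "\<lambda>_. 0" i "-1"] smooth_differentiable by force

lemma cdiv_crotv: "smooth f \<Longrightarrow> cdiv (crotv f) = (\<lambda>_. 0)"
  using mixed_partials[of f 1 2] by (auto simp: cdiv_def fun_eq_iff pd_uminus smooth_pd)

lemma smooth_cdiv: "smooth_vec \<psi> \<Longrightarrow> smooth (cdiv \<psi>)"
  unfolding cdiv_def[abs_def] smooth_vec_def by (intro smooth_add smooth_pd) auto

lemma smooth_crot: "smooth_vec \<psi> \<Longrightarrow> smooth (crot \<psi>)"
  using smooth_combo[of "pd 2 (\<lambda>y. \<psi> y $ 1)" "pd 1 (\<lambda>y. \<psi> y $ 2)" "-1"]
  by (auto simp: crot_def[abs_def] smooth_vec_def smooth_pd)

lemma test_fun_smooth: "test_fun U \<phi> \<Longrightarrow> smooth \<phi>" by (simp add: test_fun_def)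

lemma test_vec_smooth: "test_vec U \<psi> \<Longrightarrow> smooth_vec \<psi>" by (simp add: test_vec_def smooth_vec_def test_fun_def)

lemma test_fun_outside: "test_fun U \<phi> \<Longrightarrow> x \<notin> U \<Longrightarrow> \<phi> x = 0"
  unfolding test_fun_def using closure_subset[of "{x. \<phi> x \<noteq> 0}"] by blast

lemma pd_support: "closure {x. pd i \<phi> x \<noteq> 0} \<subseteq> closure {x. \<phi> x \<noteq> 0}"
proof (rule closure_minimal)
  show "{x. pd i \<phi> x \<noteq> 0} \<subseteq> closure {x. \<phi> x \<noteq> 0}"
  proof (rule subsetI, rule ccontr)
    fix x assume x: "x \<in> {x. pd i \<phi> x \<noteq> 0}" "x \<notin> closure {x. \<phi> x \<noteq> 0}"
    have "(\<phi> has_derivative (\<lambda>_. 0)) (at x)"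
    proof (rule has_derivative_transform_within_open[of "\<lambda>_. 0" _ _ _ "- closure {x. \<phi> x \<noteq> 0}"])
      show "0 = \<phi> y" if "y \<in> - closure {x. \<phi> x \<noteq> 0}" for y
        using that closure_subset[of "{x. \<phi> x \<noteq> 0}"] by auto
    qed (use x in auto)
    from pd_eqI[OF this, of i] show False using x(1) by simp
  qed
qed auto

lemma test_fun_pd: "test_fun U \<phi> \<Longrightarrow> test_fun U (pd i \<phi>)"
proof -
  assume t: "test_fun U \<phi>"
  have "compact (closure {x. \<phi> x \<noteq> 0} \<inter> closure {x. pd i \<phi> x \<noteq> 0})"
    using t by (intro compact_Int_closed) (auto simp: test_fun_def)
  also have "closure {x. \<phi> x \<noteq> 0} \<inter> closure {x. pd i \<phi> x \<noteq> 0} = closure {x. pd i \<phi> x \<noteq> 0}"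
    using pd_support by blast
  finally show ?thesis
    using t pd_support[of i \<phi>] smooth_pd[of \<phi> i] unfolding test_fun_def by blast
qed

lemma test_fun_uminus: "test_fun U \<phi> \<Longrightarrow> test_fun U (\<lambda>x. - \<phi> x)"
  by (auto simp: test_fun_def smooth_uminus)

lemma test_fun_zero [simp]: "test_fun U (\<lambda>_. 0)"
  by (simp add: test_fun_def)

lemma test_vec_grad: "test_fun U \<phi> \<Longrightarrow> test_vec U (grad \<phi>)"
  by (simp add: test_vec_def test_fun_pd)

lemma test_fun_mono: "test_fun V \<phi> \<Longrightarrow> V \<subseteq> U \<Longrightarrow> test_fun U \<phi>"
  by (auto simp: test_fun_def)

lemma test_vec_mono: "test_vec V \<psi> \<Longrightarrow> V \<subseteq> U \<Longrightarrow> test_vec U \<psi>"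
  unfolding test_vec_def using test_fun_mono by blast

lemma test_vec_outside: "test_vec U \<psi> \<Longrightarrow> x \<notin> U \<Longrightarrow> \<psi> x = 0"
  unfolding test_vec_def vec_eq_iff zero_index using test_fun_outside[of U "\<lambda>x. \<psi> x $ _"] by blast

section \<open>The fundamental lemma of the calculus of variations\<close>

text \<open>Differentiation maps \<open>exp (-1/t) / t ^ n\<close> to a combination of two members of the same family, so that
  smoothness follows by induction for all members at once.\<close>

definition flat_exp :: "nat \<Rightarrow> real \<Rightarrow> real" where
  "flat_exp n t = (if t > 0 then exp (- (1 / t)) / t ^ n else 0)"

lemma flat_exp_quotient_tendsto: "((\<lambda>t. exp (- (1 / t)) / t ^ n) \<longlongrightarrow> 0) (at_right (0 :: real))"
proof -
  have "((\<lambda>t. (inverse t) ^ n / exp (inverse t)) \<longlongrightarrow> (0::real)) (at_right 0)"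
    by (rule filterlim_compose[OF tendsto_power_div_exp_0 filterlim_inverse_at_top_right])
  also have "(\<lambda>t::real. (inverse t) ^ n / exp (inverse t)) = (\<lambda>t. exp (- (1 / t)) / t ^ n)"
    by (auto simp: exp_minus divide_simps power_inverse)
  finally show ?thesis by simp
qed

lemma DERIV_flat_exp:
  "(flat_exp n has_real_derivative (flat_exp (n + 2) t - real n * flat_exp (n + 1) t)) (at t)"
proof -
  consider "t > 0" | "t < 0" | "t = 0" by linarith
  then show ?thesis
  proof cases
    case 1
    have "((\<lambda>t. exp (- (1 / t)) / t ^ n) has_real_derivative
        (flat_exp (n + 2) t - real n * flat_exp (n + 1) t)) (at t)"
    proof (cases n)
      case 0
      show ?thesis using 1 by (auto intro!: derivative_eq_intros simp: 0 flat_exp_def power2_eq_square)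
    next
      case (Suc m)
      have "((\<lambda>t. exp (- (1 / t))) has_real_derivative exp (- (1 / t)) * (1 / t\<^sup>2)) (at t)"
        using 1 by (auto intro!: derivative_eq_intros simp: power2_eq_square)
      from DERIV_divide[OF this DERIV_pow[of "Suc m"]] 1
      have "((\<lambda>t. exp (- (1 / t)) / t ^ Suc m) has_real_derivative
          (exp (- (1 / t)) * (1 / t\<^sup>2) * t ^ Suc m - exp (- (1 / t)) * (real (Suc m) * t ^ m)) / (t ^ Suc m * t ^ Suc m)) (at t)"
        by simp
      moreover have "(exp (- (1 / t)) * (1 / t\<^sup>2) * t ^ Suc m - exp (- (1 / t)) * (real (Suc m) * t ^ m)) / (t ^ Suc m * t ^ Suc m)
          = flat_exp (Suc m + 2) t - real (Suc m) * flat_exp (Suc m + 1) t"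
        using 1 by (simp add: flat_exp_def field_simps power2_eq_square)
      ultimately show ?thesis unfolding Suc by simp
    qed
    then show ?thesis
      by (rule has_field_derivative_transform_within_open[of _ _ _ "{0<..}"]) (use 1 in \<open>auto simp: flat_exp_def\<close>)
  next
    case 2
    have "((\<lambda>t. 0) has_real_derivative 0) (at t)" by simp
    then have "(flat_exp n has_real_derivative 0) (at t)"
      by (rule has_field_derivative_transform_within_open[of _ _ _ "{..<0}"]) (use 2 in \<open>auto simp: flat_exp_def\<close>)
    then show ?thesis using 2 by (simp add: flat_exp_def)
  next
    case 3
    have "((\<lambda>h. flat_exp n h / h) \<longlongrightarrow> 0) (at_right 0)"
    proof (rule Lim_transform_eventually[OF flat_exp_quotient_tendsto[of "Suc n"]])
      show "\<forall>\<^sub>F t in at_right 0. exp (- (1 / t)) / t ^ Suc n = flat_exp n t / t"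
        by (rule eventually_mono[OF eventually_at_right_less]) (simp add: flat_exp_def)
    qed
    moreover have "((\<lambda>h. flat_exp n h / h) \<longlongrightarrow> 0) (at_left 0)"
    proof (rule Lim_transform_eventually[OF tendsto_const])
      show "\<forall>\<^sub>F t in at_left 0. 0 = flat_exp n t / t"
        by (simp add: eventually_at_filter flat_exp_def)
    qed
    ultimately have "((\<lambda>h. flat_exp n h / h) \<longlongrightarrow> 0) (at 0)"
      by (simp add: filterlim_at_split)
    then have "(flat_exp n has_real_derivative 0) (at 0)"
      by (simp add: has_field_derivative_iff flat_exp_def)
    then show ?thesis by (simp add: 3 flat_exp_def)
  qed
qed

lemma smooth_flat_exp: "smooth (\<lambda>x. flat_exp n (a * (x $ j) + b))"
  unfolding smooth_def
proof
  fix k show "C_class k (\<lambda>x. flat_exp n (a * (x $ j) + b))"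
  proof (induction k arbitrary: n)
    case 0
    have c: "continuous_on UNIV (flat_exp n)"
      using DERIV_isCont[OF DERIV_flat_exp] by (simp add: continuous_on_eq_continuous_at)
    have "continuous_on UNIV (\<lambda>x::pt. a * (x $ j) + b)" by (intro continuous_intros)
    from continuous_on_compose[OF this continuous_on_subset[OF c]] show ?case by (simp add: o_def)
  next
    case (Suc k)
    let ?d = "\<lambda>t. a * (flat_exp (n + 2) (a * t + b) - real n * flat_exp (n + 1) (a * t + b))"
    have d: "((\<lambda>t. flat_exp n (a * t + b)) has_real_derivative ?d t) (at t)" for t
    proof -
      have "((\<lambda>t. a * t + b) has_real_derivative a) (at t)"
        by (auto intro!: derivative_eq_intros)
      from DERIV_chain2[OF DERIV_flat_exp this] show ?thesis by (simp add: mult.commute)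
    qed
    have "pd i (\<lambda>x. flat_exp n (a * (x $ j) + b)) = (\<lambda>x. if i = j then ?d (x $ j) else 0)" for i
      using pd_coord(1)[OF d] by blast
    moreover have "C_class k (\<lambda>x. ?d (x $ j))"
    proof -
      have "C_class k (\<lambda>x. a * ((- real n) * flat_exp (n + 1) (a * (x $ j) + b) + flat_exp (n + 2) (a * (x $ j) + b)) + 0)"
        by (rule C_class_combo[OF C_class_combo[OF Suc.IH Suc.IH]]) simp
      then show ?thesis by (simp add: algebra_simps)
    qed
    ultimately have "C_class k (pd i (\<lambda>x. flat_exp n (a * (x $ j) + b)))" for i
      by (cases "i = j") simp_all
    then show ?case
      using pd_coord(2)[OF d] by (simp add: differentiable_iff_on)
  qed
qed

text \<open>A product of flat functions of the distances to the sides of a box. The scaling by \<open>Suc n\<close> drives the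
  values in the open box up to \<open>1\<close>.\<close>

definition bump :: "pt \<Rightarrow> pt \<Rightarrow> nat \<Rightarrow> scal" where
  "bump a b n x = (\<Prod>j\<in>UNIV. flat_exp 0 (real (Suc n) * (x $ j) + - real (Suc n) * a $ j)
                     * flat_exp 0 (- real (Suc n) * (x $ j) + real (Suc n) * b $ j))"

lemma flat_exp_0_nonzero: "flat_exp 0 t \<noteq> 0 \<longleftrightarrow> t > 0" by (simp add: flat_exp_def)

lemma bump_nonzero: "bump a b n x \<noteq> 0 \<longleftrightarrow> x \<in> box a b"
proof -
  have "0 < real (Suc n) * y + - real (Suc n) * z \<longleftrightarrow> z < y" for y z
  proof -
    have "real (Suc n) * y + - real (Suc n) * z = real (Suc n) * (y - z)" by (simp add: algebra_simps)
    then show ?thesis by (simp add: zero_less_mult_iff)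
  qed
  moreover have "0 < - real (Suc n) * y + real (Suc n) * z \<longleftrightarrow> y < z" for y z
  proof -
    have "- real (Suc n) * y + real (Suc n) * z = real (Suc n) * (z - y)" by (simp add: algebra_simps)
    then show ?thesis by (simp add: zero_less_mult_iff)
  qed
  ultimately show ?thesis
    unfolding bump_def mem_box_cart by (simp add: prod_zero_iff flat_exp_0_nonzero del: of_nat_Suc)
qed

lemma bump_bounds: "0 \<le> bump a b n x" "bump a b n x \<le> 1"
proof -
  have f: "0 \<le> flat_exp 0 t" "flat_exp 0 t \<le> 1" for t by (auto simp: flat_exp_def)
  show "0 \<le> bump a b n x" unfolding bump_def using f by (intro prod_nonneg) auto
  show "bump a b n x \<le> 1" unfolding bump_def using f by (intro prod_le_1) (auto intro: mult_le_one)
qed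

lemma bump_tendsto: "x \<in> box a b \<Longrightarrow> (\<lambda>n. bump a b n x) \<longlonglongrightarrow> 1"
proof -
  assume x: "x \<in> box a b"
  have *: "(\<lambda>n. flat_exp 0 (real (Suc n) * s)) \<longlonglongrightarrow> 1" if "s > 0" for s :: real
  proof -
    have "(\<lambda>n. exp (- (inverse (real (Suc n)) * inverse s))) \<longlonglongrightarrow> exp (- (0 * inverse s))"
      by (intro tendsto_intros LIMSEQ_inverse_real_of_nat)
    also have "(\<lambda>n. exp (- (inverse (real (Suc n)) * inverse s))) = (\<lambda>n. flat_exp 0 (real (Suc n) * s))"
      using that by (auto simp: flat_exp_def divide_simps zero_less_mult_iff)
    finally show ?thesis by simp
  qed
  have "(\<lambda>n. \<Prod>j\<in>UNIV. flat_exp 0 (real (Suc n) * (x $ j - a $ j)) * flat_exp 0 (real (Suc n) * (b $ j - x $ j)))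
      \<longlonglongrightarrow> (\<Prod>j\<in>(UNIV::2 set). 1 * 1)"
    using x by (intro tendsto_prod tendsto_mult *) (auto simp: mem_box_cart)
  then show ?thesis by (simp add: bump_def[abs_def] algebra_simps)
qed

lemma bump_test_fun:
  assumes "cbox a b \<subseteq> U"
  shows "test_fun U (bump a b n)"
proof -
  have "smooth (bump a b n)"
    unfolding bump_def[abs_def] UNIV_2 by (auto intro!: smooth_mult smooth_flat_exp)
  moreover have sub: "closure {x. bump a b n x \<noteq> 0} \<subseteq> cbox a b"
    unfolding bump_nonzero by (rule closure_minimal) (use box_subset_cbox in auto)
  moreover have "compact (closure {x. bump a b n x \<noteq> 0})"
    using compact_Int_closed[OF compact_cbox closed_closure, of a b "{x. bump a b n x \<noteq> 0}"] sub
    by (simp add: Int_absorb1)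
  ultimately show ?thesis
    using assms unfolding test_fun_def by blast
qed

lemma sigma_finite_lebesgue: "sigma_finite_measure (lebesgue :: 'a::euclidean_space measure)"
proof
  obtain A :: "'a set set" where A: "countable A" "A \<subseteq> sets lborel" "\<Union>A = space lborel"
      "\<forall>a\<in>A. emeasure lborel a \<noteq> \<infinity>"
    using sigma_finite_lborel unfolding sigma_finite_measure_def by blast
  then show "\<exists>A::'a set set. countable A \<and> A \<subseteq> sets lebesgue \<and> \<Union>A = space lebesgue
      \<and> (\<forall>a\<in>A. emeasure lebesgue a \<noteq> \<infinity>)"
    by (intro exI[of _ A]) auto
qed

text \<open>Boxes are stable under intersection and generate the Borel sets, so the integrals over all Borel sets
  vanish; Lebesgue sets differ from these by null sets.\<close>

lemma null_if_box_integrals_null: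
  fixes f :: scal
  assumes f: "integrable lebesgue f"
    and box: "\<And>a b. (LINT x:box a b|lebesgue. f x) = 0"
    and all: "(LINT x|lebesgue. f x) = 0"
  shows "AE x in lebesgue. f x = 0"
proof (rule sigma_finite_measure.density_zero[OF sigma_finite_lebesgue f])
  have si: "set_integrable lebesgue A f" if "A \<in> sets lebesgue" for A
    unfolding set_integrable_def by (rule integrable_mult_indicator[OF that f])
  have borel: "(LINT x:A|lebesgue. f x) = 0" if "A \<in> sets borel" for A
  proof -
    have A: "A \<in> sigma_sets UNIV (range (\<lambda>(a, b). box a b))"
      using that unfolding borel_eq_box by simp
    have stable: "Int_stable (range (\<lambda>(a, b). box a b :: pt set))"
      unfolding Int_stable_def by (auto simp: box_Int_box)
    have leb: "X \<in> sets lebesgue" if "X \<in> sigma_sets UNIV (range (\<lambda>(a, b). box a b :: pt set))" for X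
    proof -
      have "X \<in> sets borel" using that unfolding borel_eq_box by simp
      then show ?thesis by simp
    qed
    from stable subset_UNIV[of "range (\<lambda>(a, b). box a b)", folded Pow_UNIV] A show ?thesis
    proof (induction rule: sigma_sets_induct_disjoint)
      case (compl A)
      then have A: "A \<in> sets lebesgue" by (intro leb)
      have "(LINT x:A \<union> (UNIV - A)|lebesgue. f x) = (LINT x:A|lebesgue. f x) + (LINT x:UNIV - A|lebesgue. f x)"
        using A by (intro set_integral_Un si) auto
      with compl all show ?case by (simp add: set_lebesgue_integral_def)
    next
      case (union A)
      then have A: "A i \<in> sets lebesgue" for i by (intro leb) blast
      have "(LINT x:(\<Union>i. A i)|lebesgue. f x) = (\<Sum>i. (LINT x:(A i)|lebesgue. f x))"
        using union A by (intro lebesgue_integral_countable_add si) (auto simp: disjoint_family_on_def)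
      with union show ?case by simp
    qed (use box in \<open>auto simp: set_lebesgue_integral_def\<close>)
  qed
  fix A :: "pt set" assume "A \<in> sets lebesgue"
  then obtain S N N' where A: "A = S \<union> N" "N \<subseteq> N'" "N' \<in> null_sets lborel" "S \<in> sets lborel"
    by (rule sets_completionE)
  have "AE x in lebesgue. x \<notin> N'"
    using A(3) by (intro AE_not_in null_sets_completionI)
  then have "AE x in lebesgue. indicat_real A x *\<^sub>R f x = indicat_real S x *\<^sub>R f x"
    by (rule AE_mp) (use A in \<open>auto simp: indicator_def\<close>)
  then have "(LINT x:A|lebesgue. f x) = (LINT x:S|lebesgue. f x)"
    unfolding set_lebesgue_integral_def
    using f si[unfolded set_integrable_def] \<open>A \<in> sets lebesgue\<close> A(4)
    by (intro integral_cong_AE borel_measurable_integrable) auto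
  with borel A(4) show "(LINT x:A|lebesgue. f x) = 0" by simp
qed

text \<open>The bumps converge boundedly to the indicator functions of boxes, so the integral of \<open>f\<close> over every box
  in \<open>U\<close> vanishes. This lemma makes weak derivatives unique almost everywhere, and thereby linear.\<close>

theorem fundamental_lemma:
  fixes f :: scal
  assumes U: "open U" and f: "L2 U f" and test: "\<And>\<phi>. test_fun U \<phi> \<Longrightarrow> l2 U f \<phi> = 0"
  shows "ae_eq U f (\<lambda>_. 0)"
proof -
  have fm: "(\<lambda>x. indicat_real U x *\<^sub>R f x) \<in> borel_measurable lebesgue"
    using f by (simp add: L2_def set_borel_measurable_def)
  have int: "set_integrable lebesgue (box a b) f" if "cbox a b \<subseteq> U" for a b
  proof -
    have sub: "box a b \<subseteq> U" using that box_subset_cbox by blast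
    have "L2 (box a b) f"
    proof -
      have "(\<lambda>x. indicat_real (box a b) x *\<^sub>R (indicat_real U x *\<^sub>R f x)) \<in> borel_measurable lebesgue"
        by (intro borel_measurable_scaleR[OF borel_measurable_indicator fm]) auto
      also have "(\<lambda>x. indicat_real (box a b) x *\<^sub>R (indicat_real U x *\<^sub>R f x)) = (\<lambda>x. indicat_real (box a b) x *\<^sub>R f x)"
        using sub by (auto simp: indicator_def fun_eq_iff)
      finally have "set_borel_measurable lebesgue (box a b) f"
        unfolding set_borel_measurable_def .
      moreover have "set_integrable lebesgue (box a b) (\<lambda>x. (norm (f x))\<^sup>2)"
        using f sub by (auto simp: L2_def intro: set_integrable_subset)
      ultimately show ?thesis by (simp add: L2_def)
    qed
    moreover have "L2 (box a b) (\<lambda>_. 1 :: real)" by (intro L2_continuous) auto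
    ultimately show ?thesis using L2_inner_integrable by fastforce
  qed
  have boxes: "(LINT x:box a b|lebesgue. f x) = 0" if ab: "cbox a b \<subseteq> U" for a b
  proof -
    have sub: "box a b \<subseteq> U" using ab box_subset_cbox by blast
    have "(\<lambda>n. LINT x|lebesgue. indicat_real U x *\<^sub>R (f x \<bullet> bump a b n x))
        \<longlonglongrightarrow> (LINT x|lebesgue. indicat_real (box a b) x *\<^sub>R f x)"
    proof (rule integral_dominated_convergence)
      show "integrable lebesgue (\<lambda>x. norm (indicat_real (box a b) x *\<^sub>R f x))"
        using int[OF ab] by (intro integrable_norm) (simp add: set_integrable_def)
      show "(\<lambda>x. indicat_real (box a b) x *\<^sub>R f x) \<in> borel_measurable lebesgue"
        using int[OF ab] by (intro borel_measurable_integrable) (simp add: set_integrable_def)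
      show "(\<lambda>x. indicat_real U x *\<^sub>R (f x \<bullet> bump a b n x)) \<in> borel_measurable lebesgue" for n
      proof -
        have "bump a b n \<in> borel_measurable lebesgue"
          using smooth_continuous[OF test_fun_smooth[OF bump_test_fun[OF ab]], of UNIV]
          by (simp add: borel_measurable_continuous_onI measurable_completion)
        with fm have "(\<lambda>x. (indicat_real U x *\<^sub>R f x) * bump a b n x) \<in> borel_measurable lebesgue" by measurable
        then show ?thesis by (simp add: mult.assoc)
      qed
      have b: "bump a b n x = 0" if "x \<notin> box a b" for n x using that bump_nonzero by blast
      show "AE x in lebesgue. (\<lambda>n. indicat_real U x *\<^sub>R (f x \<bullet> bump a b n x)) \<longlonglongrightarrow> indicat_real (box a b) x *\<^sub>R f x"
      proof (intro AE_I2)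
        fix x
        show "(\<lambda>n. indicat_real U x *\<^sub>R (f x \<bullet> bump a b n x)) \<longlonglongrightarrow> indicat_real (box a b) x *\<^sub>R f x"
        proof (cases "x \<in> box a b")
          case True
          have "(\<lambda>n. f x * bump a b n x) \<longlonglongrightarrow> f x * 1" by (intro tendsto_intros bump_tendsto True)
          then show ?thesis using True sub by (auto simp: indicator_def)
        qed (simp add: b)
      qed
      show "AE x in lebesgue. norm (indicat_real U x *\<^sub>R (f x \<bullet> bump a b n x)) \<le> norm (indicat_real (box a b) x *\<^sub>R f x)" for n
      proof (intro AE_I2)
        fix x
        show "norm (indicat_real U x *\<^sub>R (f x \<bullet> bump a b n x)) \<le> norm (indicat_real (box a b) x *\<^sub>R f x)"
          using bump_bounds[of a b n x] b[of x n] sub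
          by (cases "x \<in> box a b") (auto simp: indicator_def abs_mult intro: mult_left_le)
      qed
    qed
    moreover have "(LINT x|lebesgue. indicat_real U x *\<^sub>R (f x \<bullet> bump a b n x)) = 0" for n
      using test[OF bump_test_fun[OF ab]] by (simp add: l2_def set_lebesgue_integral_def)
    ultimately show ?thesis by (simp add: set_lebesgue_integral_def LIMSEQ_const_iff)
  qed
  have null: "AE x in lebesgue. x \<in> cbox c d \<longrightarrow> f x = 0" if cd: "cbox c d \<subseteq> U" for c d
  proof -
    let ?F = "\<lambda>x. indicat_real (box c d) x *\<^sub>R f x"
    have "AE x in lebesgue. ?F x = 0"
    proof (rule null_if_box_integrals_null)
      show "integrable lebesgue ?F" using int[OF cd] by (simp add: set_integrable_def)
      show "(LINT x|lebesgue. ?F x) = 0" using boxes[OF cd] by (simp add: set_lebesgue_integral_def)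
      fix a b :: pt
      have "box a b \<inter> box c d = {} \<or> (\<exists>a' b'. box a b \<inter> box c d = box a' b' \<and> cbox a' b' \<subseteq> cbox c d)"
      proof -
        let ?a = "\<chi> i. max (a $ i) (c $ i)" and ?b = "\<chi> i. min (b $ i) (d $ i)"
        have "box a b \<inter> box c d = box ?a ?b" by (auto simp: mem_box_cart)
        moreover have "cbox ?a ?b \<subseteq> cbox c d" by (auto simp: mem_box_cart)
        ultimately show ?thesis by blast
      qed
      then have "(LINT x:box a b \<inter> box c d|lebesgue. f x) = 0"
        using boxes cd by (auto simp: set_lebesgue_integral_def)
      then show "(LINT x:box a b|lebesgue. ?F x) = 0"
        by (simp add: set_lebesgue_integral_def indicator_inter_arith mult.assoc)
    qed
    moreover have "AE x in lebesgue. x \<notin> cbox c d - box c d"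
      using negligible_frontier_interval[of c d] by (intro AE_not_in) (simp add: negligible_iff_null_sets)
    ultimately show ?thesis by eventually_elim (auto simp: indicator_def)
  qed
  obtain \<D> where D: "countable \<D>" "\<D> \<subseteq> Pow U" "\<And>X. X \<in> \<D> \<Longrightarrow> \<exists>a b. X = cbox a b" "\<Union>\<D> = U"
    using open_countable_Union_open_cbox[OF U] by metis
  have "AE x in lebesgue. \<forall>X\<in>\<D>. x \<in> X \<longrightarrow> f x = 0"
  proof (intro AE_ball_countable' D(1))
    fix X assume X: "X \<in> \<D>"
    obtain a b where "X = cbox a b" using D(3)[OF X] by blast
    with X D(2) null[of a b] show "AE x in lebesgue. x \<in> X \<longrightarrow> f x = 0" by blast
  qed
  then show ?thesis unfolding ae_eq_def D(4)[symmetric] by (rule AE_mp) (auto intro!: AE_I2)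
qed

section \<open>Weak derivatives\<close>

lemma L2_smooth: "smooth f \<Longrightarrow> open U \<Longrightarrow> bounded U \<Longrightarrow> L2 U f"
  by (intro L2_continuous smooth_continuous) auto

lemma L2_smooth_vec: "smooth_vec f \<Longrightarrow> open U \<Longrightarrow> bounded U \<Longrightarrow> L2 U f"
  by (rule L2_vec) (auto simp: smooth_vec_def intro: L2_smooth)

lemma L2_const: "open U \<Longrightarrow> bounded U \<Longrightarrow> L2 U (\<lambda>_. c :: 'b::euclidean_space)"
  by (intro L2_continuous) auto

lemma L2_subset:
  fixes f :: "pt \<Rightarrow> 'b::euclidean_space"
  assumes "L2 U f" "V \<subseteq> U" "V \<in> sets lebesgue"
  shows "L2 V f"
proof -
  have "(\<lambda>x. indicat_real V x *\<^sub>R (indicat_real U x *\<^sub>R f x)) \<in> borel_measurable lebesgue"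
    using assms(1) unfolding L2_def set_borel_measurable_def
    by (intro borel_measurable_scaleR[OF borel_measurable_indicator[OF assms(3)]]) blast
  also have "(\<lambda>x. indicat_real V x *\<^sub>R (indicat_real U x *\<^sub>R f x)) = (\<lambda>x. indicat_real V x *\<^sub>R f x)"
    using assms(2) by (auto simp: indicator_def fun_eq_iff)
  finally show ?thesis
    using assms by (auto simp: L2_def set_borel_measurable_def intro: set_integrable_subset)
qed

lemma l2_restrict:
  assumes "V \<subseteq> U" "\<And>x. x \<notin> V \<Longrightarrow> g x = 0"
  shows "l2 U f g = l2 V f g"
  unfolding l2_def set_lebesgue_integral_def
  using assms by (intro Bochner_Integration.integral_cong) (auto simp: indicator_def)

lemma smooth_vec_smooth: "smooth_vec \<psi> \<Longrightarrow> smooth (\<lambda>x. \<psi> x $ i)" by (simp add: smooth_vec_def)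

context
  fixes U :: "pt set"
  assumes U: "open U" "bounded U"
begin

lemma weak_div_combo:
  assumes "L2 U C" "L2 U C'" "L2 U d" "L2 U d'" "weak_div U C d" "weak_div U C' d'"
  shows "weak_div U (\<lambda>x. a *\<^sub>R C x + C' x) (\<lambda>x. a * d x + d' x)"
  unfolding weak_div_def
proof (intro allI impI)
  fix \<phi> assume t: "test_fun U \<phi>"
  have s: "L2 U \<phi>" "L2 U (grad \<phi>)"
    using test_fun_smooth[OF t] U by (auto intro: L2_smooth L2_smooth_vec smooth_vec_grad)
  show "l2 U (\<lambda>x. a *\<^sub>R C x + C' x) (grad \<phi>) = - l2 U (\<lambda>x. a * d x + d' x) \<phi>"
    using l2_combo_left[of U C C' "grad \<phi>" a] l2_combo_left[of U d d' \<phi> a] s assms t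
    by (simp add: weak_div_def)
qed

lemma weak_rot_combo:
  assumes "L2 U C" "L2 U C'" "L2 U d" "L2 U d'" "weak_rot U C d" "weak_rot U C' d'"
  shows "weak_rot U (\<lambda>x. a *\<^sub>R C x + C' x) (\<lambda>x. a * d x + d' x)"
  unfolding weak_rot_def
proof (intro allI impI)
  fix \<phi> assume t: "test_fun U \<phi>"
  have s: "L2 U \<phi>" "L2 U (crotv \<phi>)"
    using test_fun_smooth[OF t] U by (auto intro: L2_smooth L2_smooth_vec smooth_vec_crotv)
  show "l2 U (\<lambda>x. a *\<^sub>R C x + C' x) (crotv \<phi>) = l2 U (\<lambda>x. a * d x + d' x) \<phi>"
    using l2_combo_left[of U C C' "crotv \<phi>" a] l2_combo_left[of U d d' \<phi> a] s assms t
    by (simp add: weak_rot_def)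
qed

lemma weak_grad_combo:
  assumes "L2 U f" "L2 U f'" "L2 U F" "L2 U F'" "weak_grad U f F" "weak_grad U f' F'"
  shows "weak_grad U (\<lambda>x. a * f x + f' x) (\<lambda>x. a *\<^sub>R F x + F' x)"
  unfolding weak_grad_def
proof (intro allI impI)
  fix \<psi> assume t: "test_vec U \<psi>"
  have s: "L2 U \<psi>" "L2 U (cdiv \<psi>)"
    using test_vec_smooth[OF t] U by (auto intro: L2_smooth L2_smooth_vec smooth_cdiv)
  show "l2 U (\<lambda>x. a * f x + f' x) (cdiv \<psi>) = - l2 U (\<lambda>x. a *\<^sub>R F x + F' x) \<psi>"
    using l2_combo_left[of U F F' \<psi> a] l2_combo_left[of U f f' "cdiv \<psi>" a] s assms t
    by (simp add: weak_grad_def)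
qed

lemma weak_rotv_combo:
  assumes "L2 U f" "L2 U f'" "L2 U F" "L2 U F'" "weak_rotv U f F" "weak_rotv U f' F'"
  shows "weak_rotv U (\<lambda>x. a * f x + f' x) (\<lambda>x. a *\<^sub>R F x + F' x)"
  unfolding weak_rotv_def
proof (intro allI impI)
  fix \<psi> assume t: "test_vec U \<psi>"
  have s: "L2 U \<psi>" "L2 U (crot \<psi>)"
    using test_vec_smooth[OF t] U by (auto intro: L2_smooth L2_smooth_vec smooth_crot)
  show "l2 U (\<lambda>x. a * f x + f' x) (crot \<psi>) = l2 U (\<lambda>x. a *\<^sub>R F x + F' x) \<psi>"
    using l2_combo_left[of U F F' \<psi> a] l2_combo_left[of U f f' "crot \<psi>" a] s assms t
    by (simp add: weak_rotv_def)
qed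

lemma ae_eq_if_tests_eq:
  fixes d d' :: scal
  assumes "L2 U d" "L2 U d'" "\<And>\<phi>. test_fun U \<phi> \<Longrightarrow> l2 U d \<phi> = l2 U d' \<phi>"
  shows "ae_eq U d d'"
proof -
  have "ae_eq U (\<lambda>x. -1 *\<^sub>R d' x + d x) (\<lambda>_. 0)"
  proof (rule fundamental_lemma[OF U(1) L2_combo[OF assms(2,1)]])
    fix \<phi> assume t: "test_fun U \<phi>"
    have "L2 U \<phi>" using test_fun_smooth[OF t] U by (auto intro: L2_smooth)
    with assms t show "l2 U (\<lambda>x. -1 *\<^sub>R d' x + d x) \<phi> = 0"
      using l2_combo_left[of U d' d \<phi> "-1"] by simp
  qed
  then show ?thesis by (auto simp: ae_eq_def elim: AE_mp)
qed

lemma ae_eq_if_tests_eq_vec: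
  fixes F F' :: vect
  assumes L: "L2 U F" "L2 U F'" and e: "\<And>\<psi>. test_vec U \<psi> \<Longrightarrow> l2 U F \<psi> = l2 U F' \<psi>"
  shows "ae_eq U F F'"
proof -
  have "ae_eq U (\<lambda>x. F x $ i) (\<lambda>x. F' x $ i)" for i
  proof (rule ae_eq_if_tests_eq[OF L2_component[OF L(1)] L2_component[OF L(2)]])
    fix \<phi> assume t: "test_fun U \<phi>"
    let ?\<psi> = "\<lambda>x. axis i (\<phi> x) :: real^2"
    have "test_fun U (\<lambda>x. ?\<psi> x $ j)" for j
      using t by (cases "j = i") (auto simp: axis_def)
    then have "test_vec U ?\<psi>" by (simp add: test_vec_def)
    from e[OF this] show "l2 U (\<lambda>x. F x $ i) \<phi> = l2 U (\<lambda>x. F' x $ i) \<phi>"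
      by (simp add: l2_def inner_axis)
  qed
  from this[of 1] this[of 2] show ?thesis
    unfolding ae_eq_def by eventually_elim (auto simp: vec_eq_iff forall_2)
qed

lemma weak_div_unique: "L2 U d \<Longrightarrow> L2 U d' \<Longrightarrow> weak_div U C d \<Longrightarrow> weak_div U C d' \<Longrightarrow> ae_eq U d d'"
  by (rule ae_eq_if_tests_eq) (auto simp: weak_div_def)

lemma weak_grad_unique: "L2 U F \<Longrightarrow> L2 U F' \<Longrightarrow> weak_grad U f F \<Longrightarrow> weak_grad U f F' \<Longrightarrow> ae_eq U F F'"
  by (rule ae_eq_if_tests_eq_vec) (auto simp: weak_grad_def)

lemma weak_rotv_unique: "L2 U F \<Longrightarrow> L2 U F' \<Longrightarrow> weak_rotv U f F \<Longrightarrow> weak_rotv U f F' \<Longrightarrow> ae_eq U F F'"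
  by (rule ae_eq_if_tests_eq_vec) (auto simp: weak_rotv_def)

lemma wdiv_unique: "L2 U d \<Longrightarrow> weak_div U C d \<Longrightarrow> ae_eq U (wdiv U C) d"
  unfolding wdiv_def by (rule someI2[where a = d], blast, rule weak_div_unique) blast+

lemma wgrad_unique: "L2 U F \<Longrightarrow> weak_grad U f F \<Longrightarrow> ae_eq U (wgrad U f) F"
  unfolding wgrad_def by (rule someI2[where a = F], blast, rule weak_grad_unique) blast+

lemma wrotv_unique: "L2 U F \<Longrightarrow> weak_rotv U f F \<Longrightarrow> ae_eq U (wrotv U f) F"
  unfolding wrotv_def by (rule someI2[where a = F], blast, rule weak_rotv_unique) blast+

end

lemma wdiv_spec: "C \<in> Hdiv U \<Longrightarrow> L2 U (wdiv U C) \<and> weak_div U C (wdiv U C)"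
proof -
  assume "C \<in> Hdiv U"
  then have "\<exists>d. L2 U d \<and> weak_div U C d" by (simp add: Hdiv_def)
  from someI_ex[OF this] show ?thesis unfolding wdiv_def .
qed

lemma wgrad_spec: "f \<in> H1 U \<Longrightarrow> L2 U (wgrad U f) \<and> weak_grad U f (wgrad U f)"
proof -
  assume "f \<in> H1 U"
  then have "\<exists>d. L2 U d \<and> weak_grad U f d" by (simp add: H1_def)
  from someI_ex[OF this] show ?thesis unfolding wgrad_def .
qed

lemma wrotv_spec: "f \<in> Hrotv U \<Longrightarrow> L2 U (wrotv U f) \<and> weak_rotv U f (wrotv U f)"
proof -
  assume "f \<in> Hrotv U"
  then have "\<exists>d. L2 U d \<and> weak_rotv U f d" by (simp add: Hrotv_def)
  from someI_ex[OF this] show ?thesis unfolding wrotv_def .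
qed

lemma weak_div_cong: "ae_eq U C C' \<Longrightarrow> ae_eq U d d' \<Longrightarrow> weak_div U C d \<longleftrightarrow> weak_div U C' d'"
  unfolding weak_div_def by (simp only: ae_eq_l2[OF _ ae_eq_refl, of U C C'] ae_eq_l2[OF _ ae_eq_refl, of U d d'])

lemma weak_rot_cong: "ae_eq U C C' \<Longrightarrow> ae_eq U d d' \<Longrightarrow> weak_rot U C d \<longleftrightarrow> weak_rot U C' d'"
  unfolding weak_rot_def by (simp only: ae_eq_l2[OF _ ae_eq_refl, of U C C'] ae_eq_l2[OF _ ae_eq_refl, of U d d'])

lemma weak_div_restrict:
  assumes "weak_div U C d" "V \<subseteq> U"
  shows "weak_div V C d"
  unfolding weak_div_def
proof (intro allI impI)
  fix \<phi> assume t: "test_fun V \<phi>"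
  have "l2 U C (grad \<phi>) = - l2 U d \<phi>"
    using assms(1) test_fun_mono[OF t assms(2)] by (simp add: weak_div_def)
  also have "l2 U C (grad \<phi>) = l2 V C (grad \<phi>)"
    by (rule l2_restrict[OF assms(2)]) (rule test_vec_outside[OF test_vec_grad[OF t]])
  also have "l2 U d \<phi> = l2 V d \<phi>"
    by (rule l2_restrict[OF assms(2)]) (rule test_fun_outside[OF t])
  finally show "l2 V C (grad \<phi>) = - l2 V d \<phi>" .
qed

lemma weak_rotv_restrict:
  assumes "weak_rotv U f F" "V \<subseteq> U"
  shows "weak_rotv V f F"
  unfolding weak_rotv_def
proof (intro allI impI)
  fix \<psi> assume t: "test_vec V \<psi>"
  have t1: "test_fun V (pd i (\<lambda>x. \<psi> x $ j))" for i j
    using t unfolding test_vec_def by (intro test_fun_pd) blast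
  have c: "crot \<psi> x = 0" if "x \<notin> V" for x
    unfolding crot_def using test_fun_outside[OF t1 that] by simp
  have "l2 U f (crot \<psi>) = l2 U F \<psi>"
    using assms(1) test_vec_mono[OF t assms(2)] by (simp add: weak_rotv_def)
  also have "l2 U f (crot \<psi>) = l2 V f (crot \<psi>)"
    by (rule l2_restrict[OF assms(2)]) (rule c)
  also have "l2 U F \<psi> = l2 V F \<psi>"
    by (rule l2_restrict[OF assms(2)]) (rule test_vec_outside[OF t])
  finally show "l2 V f (crot \<psi>) = l2 V F \<psi>" .
qed

lemma H1_combo:
  assumes "open U" "bounded U" "f \<in> H1 U" "g \<in> H1 U"
  shows "(\<lambda>x. a * f x + g x) \<in> H1 U"
    and "ae_eq U (wgrad U (\<lambda>x. a * f x + g x)) (\<lambda>x. a *\<^sub>R wgrad U f x + wgrad U g x)"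
proof -
  have L: "L2 U f" "L2 U g" using assms by (auto simp: H1_def)
  note w = wgrad_spec[OF assms(3)] wgrad_spec[OF assms(4)]
  have 1: "L2 U (\<lambda>x. a * f x + g x)" using L2_combo[OF L, of a] by simp
  have 2: "weak_grad U (\<lambda>x. a * f x + g x) (\<lambda>x. a *\<^sub>R wgrad U f x + wgrad U g x)"
    using w L by (intro weak_grad_combo assms) auto
  have 3: "L2 U (\<lambda>x. a *\<^sub>R wgrad U f x + wgrad U g x)" using w by (intro L2_combo) auto
  show "(\<lambda>x. a * f x + g x) \<in> H1 U" using 1 2 3 by (auto simp: H1_def)
  show "ae_eq U (wgrad U (\<lambda>x. a * f x + g x)) (\<lambda>x. a *\<^sub>R wgrad U f x + wgrad U g x)"
    by (rule wgrad_unique[OF assms(1,2) 3 2])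
qed

lemma Hrotv_combo:
  assumes "open U" "bounded U" "f \<in> Hrotv U" "g \<in> Hrotv U"
  shows "(\<lambda>x. a * f x + g x) \<in> Hrotv U"
    and "ae_eq U (wrotv U (\<lambda>x. a * f x + g x)) (\<lambda>x. a *\<^sub>R wrotv U f x + wrotv U g x)"
proof -
  have L: "L2 U f" "L2 U g" using assms by (auto simp: Hrotv_def)
  note w = wrotv_spec[OF assms(3)] wrotv_spec[OF assms(4)]
  have 1: "L2 U (\<lambda>x. a * f x + g x)" using L2_combo[OF L, of a] by simp
  have 2: "weak_rotv U (\<lambda>x. a * f x + g x) (\<lambda>x. a *\<^sub>R wrotv U f x + wrotv U g x)"
    using w L by (intro weak_rotv_combo assms) auto
  have 3: "L2 U (\<lambda>x. a *\<^sub>R wrotv U f x + wrotv U g x)" using w by (intro L2_combo) auto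
  show "(\<lambda>x. a * f x + g x) \<in> Hrotv U" using 1 2 3 by (auto simp: Hrotv_def)
  show "ae_eq U (wrotv U (\<lambda>x. a * f x + g x)) (\<lambda>x. a *\<^sub>R wrotv U f x + wrotv U g x)"
    by (rule wrotv_unique[OF assms(1,2) 3 2])
qed

lemma Hdiv_combo:
  assumes "open U" "bounded U" "C \<in> Hdiv U" "C' \<in> Hdiv U"
  shows "(\<lambda>x. a *\<^sub>R C x + C' x) \<in> Hdiv U"
    and "ae_eq U (wdiv U (\<lambda>x. a *\<^sub>R C x + C' x)) (\<lambda>x. a * wdiv U C x + wdiv U C' x)"
proof -
  have L: "L2 U C" "L2 U C'" using assms by (auto simp: Hdiv_def)
  note w = wdiv_spec[OF assms(3)] wdiv_spec[OF assms(4)]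
  have 1: "L2 U (\<lambda>x. a *\<^sub>R C x + C' x)" by (rule L2_combo[OF L])
  have 2: "weak_div U (\<lambda>x. a *\<^sub>R C x + C' x) (\<lambda>x. a * wdiv U C x + wdiv U C' x)"
    using w L by (intro weak_div_combo assms) auto
  have 3: "L2 U (\<lambda>x. a * wdiv U C x + wdiv U C' x)" using w L2_combo[of U "wdiv U C" "wdiv U C'" a] by auto
  show "(\<lambda>x. a *\<^sub>R C x + C' x) \<in> Hdiv U" using 1 2 3 by (auto simp: Hdiv_def)
  show "ae_eq U (wdiv U (\<lambda>x. a *\<^sub>R C x + C' x)) (\<lambda>x. a * wdiv U C x + wdiv U C' x)"
    by (rule wdiv_unique[OF assms(1,2) 3 2])
qed

lemma Hrot_combo:
  assumes "open U" "bounded U" "C \<in> Hrot U" "C' \<in> Hrot U"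
  shows "(\<lambda>x. a *\<^sub>R C x + C' x) \<in> Hrot U"
proof -
  obtain w w' where w: "L2 U w" "weak_rot U C w" "L2 U w'" "weak_rot U C' w'" "L2 U C" "L2 U C'"
    using assms by (auto simp: Hrot_def)
  have "weak_rot U (\<lambda>x. a *\<^sub>R C x + C' x) (\<lambda>x. a * w x + w' x)" using w by (intro weak_rot_combo assms)
  moreover have "L2 U (\<lambda>x. a * w x + w' x)" using L2_combo[OF w(1,3), of a] by simp
  moreover have "L2 U (\<lambda>x. a *\<^sub>R C x + C' x)" using w by (intro L2_combo)
  ultimately show ?thesis by (auto simp: Hrot_def)
qed

text \<open>The rotation of a scalar is its gradient turned by a right angle: the test field is turned as well.\<close>

lemma weak_rotv_of_weak_grad:
  assumes "open U" "bounded U" "L2 U F" "weak_grad U D F"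
  shows "weak_rotv U D (\<lambda>x. vector [F x $ 2, - (F x $ 1)])"
  unfolding weak_rotv_def
proof (intro allI impI)
  fix \<psi> assume t: "test_vec U \<psi>"
  let ?\<eta> = "\<lambda>x. vector [\<psi> x $ 2, - (\<psi> x $ 1)] :: real^2"
  have te: "test_vec U ?\<eta>" using t by (auto simp: test_vec_def forall_2 test_fun_uminus)
  have "cdiv ?\<eta> = crot \<psi>"
    by (rule ext) (simp add: cdiv_def crot_def pd_uminus[OF smooth_vec_smooth[OF test_vec_smooth[OF t]]])
  moreover have "l2 U D (cdiv ?\<eta>) = - l2 U F ?\<eta>" using assms(4) te by (simp add: weak_grad_def)
  ultimately have "l2 U D (crot \<psi>) = - l2 U F ?\<eta>" by simp
  also have "\<dots> = l2 U (\<lambda>x. vector [F x $ 2, - (F x $ 1)]) \<psi>"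
  proof -
    have e: "vector [F x $ 2, - (F x $ 1)] \<bullet> \<psi> x = - (F x \<bullet> ?\<eta> x)" for x
      by (simp add: inner_vec_def sum_2)
    show ?thesis by (simp add: l2_def e set_lebesgue_integral_def)
  qed
  finally show "l2 U D (crot \<psi>) = l2 U (\<lambda>x. vector [F x $ 2, - (F x $ 1)]) \<psi>" .
qed

text \<open>The gradient of a test function is a test field, whose rotation vanishes by the symmetry of second
  derivatives.\<close>

lemma weak_div_of_weak_rotv:
  assumes "weak_rotv U D F"
  shows "weak_div U F (\<lambda>_. 0)"
  unfolding weak_div_def
proof (intro allI impI)
  fix \<phi> assume t: "test_fun U \<phi>"
  have "l2 U F (grad \<phi>) = l2 U D (crot (grad \<phi>))"
    using assms test_vec_grad[OF t] by (simp add: weak_rotv_def)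
  then show "l2 U F (grad \<phi>) = - l2 U (\<lambda>_. 0) \<phi>"
    by (simp add: crot_grad[OF test_fun_smooth[OF t]])
qed

section \<open>Winding numbers of polygons\<close>

definition cpx :: "pt \<Rightarrow> complex" where "cpx p = Complex (p $ 1) (p $ 2)"

lemma cpx_sel [simp]: "Re (cpx p) = p $ 1" "Im (cpx p) = p $ 2" by (simp_all add: cpx_def)

lemma linear_cpx: "linear cpx"
  by (rule linearI) (auto simp: complex_eq_iff)

lemma cpx_zero [simp]: "cpx 0 = 0" by (simp add: complex_eq_iff)

lemma inj_cpx: "inj cpx"
  by (auto simp: inj_def complex_eq_iff vec_eq_iff forall_2)

lemma cpx_eq_iff [simp]: "cpx a = cpx b \<longleftrightarrow> a = b" using inj_cpx by (auto simp: inj_def)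

lemma homeomorphism_cpx: "homeomorphism UNIV UNIV cpx (\<lambda>z. vector [Re z, Im z])"
proof (rule homeomorphismI)
  show "continuous_on UNIV cpx"
    using linear_cpx by (simp add: linear_continuous_on linear_conv_bounded_linear)
  have "continuous_on UNIV (\<lambda>z. if i = 1 then Re z else Im z)" for i :: 2
    by (cases "i = 1") (auto intro: continuous_intros)
  then have "continuous_on UNIV (\<lambda>z. (\<chi> i. if i = 1 then Re z else Im z) :: pt)"
    by (rule continuous_on_vec_lambda)
  also have "(\<lambda>z. (\<chi> i. if i = 1 then Re z else Im z) :: pt) = (\<lambda>z. vector [Re z, Im z])"
    by (simp add: fun_eq_iff vec_eq_iff forall_2)
  finally show "continuous_on UNIV (\<lambda>z. vector [Re z, Im z] :: pt)" .
qed (auto simp: complex_eq_iff vec_eq_iff forall_2)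

lemma cpx_segment: "cpx ` closed_segment a b = closed_segment (cpx a) (cpx b)"
  using closed_segment_linear_image[OF linear_cpx] by simp

lemma cpx_in_segment [simp]: "cpx z \<in> closed_segment (cpx a) (cpx b) \<longleftrightarrow> z \<in> closed_segment a b"
  unfolding cpx_segment[symmetric] using inj_cpx by (auto simp: inj_def)

lemma bounded_cpx: "bounded (cpx ` S) \<longleftrightarrow> bounded S"
proof -
  have "norm (cpx p) = norm p" for p
    by (simp add: cmod_def norm_vec_def L2_set_def sum_2)
  then show ?thesis by (auto simp: bounded_iff)
qed

lemma inside_cpx: "cpx z \<in> inside (cpx ` S) \<longleftrightarrow> z \<in> inside S"
proof (cases "z \<in> S")
  case False
  have "homeomorphism (- S) (- (cpx ` S)) cpx (\<lambda>z. vector [Re z, Im z])"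
    using homeomorphism_of_subsets[OF homeomorphism_cpx, of "- S" "- (cpx ` S)"] inj_cpx
      homeomorphism_image1[OF homeomorphism_cpx]
    by (simp add: bij_def surj_def bij_image_Compl_eq)
  then have "connected_component_set (- (cpx ` S)) (cpx z) = cpx ` connected_component_set (- S) z"
    by (rule connected_component_set_homeomorphism) (use False in simp)
  with False show ?thesis by (simp add: inside_def bounded_cpx inj_image_mem_iff[OF inj_cpx])
qed (simp add: inside_def)

fun polypath :: "complex \<Rightarrow> complex list \<Rightarrow> real \<Rightarrow> complex" where
  "polypath a [] = linepath a a"
| "polypath a [b] = linepath a b"
| "polypath a (b # c # xs) = linepath a b +++ polypath b (c # xs)"

lemma pathstart_polypath [simp]: "pathstart (polypath a xs) = a"
  by (induction a xs rule: polypath.induct) (simp add: pathstart_def, simp_all)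

lemma pathfinish_polypath: "pathfinish (polypath a xs) = (if xs = [] then a else last xs)"
  by (induction a xs rule: polypath.induct) (simp add: pathfinish_def, simp_all)

lemma path_polypath [simp]: "path (polypath a xs)"
  by (induction a xs rule: polypath.induct) (simp add: path_def, simp_all)

lemma path_image_polypath:
  "xs \<noteq> [] \<Longrightarrow> path_image (polypath a xs) = (\<Union>(p, q)\<in>set (zip (a # xs) xs). closed_segment p q)"
  by (induction a xs rule: polypath.induct) (auto simp: path_image_join)

lemma winding_number_polypath:
  "xs \<noteq> [] \<Longrightarrow> z \<notin> path_image (polypath a xs) \<Longrightarrow>
     winding_number (polypath a xs) z = (\<Sum>(p, q)\<leftarrow>zip (a # xs) xs. winding_number (linepath p q) z)"
proof (induction a xs rule: polypath.induct)
  case (3 a b c xs)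
  have "winding_number (polypath a (b # c # xs)) z
      = winding_number (linepath a b) z + winding_number (polypath b (c # xs)) z"
    unfolding polypath.simps using 3(3) by (intro winding_number_join) (auto simp: path_image_join)
  with 3 show ?case by (simp add: path_image_join)
qed auto

lemma arc_polypath:
  assumes "xs \<noteq> []" "distinct (a # xs)"
    and "\<And>p q r s. (p, q) \<in> set (zip (a # xs) xs) \<Longrightarrow> (r, s) \<in> set (zip (a # xs) xs) \<Longrightarrow> (p, q) \<noteq> (r, s)
       \<Longrightarrow> closed_segment p q \<inter> closed_segment r s \<subseteq> {p, q} \<inter> {r, s}"
  shows "arc (polypath a xs)"
  using assms
proof (induction a xs rule: polypath.induct)
  case (3 a b c xs)
  have "arc (linepath a b +++ polypath b (c # xs))"
  proof (rule arc_join)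
    show "arc (polypath b (c # xs))"
      by (rule 3(1)) (use 3(3,4) in auto)
    show "path_image (linepath a b) \<inter> path_image (polypath b (c # xs)) \<subseteq> {pathstart (polypath b (c # xs))}"
    proof
      fix z assume z: "z \<in> path_image (linepath a b) \<inter> path_image (polypath b (c # xs))"
      then obtain p q where pq: "(p, q) \<in> set (zip (b # c # xs) (c # xs))" "z \<in> closed_segment p q"
        by (auto simp: path_image_polypath)
      then have m: "p \<in> set (b # c # xs)" "q \<in> set (c # xs)" by (auto dest: set_zip_leftD set_zip_rightD)
      with 3(3) have "a \<noteq> p" "a \<noteq> q" by auto
      moreover have "closed_segment a b \<inter> closed_segment p q \<subseteq> {a, b} \<inter> {p, q}"
        using pq(1) \<open>a \<noteq> p\<close> by (intro 3(4)) auto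
      ultimately show "z \<in> {pathstart (polypath b (c # xs))}" using z pq(2) by auto
    qed
  qed (use 3 in auto)
  then show ?case by simp
qed auto

lemma zip_rotate1: "zip (a # ps @ [a]) (ps @ [a]) = zip (a # ps) (rotate1 (a # ps))"
  using zip_append1[of "a # ps" "[a]" "ps @ [a]"] by simp

lemma finite_edges [simp]: "finite (edges P)" by (simp add: edges_def)

lemma distinct_zip_rotate1: "distinct P \<Longrightarrow> distinct (zip P (rotate1 P))"
  by (simp add: distinct_zipI1)

lemma sum_edges: "distinct P \<Longrightarrow> (\<Sum>e\<in>edges P. f e) = (\<Sum>e\<leftarrow>zip P (rotate1 P). f e)"
  unfolding edges_def by (simp add: sum_list_distinct_conv_sum_set distinct_zip_rotate1)

text \<open>The end points of the edges are the starting points in rotated order.\<close>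

lemma sum_edges_telescope:
  fixes f :: "pt \<Rightarrow> 'b::ab_group_add"
  assumes "distinct P"
  shows "(\<Sum>(a, b)\<in>edges P. f b - f a) = 0"
proof -
  have "(\<Sum>(a, b)\<leftarrow>zip P (rotate1 P). f b - f a) = sum_list (map f (rotate1 P)) - sum_list (map f P)"
  proof -
    have "(\<Sum>(a, b)\<leftarrow>zip xs ys. f b - f a) = sum_list (map f ys) - sum_list (map f xs)"
      if "length xs = length ys" for xs ys
      using that by (induction xs ys rule: list_induct2) (auto simp: algebra_simps)
    then show ?thesis by simp
  qed
  also have "sum_list (map f (rotate1 P)) = sum_list (map f P)"
    by (cases P) (simp_all add: add.commute)
  finally show ?thesis using assms by (simp add: sum_edges)
qed

lemma edges_distinct:
  assumes "polygon P" "(a, b) \<in> edges P"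
  shows "a \<noteq> b"
proof -
  have P: "distinct P" "length P \<ge> 3" using assms by (auto simp: polygon_def)
  obtain i where i: "i < length P" "a = P ! i" "b = rotate1 P ! i"
    using assms(2) by (auto simp: edges_def in_set_zip)
  then have "b = P ! (Suc i mod length P)" by (simp add: nth_rotate1)
  moreover have "Suc i mod length P \<noteq> i" using i(1) P(2) by (auto simp: mod_Suc)
  moreover have "Suc i mod length P < length P" using P(2) by (intro mod_less_divisor) linarith
  ultimately show ?thesis using i P(1) by (simp add: nth_eq_iff_index_eq)
qed

lemma zip_map_cpx: "zip (map cpx xs) (map cpx ys) = map (map_prod cpx cpx) (zip xs ys)"
  by (simp add: zip_map_map map_prod_def)

text \<open>The contribution of a segment to a winding number, in general not an integer.\<close>

definition wnseg :: "pt \<Rightarrow> pt \<Rightarrow> pt \<Rightarrow> real" where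
  "wnseg a b z = Re (winding_number (linepath (cpx a) (cpx b)) (cpx z))"

text \<open>The edges form a simple closed path. Its winding number is the sum of the contributions of the edges,
  constantly \<open>1\<close> or constantly \<open>-1\<close> on the inside, and \<open>0\<close> on the outside.\<close>

lemma polygon_winding:
  assumes P: "polygon P"
  obtains \<sigma> :: real where "\<sigma> = 1 \<or> \<sigma> = -1"
    "\<And>z. z \<notin> bdry P \<Longrightarrow> (\<Sum>(a, b)\<in>edges P. wnseg a b z) = \<sigma> * indicat_real (region P) z"
proof -
  have dP: "distinct P" "length P \<ge> 3" using P by (auto simp: polygon_def)
  obtain p0 p1 p2 ps where P_eq: "P = p0 # p1 # p2 # ps"
    using dP(2) by (auto simp: numeral_3_eq_3 Suc_le_length_iff)
  have cross: "closed_segment p q \<inter> closed_segment r s \<subseteq> {p, q} \<inter> {r, s}"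
    if "(p, q) \<in> edges P" "(r, s) \<in> edges P" "(p, q) \<noteq> (r, s)" for p q r s
    using P that unfolding polygon_def by fast
  let ?c = "map cpx (p1 # p2 # ps @ [p0])"
  have zipc: "zip (cpx p0 # ?c) ?c = map (map_prod cpx cpx) (zip P (rotate1 P))"
    using zip_rotate1[of p0 "p1 # p2 # ps"] zip_map_cpx[of "p0 # p1 # p2 # ps @ [p0]" "p1 # p2 # ps @ [p0]"]
    unfolding P_eq by simp
  let ?\<gamma> = "polypath (cpx p0) ?c"
  have image: "path_image ?\<gamma> = cpx ` bdry P"
  proof -
    have "path_image ?\<gamma> = (\<Union>(p, q)\<in>set (zip (cpx p0 # ?c) ?c). closed_segment p q)"
      by (rule path_image_polypath) simp
    also have "\<dots> = (\<Union>(p, q)\<in>edges P. cpx ` closed_segment p q)"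
      unfolding zipc edges_def by (auto simp: cpx_segment)
    finally show ?thesis by (auto simp: bdry_def)
  qed
  \<comment> \<open>The edges after the first one form an arc from \<open>p1\<close> back to \<open>p0\<close>, which closes up with the first edge.\<close>
  have sub: "zip (p1 # p2 # ps @ [p0]) (p2 # ps @ [p0]) = tl (zip P (rotate1 P))"
    using zip_rotate1[of p0 "p1 # p2 # ps"] unfolding P_eq by simp
  have tl_edges: "(p, q) \<in> edges P \<and> p \<noteq> p0" if "(p, q) \<in> set (zip (p1 # p2 # ps @ [p0]) (p2 # ps @ [p0]))" for p q
  proof
    show "(p, q) \<in> edges P" using that unfolding sub edges_def P_eq by (simp add: list.set_sel(2))
    have "zip (p1 # p2 # ps @ [p0]) (p2 # ps @ [p0]) = zip (p1 # p2 # ps) (p2 # ps @ [p0])"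
      using zip_append1[of "p1 # p2 # ps" "[p0]" "p2 # ps @ [p0]"] by simp
    with that have "p \<in> set (p1 # p2 # ps)" by (metis set_zip_leftD)
    then show "p \<noteq> p0" using dP(1) unfolding P_eq by auto
  qed
  have "arc (polypath (cpx p1) (map cpx (p2 # ps @ [p0])))"
  proof (rule arc_polypath)
    have "distinct (p1 # p2 # ps @ [p0])" using dP(1) unfolding P_eq by auto
    then have "distinct (map cpx (p1 # p2 # ps @ [p0]))"
      unfolding distinct_map using inj_cpx inj_on_subset by blast
    then show "distinct (cpx p1 # map cpx (p2 # ps @ [p0]))" by simp
    fix p q r s
    have z: "zip (cpx p1 # map cpx (p2 # ps @ [p0])) (map cpx (p2 # ps @ [p0]))
        = map (map_prod cpx cpx) (zip (p1 # p2 # ps @ [p0]) (p2 # ps @ [p0]))"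
      using zip_map_cpx[of "p1 # p2 # ps @ [p0]" "p2 # ps @ [p0]"] by simp
    assume "(p, q) \<in> set (zip (cpx p1 # map cpx (p2 # ps @ [p0])) (map cpx (p2 # ps @ [p0])))"
      and "(r, s) \<in> set (zip (cpx p1 # map cpx (p2 # ps @ [p0])) (map cpx (p2 # ps @ [p0])))"
      and ne: "(p, q) \<noteq> (r, s)"
    then obtain p' q' r' s' where e: "p = cpx p'" "q = cpx q'" "r = cpx r'" "s = cpx s'"
       "(p', q') \<in> edges P" "(r', s') \<in> edges P"
      unfolding z using tl_edges by (auto simp: map_prod_def)
    then have "closed_segment p' q' \<inter> closed_segment r' s' \<subseteq> {p', q'} \<inter> {r', s'}"
      using ne by (intro cross) auto
    then have "cpx ` (closed_segment p' q' \<inter> closed_segment r' s') \<subseteq> cpx ` ({p', q'} \<inter> {r', s'})" by (rule image_mono)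
    then show "closed_segment p q \<inter> closed_segment r s \<subseteq> {p, q} \<inter> {r, s}"
      unfolding image_Int[OF inj_cpx] cpx_segment e by simp
  qed simp
  moreover have "arc (linepath (cpx p0) (cpx p1))" using dP(1) unfolding P_eq by auto
  moreover have "path_image (linepath (cpx p0) (cpx p1)) \<inter> path_image (polypath (cpx p1) (map cpx (p2 # ps @ [p0]))) \<subseteq> {cpx p0, cpx p1}"
  proof
    fix z assume z: "z \<in> path_image (linepath (cpx p0) (cpx p1)) \<inter> path_image (polypath (cpx p1) (map cpx (p2 # ps @ [p0])))"
    then obtain y where y: "z = cpx y" "y \<in> closed_segment p0 p1" by (auto simp: cpx_segment[symmetric])
    obtain p q where pq: "(p, q) \<in> set (zip (cpx p1 # map cpx (p2 # ps @ [p0])) (map cpx (p2 # ps @ [p0])))" "z \<in> closed_segment p q"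
      using z path_image_polypath[of "map cpx (p2 # ps @ [p0])" "cpx p1"] by auto
    have "zip (cpx p1 # map cpx (p2 # ps @ [p0])) (map cpx (p2 # ps @ [p0]))
        = map (map_prod cpx cpx) (zip (p1 # p2 # ps @ [p0]) (p2 # ps @ [p0]))"
      using zip_map_cpx[of "p1 # p2 # ps @ [p0]" "p2 # ps @ [p0]"] by simp
    with pq(1) have "(p, q) \<in> map_prod cpx cpx ` set (zip (p1 # p2 # ps @ [p0]) (p2 # ps @ [p0]))"
      by (simp only: set_map)
    then obtain p' q' where pq': "(p', q') \<in> set (zip (p1 # p2 # ps @ [p0]) (p2 # ps @ [p0]))"
        and e: "p = cpx p'" "q = cpx q'" by auto
    note e = e tl_edges[OF pq', THEN conjunct1] tl_edges[OF pq', THEN conjunct2]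
    have "closed_segment p0 p1 \<inter> closed_segment p' q' \<subseteq> {p0, p1} \<inter> {p', q'}"
      using e(3,4) unfolding P_eq by (intro cross[unfolded P_eq]) (auto simp: edges_def)
    with y pq(2) e show "z \<in> {cpx p0, cpx p1}" by auto
  qed
  ultimately have simple: "simple_path ?\<gamma>"
    using simple_path_join_loop[of "linepath (cpx p0) (cpx p1)" "polypath (cpx p1) (map cpx (p2 # ps @ [p0]))"]
    by (simp add: pathfinish_polypath)
  have wn: "Re (winding_number ?\<gamma> (cpx z)) = (\<Sum>(a, b)\<in>edges P. wnseg a b z)" if z: "z \<notin> bdry P" for z
  proof -
    have "cpx z \<notin> path_image ?\<gamma>" using z unfolding image by (auto dest: injD[OF inj_cpx])
    then have "winding_number ?\<gamma> (cpx z) = (\<Sum>(p, q)\<leftarrow>zip (cpx p0 # ?c) ?c. winding_number (linepath p q) (cpx z))"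
      by (intro winding_number_polypath) simp
    also have "\<dots> = (\<Sum>(a, b)\<leftarrow>zip P (rotate1 P). winding_number (linepath (cpx a) (cpx b)) (cpx z))"
      unfolding zipc by (simp add: o_def case_prod_unfold)
    also have "\<dots> = (\<Sum>(a, b)\<in>edges P. winding_number (linepath (cpx a) (cpx b)) (cpx z))"
      using sum_edges[OF dP(1)] by metis
    finally show ?thesis by (simp add: wnseg_def case_prod_unfold)
  qed
  have out: "winding_number ?\<gamma> (cpx z) = 0" if "z \<notin> bdry P" "z \<notin> region P" for z
  proof (rule winding_number_zero_in_outside)
    have "cpx z \<notin> inside (cpx ` bdry P)" "cpx z \<notin> cpx ` bdry P"
      using that by (auto simp: inside_cpx region_def)
    then show "cpx z \<in> outside (path_image ?\<gamma>)"
      unfolding image using inside_Un_outside[of "cpx ` bdry P"] by blast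
  qed (auto simp: pathfinish_polypath)
  have inn: "cpx z \<in> inside (path_image ?\<gamma>)" if "z \<in> region P" for z
    using that unfolding image by (simp add: inside_cpx region_def)
  from simple show ?thesis
  proof (rule simple_closed_path_winding_number_inside)
    assume w: "\<And>z. z \<in> inside (path_image ?\<gamma>) \<Longrightarrow> winding_number ?\<gamma> z = 1"
    show ?thesis
      by (rule that[of 1]) (use w[OF inn] out in \<open>auto simp: wn[symmetric] indicator_def\<close>)
  next
    assume w: "\<And>z. z \<in> inside (path_image ?\<gamma>) \<Longrightarrow> winding_number ?\<gamma> z = -1"
    show ?thesis
      by (rule that[of "-1"]) (use w[OF inn] out in \<open>auto simp: wn[symmetric] indicator_def\<close>)
  qed
qed

section \<open>The divergence theorem on a triangle\<close>

definition cross2 :: "pt \<Rightarrow> pt \<Rightarrow> real" where "cross2 a b = a $ 1 * b $ 2 - a $ 2 * b $ 1"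

definition simplex2 :: "pt set" where "simplex2 = {\<xi>. 0 \<le> \<xi> $ 1 \<and> 0 \<le> \<xi> $ 2 \<and> \<xi> $ 1 + \<xi> $ 2 \<le> 1}"

definition span2 :: "pt \<Rightarrow> pt \<Rightarrow> pt \<Rightarrow> pt" where "span2 a b \<xi> = \<xi> $ 1 *\<^sub>R a + \<xi> $ 2 *\<^sub>R b"

lemma linear_span2: "linear (span2 a b)"
  by (rule linearI) (auto simp: span2_def algebra_simps)

lemma det_span2: "det (matrix (span2 a b)) = cross2 a b"
  by (simp add: det_2 matrix_def span2_def axis_def cross2_def mult.commute)

lemma image_simplex2: "span2 a b ` simplex2 = convex hull {0, a, b}"
proof (intro set_eqI iffI)
  fix z assume "z \<in> span2 a b ` simplex2"
  then obtain \<xi> where x: "\<xi> \<in> simplex2" "z = span2 a b \<xi>" by blast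
  then show "z \<in> convex hull {0, a, b}"
    unfolding convex_hull_3 simplex2_def span2_def
    by (intro CollectI exI[of _ "1 - \<xi> $ 1 - \<xi> $ 2"] exI[of _ "\<xi> $ 1"] exI[of _ "\<xi> $ 2"]) auto
next
  fix z assume "z \<in> convex hull {0, a, b}"
  then obtain u v w where w: "0 \<le> u" "0 \<le> v" "0 \<le> w" "u + v + w = 1" "z = u *\<^sub>R 0 + v *\<^sub>R a + w *\<^sub>R b"
    unfolding convex_hull_3 by auto
  then show "z \<in> span2 a b ` simplex2"
    by (intro image_eqI[of _ _ "vector [v, w]"]) (auto simp: span2_def simplex2_def)
qed

lemma compact_simplex2: "compact simplex2"
proof -
  have "span2 (axis 1 1) (axis 2 1) = (\<lambda>\<xi>. \<xi>)"
    by (auto simp: fun_eq_iff span2_def vec_eq_iff forall_2 axis_def)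
  then have "simplex2 = span2 (axis 1 1) (axis 2 1) ` simplex2" by simp
  also have "compact \<dots>"
    unfolding image_simplex2 by (intro compact_convex_hull) auto
  finally show ?thesis .
qed

lemma vector_measurable: "(\<lambda>(x, y). vector [x, y] :: pt) \<in> borel_measurable (lborel \<Otimes>\<^sub>M lborel)"
proof -
  have "(\<lambda>p. fst p *\<^sub>R axis 1 1 + snd p *\<^sub>R axis 2 1 :: pt) \<in> borel_measurable (lborel \<Otimes>\<^sub>M lborel :: (real \<times> real) measure)"
    by measurable
  also have "(\<lambda>p. fst p *\<^sub>R axis 1 1 + snd p *\<^sub>R axis 2 1 :: pt) = (\<lambda>(x, y). vector [x, y])"
    by (auto simp: vec_eq_iff forall_2 axis_def)
  finally show ?thesis .
qed

text \<open>Presents the measure of the plane as a product measure, for the use of Fubini's theorem.\<close>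

lemma lborel_pt: "distr (lborel \<Otimes>\<^sub>M lborel) borel (\<lambda>(x, y). vector [x, y] :: pt) = lborel"
proof (rule sym, rule lborel_eqI)
  fix l u :: pt assume le: "\<And>b. b \<in> Basis \<Longrightarrow> l \<bullet> b \<le> u \<bullet> b"
  have le': "l $ 1 \<le> u $ 1" "l $ 2 \<le> u $ 2"
    using le[of "axis 1 1"] le[of "axis 2 1"] by (auto simp: inner_axis axis_in_Basis_iff)
  have "emeasure (distr (lborel \<Otimes>\<^sub>M lborel) borel (\<lambda>(x, y). vector [x, y] :: pt)) (box l u)
      = emeasure (lborel \<Otimes>\<^sub>M lborel) ({l $ 1<..<u $ 1} \<times> {l $ 2<..<u $ 2})"
    using vector_measurable by (subst emeasure_distr) (auto simp: case_prod_unfold space_pair_measure mem_box_cart forall_2 intro!: arg_cong[where f = "emeasure _"])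
  also have "\<dots> = ennreal (u $ 1 - l $ 1) * ennreal (u $ 2 - l $ 2)"
    using le' by (subst lborel.emeasure_pair_measure_Times) auto
  also have "\<dots> = ennreal ((u $ 1 - l $ 1) * (u $ 2 - l $ 2))" using le' by (simp add: ennreal_mult)
  also have "(u $ 1 - l $ 1) * (u $ 2 - l $ 2) = (\<Prod>b\<in>Basis. (u - l) \<bullet> b)"
  proof -
    have B: "Basis = {axis 1 1, axis 2 1 :: pt}" by (auto simp: Basis_vec_def UNIV_2)
    have "axis 1 1 \<noteq> (axis 2 1 :: pt)" by (auto simp: axis_eq_axis)
    then have "(\<Prod>b\<in>{axis 1 1, axis 2 1}. (u - l) \<bullet> b) = ((u - l) \<bullet> axis 1 1) * ((u - l) \<bullet> axis 2 1)" by simp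
    then show ?thesis unfolding B by (simp add: inner_axis)
  qed
  finally show "emeasure (distr (lborel \<Otimes>\<^sub>M lborel) borel (\<lambda>(x, y). vector [x, y] :: pt)) (box l u)
     = ennreal (\<Prod>b\<in>Basis. (u - l) \<bullet> b)" .
qed simp

lemma integral_pt:
  fixes f :: "pt \<Rightarrow> real"
  assumes f: "integrable lborel f"
  shows "(LINT p|lborel. f p) = (LINT x|lborel. LINT y|lborel. f (vector [x, y]))"
    and "(LINT p|lborel. f p) = (LINT y|lborel. LINT x|lborel. f (vector [x, y]))"
proof -
  let ?V = "\<lambda>(x, y). vector [x, y] :: pt"
  have fb: "f \<in> borel_measurable borel" using f by (simp add: borel_measurable_integrable)
  have i: "integrable (lborel \<Otimes>\<^sub>M lborel) (\<lambda>p. f (?V p))"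
    using f integrable_distr_eq[OF vector_measurable fb] unfolding lborel_pt by simp
  have "(LINT p|lborel. f p) = (LINT p|(lborel \<Otimes>\<^sub>M lborel). f (?V p))"
    using integral_distr[OF vector_measurable fb] unfolding lborel_pt .
  also have "\<dots> = (LINT x|lborel. LINT y|lborel. f (vector [x, y]))"
    using lborel_pair.integral_fst'[OF i] by simp
  finally show 1: "(LINT p|lborel. f p) = (LINT x|lborel. LINT y|lborel. f (vector [x, y]))" .
  have "(LINT x|lborel. LINT y|lborel. f (vector [x, y])) = (LINT y|lborel. LINT x|lborel. f (vector [x, y]))"
    using lborel_pair.Fubini_integral[of "\<lambda>x y. f (vector [x, y])"] i by (simp add: case_prod_unfold)
  with 1 show "(LINT p|lborel. f p) = (LINT y|lborel. LINT x|lborel. f (vector [x, y]))" by simp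
qed

lemma smooth_FTC:
  assumes F: "smooth F" and r: "0 \<le> r"
  shows "(LINT t|lborel. indicat_real {0..r} t *\<^sub>R pd i F (y + t *\<^sub>R axis i 1)) = F (y + r *\<^sub>R axis i 1) - F y"
proof -
  have d: "((\<lambda>t. F (y + t *\<^sub>R axis i 1)) has_real_derivative pd i F (y + t *\<^sub>R axis i 1)) (at t within S)" for t S
    using line_derivative[of F y "axis i 1" t S] smooth_differentiable[OF F] exhaust_2[of i]
    by (auto simp: axis_def)
  have "continuous_on {0..r} (\<lambda>t. pd i F (y + t *\<^sub>R axis i 1))"
    by (rule continuous_on_compose2[OF smooth_continuous[OF smooth_pd[OF F], of UNIV]]) (auto intro!: continuous_intros)
  from integral_FTC_atLeastAtMost[OF r _ this, of "\<lambda>t. F (y + t *\<^sub>R axis i 1)"]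
  show ?thesis using d by (simp add: has_real_derivative_iff_has_vector_derivative)
qed

lemma vector_axis: "vector [x, y] = vector [0, y] + x *\<^sub>R (axis 1 1 :: pt)"
    "vector [x, y] = vector [x, 0] + y *\<^sub>R (axis 2 1 :: pt)"
  by (auto simp: vec_eq_iff forall_2 axis_def)

text \<open>Fubini's theorem, with the fundamental theorem of calculus along the lines parallel to an axis.\<close>

lemma simplex2_divergence:
  assumes F: "smooth F"
  shows "(LINT \<xi>:simplex2|lborel. pd 1 F \<xi>) = (LINT t:{0..1}|lborel. F (vector [1 - t, t]) - F (vector [0, t]))"
    and "(LINT \<xi>:simplex2|lborel. pd 2 F \<xi>) = (LINT t:{0..1}|lborel. F (vector [t, 1 - t]) - F (vector [t, 0]))"
proof -
  have i: "integrable lborel (\<lambda>\<xi>. indicat_real simplex2 \<xi> *\<^sub>R pd i F \<xi>)" for i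
    by (rule borel_integrable_compact[OF compact_simplex2 smooth_continuous[OF smooth_pd[OF F]]])
  have "(LINT x|lborel. indicat_real simplex2 (vector [x, y]) *\<^sub>R pd 1 F (vector [x, y]))
      = indicat_real {0..1} y *\<^sub>R (F (vector [1 - y, y]) - F (vector [0, y]))" for y
  proof (cases "y \<in> {0..1}")
    case True
    then have "(LINT x|lborel. indicat_real simplex2 (vector [x, y]) *\<^sub>R pd 1 F (vector [x, y]))
        = (LINT x|lborel. indicat_real {0..1 - y} x *\<^sub>R pd 1 F (vector [0, y] + x *\<^sub>R axis 1 1))"
      by (intro Bochner_Integration.integral_cong) (auto simp: simplex2_def indicator_def vector_axis(1)[of _ y, symmetric])
    also have "\<dots> = F (vector [1 - y, y]) - F (vector [0, y])"
      using True by (subst smooth_FTC[OF F]) (auto simp: vector_axis(1)[of _ y, symmetric])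
    finally show ?thesis using True by simp
  next
    case False
    then have z: "vector [x, y] \<notin> simplex2" for x by (auto simp: simplex2_def)
    show ?thesis using False by (simp add: z)
  qed
  then show "(LINT \<xi>:simplex2|lborel. pd 1 F \<xi>) = (LINT t:{0..1}|lborel. F (vector [1 - t, t]) - F (vector [0, t]))"
    unfolding set_lebesgue_integral_def by (simp only: integral_pt(2)[OF i])
  have "(LINT x|lborel. indicat_real simplex2 (vector [y, x]) *\<^sub>R pd 2 F (vector [y, x]))
      = indicat_real {0..1} y *\<^sub>R (F (vector [y, 1 - y]) - F (vector [y, 0]))" for y
  proof (cases "y \<in> {0..1}")
    case True
    then have "(LINT x|lborel. indicat_real simplex2 (vector [y, x]) *\<^sub>R pd 2 F (vector [y, x]))
        = (LINT x|lborel. indicat_real {0..1 - y} x *\<^sub>R pd 2 F (vector [y, 0] + x *\<^sub>R axis 2 1))"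
      by (intro Bochner_Integration.integral_cong) (auto simp: simplex2_def indicator_def vector_axis(2)[of y, symmetric])
    also have "\<dots> = F (vector [y, 1 - y]) - F (vector [y, 0])"
      using True by (subst smooth_FTC[OF F]) (auto simp: vector_axis(2)[of y, symmetric])
    finally show ?thesis using True by simp
  next
    case False
    then have z: "vector [y, x] \<notin> simplex2" for x by (auto simp: simplex2_def)
    show ?thesis using False by (simp add: z)
  qed
  then show "(LINT \<xi>:simplex2|lborel. pd 2 F \<xi>) = (LINT t:{0..1}|lborel. F (vector [t, 1 - t]) - F (vector [t, 0]))"
    unfolding set_lebesgue_integral_def by (simp only: integral_pt(1)[OF i])
qed

lemma reflect_unit_interval:
  fixes k :: "real \<Rightarrow> real"
  shows "(LINT t:{0..1}|lborel. k (1 - t)) = (LINT t:{0..1}|lborel. k t)"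
proof -
  have "(LINT t|lborel. indicat_real {0..1} t *\<^sub>R k t) = (LINT t|lborel. indicat_real {0..1} (1 - t) *\<^sub>R k (1 - t))"
    using lborel_integral_real_affine[of "-1" "\<lambda>t. indicat_real {0..1} t *\<^sub>R k t" 1] by simp
  also have "\<dots> = (LINT t|lborel. indicat_real {0..1} t *\<^sub>R k (1 - t))"
    by (intro Bochner_Integration.integral_cong) (auto simp: indicator_def)
  finally show ?thesis by (simp add: set_lebesgue_integral_def)
qed

lemma span2_smooth:
  assumes "smooth \<phi>"
  shows "smooth (\<lambda>\<xi>. \<phi> (span2 a b \<xi>))"
    and "pd 1 (\<lambda>\<xi>. \<phi> (span2 a b \<xi>)) \<xi> = a \<bullet> grad \<phi> (span2 a b \<xi>)"
    and "pd 2 (\<lambda>\<xi>. \<phi> (span2 a b \<xi>)) \<xi> = b \<bullet> grad \<phi> (span2 a b \<xi>)"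
proof -
  have D: "((\<lambda>\<xi>. f (span2 a b \<xi>)) has_derivative
      (\<lambda>h. (span2 a b h) $ 1 * pd 1 f (span2 a b \<xi>) + (span2 a b h) $ 2 * pd 2 f (span2 a b \<xi>))) (at \<xi>)"
    if "\<And>x. f differentiable (at x)" for f \<xi>
  proof -
    have "(span2 a b has_derivative span2 a b) (at \<xi>)"
      using linear_span2 by (rule linear_imp_has_derivative)
    from has_derivative_compose[OF this has_derivative_pd[OF that]] show ?thesis .
  qed
  have pd: "pd i (\<lambda>\<xi>. f (span2 a b \<xi>)) \<xi>
      = (span2 a b (axis i 1)) $ 1 * pd 1 f (span2 a b \<xi>) + (span2 a b (axis i 1)) $ 2 * pd 2 f (span2 a b \<xi>)"
    if "\<And>x. f differentiable (at x)" for f \<xi> i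
    using pd_eqI[OF D[OF that]] by simp
  have "C_class k (\<lambda>\<xi>. f (span2 a b \<xi>))" if "smooth f" for k f
    using that
  proof (induction k arbitrary: f)
    case 0
    have "continuous_on UNIV (span2 a b)"
      using linear_span2 by (simp add: linear_continuous_on linear_conv_bounded_linear)
    then show ?case
      using continuous_on_compose2[OF smooth_continuous[OF 0, of UNIV]] by simp
  next
    case (Suc k)
    have d: "f differentiable (at x)" for x using smooth_differentiable[OF Suc.prems] .
    have "C_class k (\<lambda>\<xi>. (span2 a b (axis i 1)) $ 1 * pd 1 f (span2 a b \<xi>)
        + ((span2 a b (axis i 1)) $ 2 * pd 2 f (span2 a b \<xi>) + 0))" for i
      using Suc.prems by (intro C_class_combo Suc.IH smooth_pd) auto
    then have "C_class k (pd i (\<lambda>\<xi>. f (span2 a b \<xi>)))" for i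
      unfolding pd[OF d, abs_def] by simp
    moreover have "(\<lambda>\<xi>. f (span2 a b \<xi>)) differentiable (at x)" for x
      using D[OF d] unfolding differentiable_def by blast
    ultimately show ?case by (simp add: differentiable_iff_on)
  qed
  with assms show "smooth (\<lambda>\<xi>. \<phi> (span2 a b \<xi>))" by (simp add: smooth_def)
  show "pd 1 (\<lambda>\<xi>. \<phi> (span2 a b \<xi>)) \<xi> = a \<bullet> grad \<phi> (span2 a b \<xi>)"
    "pd 2 (\<lambda>\<xi>. \<phi> (span2 a b \<xi>)) \<xi> = b \<bullet> grad \<phi> (span2 a b \<xi>)"
    unfolding pd[OF smooth_differentiable[OF assms]] by (simp_all add: span2_def axis_def inner_vec_def sum_2)
qed

text \<open>The divergence theorem on the triangle with vertices \<open>0\<close>, \<open>a\<close>, \<open>b\<close>, pulled back to the standard simplex. By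
  Cramer's rule \<open>cross2 a b *\<^sub>R q = cross2 q b *\<^sub>R a - cross2 q a *\<^sub>R b\<close>, which reduces the derivative in direction
  \<open>q\<close> to the partial derivatives on the simplex. The contributions of the two sides at the origin appear as a
  difference, and cancel when the triangles over all edges of a closed polygon are added.\<close>

lemma triangle_divergence:
  assumes \<phi>: "smooth \<phi>"
  shows "cross2 a b * (LINT \<xi>:simplex2|lborel. q \<bullet> grad \<phi> (span2 a b \<xi>))
    = cross2 q (b - a) * (LINT t:{0..1}|lborel. \<phi> (linepath a b t))
      - (cross2 q b * (LINT t:{0..1}|lborel. \<phi> (t *\<^sub>R b)) - cross2 q a * (LINT t:{0..1}|lborel. \<phi> (t *\<^sub>R a)))"
proof -
  let ?F = "\<lambda>\<xi>. \<phi> (span2 a b \<xi>)"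
  note s = span2_smooth[OF \<phi>]
  have c: "set_integrable lborel {0..1} (\<lambda>t. \<phi> (g t))" if "continuous_on {0..1} g" for g :: "real \<Rightarrow> pt"
    using that by (intro borel_integrable_atLeastAtMost' continuous_on_compose2[OF smooth_continuous[OF \<phi>, of UNIV]]) auto
  have v: "?F (vector [1 - t, t]) = \<phi> (linepath a b t)" "?F (vector [0, t]) = \<phi> (t *\<^sub>R b)"
      "?F (vector [t, 0]) = \<phi> (t *\<^sub>R a)" "?F (vector [t, 1 - t]) = \<phi> (linepath a b (1 - t))" for t
    by (simp_all add: span2_def linepath_def)
  have 1: "(LINT \<xi>:simplex2|lborel. pd 1 ?F \<xi>)
      = (LINT t:{0..1}|lborel. \<phi> (linepath a b t)) - (LINT t:{0..1}|lborel. \<phi> (t *\<^sub>R b))"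
    unfolding simplex2_divergence(1)[OF s(1)] v
    by (intro set_integral_diff c continuous_intros)
  have 2: "(LINT \<xi>:simplex2|lborel. pd 2 ?F \<xi>)
      = (LINT t:{0..1}|lborel. \<phi> (linepath a b t)) - (LINT t:{0..1}|lborel. \<phi> (t *\<^sub>R a))"
  proof -
    have "(LINT \<xi>:simplex2|lborel. pd 2 ?F \<xi>)
      = (LINT t:{0..1}|lborel. \<phi> (linepath a b (1 - t))) - (LINT t:{0..1}|lborel. \<phi> (t *\<^sub>R a))"
      unfolding simplex2_divergence(2)[OF s(1)] v
      by (intro set_integral_diff c continuous_intros) (auto simp: linepath_def intro!: continuous_intros)
    also have "(LINT t:{0..1}|lborel. \<phi> (linepath a b (1 - t))) = (LINT t:{0..1}|lborel. \<phi> (linepath a b t))"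
      by (rule reflect_unit_interval)
    finally show ?thesis .
  qed
  have i: "set_integrable lborel simplex2 (pd i ?F)" for i
    using borel_integrable_compact[OF compact_simplex2 smooth_continuous[OF smooth_pd[OF s(1)]], of i]
    by (simp add: set_integrable_def)
  have "cross2 a b * (q \<bullet> grad \<phi> z) = cross2 q b * (a \<bullet> grad \<phi> z) - cross2 q a * (b \<bullet> grad \<phi> z)" for z
    by (simp add: cross2_def inner_vec_def sum_2 algebra_simps)
  then have "cross2 a b * (LINT \<xi>:simplex2|lborel. q \<bullet> grad \<phi> (span2 a b \<xi>))
      = (LINT \<xi>:simplex2|lborel. cross2 q b * pd 1 ?F \<xi> - cross2 q a * pd 2 ?F \<xi>)"
    by (simp add: s(2,3) flip: set_integral_mult_right)
  also have "\<dots> = cross2 q b * (LINT \<xi>:simplex2|lborel. pd 1 ?F \<xi>) - cross2 q a * (LINT \<xi>:simplex2|lborel. pd 2 ?F \<xi>)"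
    using i by (subst set_integral_diff) auto
  finally show ?thesis unfolding 1 2 by (simp add: cross2_def algebra_simps)
qed

lemma negligible_segment: "negligible (closed_segment a b)" for a b :: pt
  using negligible_convex_interior[OF convex_closed_segment, of a b] interior_closed_segment_ge2[of a b] by simp

text \<open>Off its sides, an oriented triangle winds about a point as often as its signed indicator function says. The
  sides at the origin enter as a difference that cancels around a closed polygon.\<close>

lemma triangle_winding:
  assumes z: "z \<notin> closed_segment 0 a" "z \<notin> closed_segment a b" "z \<notin> closed_segment 0 b"
    and ab: "z \<in> convex hull {0, a, b} \<Longrightarrow> cross2 a b \<noteq> 0"
  shows "wnseg 0 a z + wnseg a b z - wnseg 0 b z = sgn (cross2 a b) * indicat_real (convex hull {0, a, b}) z"
proof -
  let ?A = "cpx a" and ?B = "cpx b" and ?Z = "cpx z"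
  let ?\<gamma> = "linepath 0 ?A +++ linepath ?A ?B +++ linepath ?B 0"
  have zc: "?Z \<notin> closed_segment 0 ?A" "?Z \<notin> closed_segment ?A ?B" "?Z \<notin> closed_segment 0 ?B"
    using z cpx_in_segment[of z 0] by auto
  have "winding_number ?\<gamma> ?Z = winding_number (linepath 0 ?A) ?Z
      + (winding_number (linepath ?A ?B) ?Z + winding_number (linepath ?B 0) ?Z)"
    using zc closed_segment_commute[of 0 ?B] by (simp add: winding_number_join path_image_join)
  moreover have "winding_number (linepath ?B 0) ?Z = - winding_number (linepath 0 ?B) ?Z"
    using winding_number_reversepath[of "linepath 0 ?B" ?Z] zc by (simp add: reversepath_linepath)
  ultimately have w: "Re (winding_number ?\<gamma> ?Z) = wnseg 0 a z + wnseg a b z - wnseg 0 b z"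
    by (simp add: wnseg_def)
  have hull: "?Z \<in> convex hull {0, ?A, ?B} \<longleftrightarrow> z \<in> convex hull {0, a, b}"
  proof -
    have "convex hull {0, ?A, ?B} = cpx ` (convex hull {0, a, b})"
      using convex_hull_linear_image[OF linear_cpx, of "{0, a, b}"] by simp
    then show ?thesis by (simp only: inj_image_mem_iff[OF inj_cpx])
  qed
  show ?thesis
  proof (cases "z \<in> convex hull {0, a, b}")
    case False
    have seg: "closed_segment u v \<subseteq> convex hull {0, ?A, ?B}" if "u \<in> {0, ?A, ?B}" "v \<in> {0, ?A, ?B}" for u v
      using that by (intro closed_segment_subset hull_inc convex_convex_hull)
    have "winding_number ?\<gamma> ?Z = 0"
    proof (rule winding_number_zero_outside[of _ "convex hull {0, ?A, ?B}"])
      show "path_image ?\<gamma> \<subseteq> convex hull {0, ?A, ?B}"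
        using seg[of 0 ?A] seg[of ?A ?B] seg[of ?B 0] by (simp add: path_image_join)
    qed (use False hull in auto)
    with w False show ?thesis by simp
  next
    case True
    have "?Z \<in> interior (convex hull {0, ?A, ?B})"
      using interior_of_triangle[of 0 ?A ?B] True hull zc closed_segment_commute[of 0 ?B] by simp
    from winding_number_triangle[OF this]
    have wn: "winding_number ?\<gamma> ?Z = (if 0 < Im (?A * cnj (?A - ?Z)) then 1 else -1)" by simp
    have im: "Im (?A * cnj (?A - ?Z)) = cross2 a z" by (simp add: cross2_def algebra_simps)
    obtain \<xi> where x: "\<xi> \<in> simplex2" "z = span2 a b \<xi>" using True image_simplex2 by blast
    have "\<xi> $ 2 \<noteq> 0"
    proof
      assume "\<xi> $ 2 = 0"
      with x have "z \<in> closed_segment 0 a"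
        by (auto simp: span2_def simplex2_def in_segment)
      with z show False by simp
    qed
    moreover have "cross2 a z = \<xi> $ 2 * cross2 a b" unfolding x(2) by (simp add: cross2_def span2_def algebra_simps)
    ultimately have "sgn (cross2 a z) = sgn (cross2 a b)" "0 < cross2 a z \<longleftrightarrow> 0 < cross2 a b" using x(1)
      by (auto simp: simplex2_def sgn_mult zero_less_mult_iff)
    then show ?thesis using w wn im True ab by (auto simp: sgn_if)
  qed
qed

lemma integral_over_triangle:
  fixes h :: scal
  assumes h: "continuous_on UNIV h"
  shows "(LINT z:convex hull {0, a, b}|lebesgue. h z) = \<bar>cross2 a b\<bar> * (LINT \<xi>:simplex2|lborel. h (span2 a b \<xi>))"
proof -
  have cs: "continuous_on UNIV (\<lambda>\<xi>. h (span2 a b \<xi>))"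
  proof -
    have "continuous_on UNIV (span2 a b)"
      using linear_span2 by (simp add: linear_continuous_on linear_conv_bounded_linear)
    then show ?thesis using continuous_on_compose2[OF h] by simp
  qed
  have int: "integrable lborel (\<lambda>z. indicat_real S z *\<^sub>R k z)" if "compact S" "continuous_on UNIV k" for S and k :: scal
    by (rule borel_integrable_compact[OF that(1)]) (use that(2) continuous_on_subset in blast)
  have leb: "set_integrable lebesgue S k" if "compact S" "continuous_on UNIV k" for S and k :: scal
    using int[OF that] unfolding set_integrable_def by (subst integrable_completion) auto
  have ct: "compact (convex hull {0, a, b})" by (intro compact_convex_hull) auto
  let ?h = "\<lambda>z. vec (h z) :: real^1"
  have "integral (span2 a b ` simplex2) ?h = \<bar>det (matrix (span2 a b))\<bar> *\<^sub>R integral simplex2 (?h \<circ> span2 a b)"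
  proof (rule integral_change_of_variables_linear[OF linear_span2 disjI1])
    show "?h absolutely_integrable_on span2 a b ` simplex2"
      using leb[OF ct h] by (simp add: absolutely_integrable_on_1_iff image_simplex2)
  qed
  then have "integral (convex hull {0, a, b}) h = \<bar>cross2 a b\<bar> * integral simplex2 (\<lambda>\<xi>. h (span2 a b \<xi>))"
    unfolding integral_on_1_eq image_simplex2 det_span2 by (simp add: vec_eq_iff)
  also have "integral (convex hull {0, a, b}) h = (LINT z:convex hull {0, a, b}|lebesgue. h z)"
    using set_lebesgue_integral_eq_integral(2)[OF leb[OF ct h]] by simp
  also have "integral simplex2 (\<lambda>\<xi>. h (span2 a b \<xi>)) = (LINT \<xi>:simplex2|lebesgue. h (span2 a b \<xi>))"
    using set_lebesgue_integral_eq_integral(2)[OF leb[OF compact_simplex2 cs]] by simp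
  also have "\<dots> = (LINT \<xi>:simplex2|lborel. h (span2 a b \<xi>))"
    unfolding set_lebesgue_integral_def
    using int[OF compact_simplex2 cs] by (intro integral_completion borel_measurable_integrable)
  finally show ?thesis .
qed

section \<open>The divergence theorem on a polygonal cell\<close>

lemma bdry_closed: "closed (bdry P)" and bdry_bounded: "bounded (bdry P)" and bdry_negligible: "negligible (bdry P)"
  by (auto simp: bdry_def intro!: closed_UN bounded_UN negligible_Union negligible_segment compact_imp_bounded[OF compact_segment] split: prod.splits)

lemma open_region [simp]: "open (region P)"
  by (simp add: region_def open_inside bdry_closed)

lemma bounded_region [simp]: "bounded (region P)"
  by (simp add: region_def bounded_inside bdry_bounded)

lemma region_bdry: "x \<in> region P \<Longrightarrow> x \<notin> bdry P"
  by (simp add: region_def inside_def)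

text \<open>The fan of the triangles with apex \<open>0\<close> over the edges of the polygon: their signed indicator functions add
  up to the winding number of the polygon almost everywhere.\<close>

lemma polygon_integral:
  assumes P: "polygon P"
  obtains \<sigma> :: real where "\<sigma> = 1 \<or> \<sigma> = -1"
    "\<And>h :: scal. continuous_on UNIV h \<Longrightarrow>
       \<sigma> * (LINT z:region P|lebesgue. h z) = (\<Sum>(a, b)\<in>edges P. cross2 a b * (LINT \<xi>:simplex2|lborel. h (span2 a b \<xi>)))"
proof -
  obtain \<sigma> :: real where \<sigma>: "\<sigma> = 1 \<or> \<sigma> = -1"
    and w: "\<And>z. z \<notin> bdry P \<Longrightarrow> (\<Sum>(a, b)\<in>edges P. wnseg a b z) = \<sigma> * indicat_real (region P) z"
    using polygon_winding[OF P] by blast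
  have dP: "distinct P" using P by (simp add: polygon_def)
  let ?T = "\<lambda>e. convex hull {0, fst e, snd e :: pt}"
  let ?W = "\<lambda>e z. sgn (cross2 (fst e) (snd e)) * indicat_real (?T e) z"
  have null: "AE z in lebesgue. z \<notin> S" if "negligible S" for S :: "pt set"
    using that by (intro AE_not_in) (simp add: negligible_iff_null_sets)
  have T0: "negligible (?T (a, b))" if "cross2 a b = 0" for a b
  proof -
    have "\<not> inj (span2 a b)" using that det_nz_iff_inj[OF linear_span2, of a b] by (simp add: det_span2)
    then show ?thesis
      using negligible_linear_singular_image[OF linear_span2, of a b simplex2] by (simp add: image_simplex2)
  qed
  have "AE z in lebesgue. z \<notin> closed_segment 0 a \<and> z \<notin> closed_segment a b \<and> z \<notin> closed_segment 0 b
      \<and> (z \<in> ?T (a, b) \<longrightarrow> cross2 a b \<noteq> 0)" for a b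
    using null[OF negligible_segment[of 0 a]] null[OF negligible_segment[of a b]] null[OF negligible_segment[of 0 b]]
      null[OF T0[of a b]]
    by (cases "cross2 a b = 0") (auto elim!: AE_mp)
  then have tri: "AE z in lebesgue. wnseg 0 (fst e) z + wnseg (fst e) (snd e) z - wnseg 0 (snd e) z = ?W e z" for e
    by (rule AE_mp) (auto intro!: AE_I2 triangle_winding)
  have AE: "AE z in lebesgue. (\<Sum>e\<in>edges P. ?W e z) = \<sigma> * indicat_real (region P) z"
  proof -
    have "AE z in lebesgue. \<forall>e\<in>edges P. wnseg 0 (fst e) z + wnseg (fst e) (snd e) z - wnseg 0 (snd e) z = ?W e z"
      using tri by (intro AE_finite_allI) auto
    then show ?thesis
      using null[OF bdry_negligible[of P]]
    proof eventually_elim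
      case (elim z)
      have "(\<Sum>e\<in>edges P. ?W e z) = (\<Sum>e\<in>edges P. wnseg 0 (fst e) z + wnseg (fst e) (snd e) z - wnseg 0 (snd e) z)"
        using elim(1) by simp
      also have "\<dots> = (\<Sum>(a, b)\<in>edges P. wnseg a b z) - (\<Sum>(a, b)\<in>edges P. wnseg 0 b z - wnseg 0 a z)"
        by (simp add: case_prod_unfold algebra_simps flip: sum_subtractf sum.distrib)
      also have "(\<Sum>(a, b)\<in>edges P. wnseg 0 b z - wnseg 0 a z) = 0"
        by (rule sum_edges_telescope[OF dP])
      finally show ?case using w[OF elim(2)] by simp
    qed
  qed
  have "\<sigma> * (LINT z:region P|lebesgue. h z) = (\<Sum>(a, b)\<in>edges P. cross2 a b * (LINT \<xi>:simplex2|lborel. h (span2 a b \<xi>)))"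
    if h: "continuous_on UNIV h" for h :: scal
  proof -
    have hm: "h \<in> borel_measurable lebesgue"
      using h by (simp add: borel_measurable_continuous_onI measurable_completion)
    have T_int: "set_integrable lebesgue (?T e) h" for e
    proof -
      have "compact (?T e)" by (intro compact_convex_hull) auto
      then have "integrable lborel (\<lambda>z. indicat_real (?T e) z *\<^sub>R h z)"
        by (rule borel_integrable_compact) (use h continuous_on_subset in blast)
      then show ?thesis unfolding set_integrable_def by (subst integrable_completion) auto
    qed
    have "(\<Sum>(a, b)\<in>edges P. cross2 a b * (LINT \<xi>:simplex2|lborel. h (span2 a b \<xi>)))
        = (\<Sum>e\<in>edges P. sgn (cross2 (fst e) (snd e)) * (LINT z:?T e|lebesgue. h z))"
      unfolding integral_over_triangle[OF h] case_prod_unfold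
      by (intro sum.cong refl) (simp add: mult.assoc[symmetric] mult_sgn_abs)
    also have "\<dots> = (\<Sum>e\<in>edges P. LINT z|lebesgue. ?W e z * h z)"
      by (simp add: set_lebesgue_integral_def mult.assoc)
    also have "\<dots> = (LINT z|lebesgue. (\<Sum>e\<in>edges P. ?W e z * h z))"
      using T_int by (intro Bochner_Integration.integral_sum[symmetric])
        (simp add: set_integrable_def mult.assoc)
    also have "\<dots> = (LINT z|lebesgue. \<sigma> * (indicat_real (region P) z *\<^sub>R h z))"
    proof (rule integral_cong_AE)
      show "(\<lambda>z. \<Sum>e\<in>edges P. ?W e z * h z) \<in> borel_measurable lebesgue"
      proof (intro borel_measurable_sum)
        fix e
        have "integrable lebesgue (\<lambda>z. indicat_real (?T e) z *\<^sub>R h z)"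
          using T_int[of e] by (simp add: set_integrable_def)
        then have "(\<lambda>z. sgn (cross2 (fst e) (snd e)) * (indicat_real (?T e) z *\<^sub>R h z)) \<in> borel_measurable lebesgue"
          by (intro borel_measurable_times borel_measurable_const borel_measurable_integrable)
        then show "(\<lambda>z. ?W e z * h z) \<in> borel_measurable lebesgue" by (simp add: mult.assoc)
      qed
      show "(\<lambda>z. \<sigma> * (indicat_real (region P) z *\<^sub>R h z)) \<in> borel_measurable lebesgue"
        by (intro borel_measurable_times borel_measurable_const borel_measurable_scaleR borel_measurable_indicator hm) simp
      show "AE z in lebesgue. (\<Sum>e\<in>edges P. ?W e z * h z) = \<sigma> * (indicat_real (region P) z *\<^sub>R h z)"
        using AE
      proof eventually_elim
        case (elim z)
        then show ?case by (simp flip: sum_distrib_right)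
      qed
    qed
    finally show ?thesis by (simp add: set_lebesgue_integral_def)
  qed
  with \<sigma> that show ?thesis by blast
qed

text \<open>For \<open>h = 1\<close> the sum over the edges is the signed area that the definition of a polygon requires to be
  positive; this determines the sign of the winding number and shows that the cell is not a null set.\<close>

lemma polygon_integral_pos:
  assumes P: "polygon P"
  shows "measure lebesgue (region P) > 0"
    and "continuous_on UNIV h \<Longrightarrow>
       (LINT z:region P|lebesgue. h z) = (\<Sum>(a, b)\<in>edges P. cross2 a b * (LINT \<xi>:simplex2|lborel. h (span2 a b \<xi>)))"
proof -
  obtain \<sigma> :: real where \<sigma>: "\<sigma> = 1 \<or> \<sigma> = -1"
    and eq: "\<And>h :: scal. continuous_on UNIV h \<Longrightarrow>
       \<sigma> * (LINT z:region P|lebesgue. h z) = (\<Sum>(a, b)\<in>edges P. cross2 a b * (LINT \<xi>:simplex2|lborel. h (span2 a b \<xi>)))"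
    using polygon_integral[OF P] by blast
  have half: "(LINT \<xi>:simplex2|lborel. 1 :: real) = 1 / 2"
  proof -
    have pd1: "pd 1 (\<lambda>x. x $ 1) = (\<lambda>_. 1)"
      using pd_coord(1)[of "\<lambda>t. t" 1 _ 1 1] by (auto intro!: derivative_eq_intros)
    have "(LINT \<xi>:simplex2|lborel. 1 :: real) = (LINT t:{0..1}|lborel. (1 - t) - 0)"
      using simplex2_divergence(1)[OF smooth_coord[of 1]] unfolding pd1 by simp
    also have "\<dots> = (LINT t:{0..1}|lborel. t)" using reflect_unit_interval[of "\<lambda>t. t"] by simp
    also have "\<dots> = 1\<^sup>2 / 2 - 0\<^sup>2 / 2"
      unfolding set_lebesgue_integral_def
      by (rule integral_FTC_atLeastAtMost)
        (auto intro!: derivative_eq_intros simp flip: has_real_derivative_iff_has_vector_derivative)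
    finally show ?thesis by simp
  qed
  have area: "\<sigma> * measure lebesgue (region P) > 0"
  proof -
    have "\<sigma> * (LINT z:region P|lebesgue. 1) = (\<Sum>(a, b)\<in>edges P. cross2 a b * (1 / 2))"
      using eq[of "\<lambda>_. 1"] by (simp add: half)
    also have "\<dots> = (\<Sum>(a, b)\<in>edges P. a $ 1 * b $ 2 - a $ 2 * b $ 1) / 2"
      by (simp add: sum_divide_distrib cross2_def case_prod_unfold)
    also have "\<dots> > 0" using P by (simp add: polygon_def)
    finally show ?thesis by (simp add: set_lebesgue_integral_def)
  qed
  have "measure lebesgue (region P) \<ge> 0" by simp
  with area \<sigma> show "measure lebesgue (region P) > 0" by (auto simp: zero_less_mult_iff)
  with area have "\<sigma> > 0" by (simp add: zero_less_mult_iff)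
  with \<sigma> have "\<sigma> = 1" by auto
  with eq show "continuous_on UNIV h \<Longrightarrow>
       (LINT z:region P|lebesgue. h z) = (\<Sum>(a, b)\<in>edges P. cross2 a b * (LINT \<xi>:simplex2|lborel. h (span2 a b \<xi>)))"
    by auto
qed

text \<open>The divergence theorem, summed over the fan of triangles; the sides at the apex telescope.\<close>

theorem polygon_divergence:
  assumes P: "polygon P" and \<phi>: "smooth \<phi>"
  shows "l2 (region P) (\<lambda>_. q) (grad \<phi>) = (\<Sum>e\<in>edges P. edge_int e (\<lambda>x. (q \<bullet> normal e) * \<phi> x))"
proof -
  have dP: "distinct P" using P by (simp add: polygon_def)
  have c: "continuous_on UNIV (\<lambda>z. q \<bullet> grad \<phi> z)"
    unfolding inner_vec_def sum_2 using smooth_continuous[OF smooth_pd[OF \<phi>]]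
    by (auto intro!: continuous_intros)
  let ?J = "\<lambda>a. cross2 q a * (LINT t:{0..1}|lborel. \<phi> (t *\<^sub>R a))"
  have "l2 (region P) (\<lambda>_. q) (grad \<phi>)
      = (\<Sum>(a, b)\<in>edges P. cross2 a b * (LINT \<xi>:simplex2|lborel. q \<bullet> grad \<phi> (span2 a b \<xi>)))"
    unfolding l2_def by (rule polygon_integral_pos(2)[OF P c])
  also have "\<dots> = (\<Sum>(a, b)\<in>edges P. cross2 q (b - a) * (LINT t:{0..1}|lborel. \<phi> (linepath a b t)))
      - (\<Sum>(a, b)\<in>edges P. ?J b - ?J a)"
    unfolding triangle_divergence[OF \<phi>] by (simp add: case_prod_unfold sum_subtractf)
  also have "(\<Sum>(a, b)\<in>edges P. ?J b - ?J a) = 0" by (rule sum_edges_telescope[OF dP])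
  also have "(\<Sum>(a, b)\<in>edges P. cross2 q (b - a) * (LINT t:{0..1}|lborel. \<phi> (linepath a b t)))
      = (\<Sum>e\<in>edges P. edge_int e (\<lambda>x. (q \<bullet> normal e) * \<phi> x))"
  proof (rule sum.cong[OF refl], clarify)
    fix a b assume "(a, b) \<in> edges P"
    then have "a \<noteq> b" using edges_distinct[OF P] by blast
    moreover have "q \<bullet> vector [b $ 2 - a $ 2, a $ 1 - b $ 1] = cross2 q (b - a)"
      by (simp add: cross2_def inner_vec_def sum_2 algebra_simps)
    ultimately have "dist a b * (q \<bullet> normal (a, b)) = cross2 q (b - a)"
      by (simp add: normal_def)
    then show "cross2 q (b - a) * (LINT t:{0..1}|lborel. \<phi> (linepath a b t)) = edge_int (a, b) (\<lambda>x. (q \<bullet> normal (a, b)) * \<phi> x)"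
      by (simp add: edge_int_def mult.assoc[symmetric])
  qed
  finally show ?thesis by simp
qed

lemma edge_subset_bdry: "(a, b) \<in> edges P \<Longrightarrow> t \<in> {0..1} \<Longrightarrow> linepath a b t \<in> bdry P"
  unfolding bdry_def using linepath_in_path[of t a b] by force

lemma edge_int_cong:
  assumes "e \<in> edges P" "\<And>x. x \<in> bdry P \<Longrightarrow> f x = g x"
  shows "edge_int e f = edge_int e g"
proof -
  obtain a b where e: "e = (a, b)" by (cases e)
  have "(LINT t:{0..1}|lborel. f (linepath a b t)) = (LINT t:{0..1}|lborel. g (linepath a b t))"
    using assms edge_subset_bdry[of a b P] unfolding e by (intro set_lebesgue_integral_cong) auto
  then show ?thesis by (simp add: e edge_int_def)
qed

lemma edge_int_zero [simp]: "edge_int e (\<lambda>_. 0) = 0"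
  by (cases e) (simp add: edge_int_def)

text \<open>Test functions vanish on the boundary, and with them the boundary integrals in the divergence theorem. For
  the rotation, the constant field is turned by a right angle.\<close>

lemma constants_weakly_free:
  assumes P: "polygon P"
  shows "weak_div (region P) (\<lambda>_. q) (\<lambda>_. 0)" and "weak_rot (region P) (\<lambda>_. q) (\<lambda>_. 0)"
proof -
  have z: "l2 (region P) (\<lambda>_. q) (grad \<phi>) = 0" if t: "test_fun (region P) \<phi>" for q \<phi>
  proof -
    have "edge_int e (\<lambda>x. (q \<bullet> normal e) * \<phi> x) = 0" if "e \<in> edges P" for e
      using edge_int_cong[OF that, of "\<lambda>x. (q \<bullet> normal e) * \<phi> x" "\<lambda>_. 0"] test_fun_outside[OF t] region_bdry[of _ P] by auto
    then show ?thesis using polygon_divergence[OF P test_fun_smooth[OF t], of q] by simp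
  qed
  then show "weak_div (region P) (\<lambda>_. q) (\<lambda>_. 0)" by (simp add: weak_div_def)
  show "weak_rot (region P) (\<lambda>_. q) (\<lambda>_. 0)"
    unfolding weak_rot_def
  proof (intro allI impI)
    fix \<phi> assume t: "test_fun (region P) \<phi>"
    have "q \<bullet> crotv \<phi> x = vector [- (q $ 2), q $ 1] \<bullet> grad \<phi> x" for x
      by (simp add: inner_vec_def sum_2)
    then show "l2 (region P) (\<lambda>_. q) (crotv \<phi>) = l2 (region P) (\<lambda>_. 0) \<phi>"
      using z[OF t, of "vector [- (q $ 2), q $ 1]"] by (simp add: l2_def)
  qed
qed

lemma edge_integrable_const [simp]: "edge_integrable e (\<lambda>_. c)"
  by (cases e) (simp add: edge_integrable_def set_integrable_def)

text \<open>The discrete inner product applies the stabilising form to fields minus their means, but the form is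
  controlled on the local edge space only. Constants in this space are what makes it usable.\<close>

theorem constants_in_EhP:
  assumes P: "polygon P"
  shows "(\<lambda>_. q) \<in> EhP P"
proof -
  have L: "L2 (region P) (\<lambda>_. q)" "L2 (region P) (\<lambda>_. 0 :: real)" by (simp_all add: L2_const)
  note w = constants_weakly_free[OF P, of q]
  have H: "(\<lambda>_. q) \<in> Hdiv (region P)" "(\<lambda>_. q) \<in> Hrot (region P)"
    using L w unfolding Hdiv_def Hrot_def by blast+
  have "ae_eq (region P) (wdiv (region P) (\<lambda>_. q)) (\<lambda>_. 0)"
    by (rule wdiv_unique[OF open_region bounded_region L(2) w(1)])
  then have "l2 (region P) (wdiv (region P) (\<lambda>_. q)) \<phi> = 0" for \<phi>
    using ae_eq_l2[OF _ ae_eq_refl, of "region P" _ "\<lambda>_. 0" \<phi>] by simp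
  then have "is_normal_trace P (\<lambda>_. q) (\<lambda>e _. q \<bullet> normal e)"
    using H(1) polygon_divergence[OF P, of _ q] by (simp add: is_normal_trace_def)
  then have "\<exists>c :: edge \<Rightarrow> real. is_normal_trace P (\<lambda>_. q) (\<lambda>e _. c e)"
    by (rule exI[where x = "\<lambda>e. q \<bullet> normal e"])
  moreover have "\<exists>c. weak_div (region P) (\<lambda>_. q) (\<lambda>_. c)" using w(1) by (rule exI)
  ultimately show ?thesis using H w(2) by (simp add: EhP_def)
qed

section \<open>Linearity of traces\<close>

lemma edge_int_combo:
  assumes "edge_integrable e f" "edge_integrable e g"
  shows "edge_int e (\<lambda>x. c * f x + g x) = c * edge_int e f + edge_int e g"
proof -
  obtain a b where e: "e = (a, b)" by (cases e)
  have i: "set_integrable lborel {0..1} (\<lambda>t. f (linepath a b t))" "set_integrable lborel {0..1} (\<lambda>t. g (linepath a b t))"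
    using assms by (simp_all add: e edge_integrable_def)
  have "(LINT t:{0..1}|lborel. c * f (linepath a b t) + g (linepath a b t))
      = c * (LINT t:{0..1}|lborel. f (linepath a b t)) + (LINT t:{0..1}|lborel. g (linepath a b t))"
    using i by (subst set_integral_add) auto
  then show ?thesis by (simp add: e edge_int_def algebra_simps)
qed

lemma edge_integrable_combo:
  "edge_integrable e f \<Longrightarrow> edge_integrable e g \<Longrightarrow> edge_integrable e (\<lambda>x. c * f x + g x)"
  by (cases e) (auto simp: edge_integrable_def intro!: set_integral_add)

lemma edge_integrable_continuous:
  assumes "e \<in> edges P" "continuous_on (bdry P) f"
  shows "edge_integrable e f"
proof -
  obtain a b where e: "e = (a, b)" by (cases e)
  have "continuous_on {0..1} (\<lambda>t. f (linepath a b t))"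
    using edge_subset_bdry[of a b P] assms unfolding e
    by (intro continuous_on_compose2[OF assms(2)] continuous_on_linepath) auto
  then show ?thesis by (simp add: e edge_integrable_def borel_integrable_atLeastAtMost')
qed

lemma edge_integrable_mult_continuous:
  assumes "edge_integrable e f" "continuous_on UNIV k"
  shows "edge_integrable e (\<lambda>x. f x * k x)"
proof -
  obtain a b where e: "e = (a, b)" by (cases e)
  have i: "integrable lborel (\<lambda>t. indicat_real {0..1} t *\<^sub>R f (linepath a b t))"
    using assms(1) by (simp add: e edge_integrable_def set_integrable_def)
  have c: "continuous_on UNIV (\<lambda>t. k (linepath a b t))"
    by (intro continuous_on_compose2[OF assms(2)] continuous_on_linepath) auto
  then have m: "(\<lambda>t. k (linepath a b t)) \<in> borel_measurable lborel"
    by (simp add: borel_measurable_continuous_onI)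
  have "compact ((\<lambda>t. k (linepath a b t)) ` {0..1})"
    by (intro compact_continuous_image continuous_on_subset[OF c]) auto
  then obtain C where C: "\<And>t. t \<in> {0..1} \<Longrightarrow> \<bar>k (linepath a b t)\<bar> \<le> C"
    using compact_imp_bounded bounded_iff by (metis (no_types, lifting) imageI real_norm_def)
  have "integrable lborel (\<lambda>t. (indicat_real {0..1} t *\<^sub>R f (linepath a b t)) * k (linepath a b t))"
  proof (rule Bochner_Integration.integrable_bound[OF integrable_mult_right[OF i, of C]])
    show "(\<lambda>t. (indicat_real {0..1} t *\<^sub>R f (linepath a b t)) * k (linepath a b t)) \<in> borel_measurable lborel"
      by (rule borel_measurable_times[OF borel_measurable_integrable[OF i] m])
    show "AE t in lborel. norm ((indicat_real {0..1} t *\<^sub>R f (linepath a b t)) * k (linepath a b t))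
        \<le> norm (C * (indicat_real {0..1} t *\<^sub>R f (linepath a b t)))"
    proof (intro AE_I2)
      fix t
      show "norm ((indicat_real {0..1} t *\<^sub>R f (linepath a b t)) * k (linepath a b t))
        \<le> norm (C * (indicat_real {0..1} t *\<^sub>R f (linepath a b t)))"
      proof (cases "t \<in> {0..1}")
        case True
        then have "\<bar>k (linepath a b t)\<bar> \<le> \<bar>C\<bar>" using C[OF True] by linarith
        then show ?thesis using True
          using mult_right_mono[of "\<bar>k (linepath a b t)\<bar>" "\<bar>C\<bar>" "\<bar>f (linepath a b t)\<bar>"]
          by (simp add: abs_mult mult.commute)
      qed simp
    qed
  qed
  then show ?thesis by (simp add: e edge_integrable_def set_integrable_def mult.assoc)
qed

lemma is_trace_combo:
  assumes "is_trace P D g" "is_trace P E h"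
  shows "is_trace P (\<lambda>x. a * D x + E x) (\<lambda>x. a * g x + h x)"
  unfolding is_trace_def
proof (intro conjI allI impI)
  have H: "D \<in> H1 (region P)" "E \<in> H1 (region P)" and c: "continuous_on (bdry P) g" "continuous_on (bdry P) h"
    using assms by (auto simp: is_trace_def)
  note H1 = H1_combo[OF open_region bounded_region H, of a]
  show "(\<lambda>x. a * D x + E x) \<in> H1 (region P)" by (rule H1)
  show "continuous_on (bdry P) (\<lambda>x. a * g x + h x)" using c by (intro continuous_intros)
  fix \<psi> assume \<psi>: "smooth_vec \<psi>"
  have L: "L2 (region P) D" "L2 (region P) E" "L2 (region P) (wgrad (region P) D)" "L2 (region P) (wgrad (region P) E)"
      "L2 (region P) (cdiv \<psi>)" "L2 (region P) \<psi>"
    using H wgrad_spec[OF H(1)] wgrad_spec[OF H(2)] L2_smooth[OF smooth_cdiv[OF \<psi>]] L2_smooth_vec[OF \<psi>]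
    by (auto simp: H1_def)
  have "continuous_on UNIV \<psi>"
    using continuous_on_vec_lambda[of UNIV "\<lambda>i x. \<psi> x $ i"] smooth_continuous[OF smooth_vec_smooth[OF \<psi>]] by simp
  then have cn: "continuous_on (bdry P) (\<lambda>x. \<psi> x \<bullet> n)" for n
    by (intro continuous_intros) (auto intro: continuous_on_subset)
  have A1: "l2 (region P) (\<lambda>x. a * D x + E x) (cdiv \<psi>) = a * l2 (region P) D (cdiv \<psi>) + l2 (region P) E (cdiv \<psi>)"
    using l2_combo_left[OF L(1,2,5), of a] by simp
  have A2: "l2 (region P) (wgrad (region P) (\<lambda>x. a * D x + E x)) \<psi>
      = a * l2 (region P) (wgrad (region P) D) \<psi> + l2 (region P) (wgrad (region P) E) \<psi>"
    using l2_combo_left[OF L(3,4,6), of a] ae_eq_l2[OF H1(2) ae_eq_refl, of \<psi>] by simp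
  have A3: "(\<Sum>e\<in>edges P. edge_int e (\<lambda>x. (a * g x + h x) * (\<psi> x \<bullet> normal e)))
      = a * (\<Sum>e\<in>edges P. edge_int e (\<lambda>x. g x * (\<psi> x \<bullet> normal e))) + (\<Sum>e\<in>edges P. edge_int e (\<lambda>x. h x * (\<psi> x \<bullet> normal e)))"
    unfolding sum_distrib_left sum.distrib[symmetric]
  proof (rule sum.cong[OF refl])
    fix e assume e: "e \<in> edges P"
    have "edge_int e (\<lambda>x. a * (g x * (\<psi> x \<bullet> normal e)) + h x * (\<psi> x \<bullet> normal e))
        = a * edge_int e (\<lambda>x. g x * (\<psi> x \<bullet> normal e)) + edge_int e (\<lambda>x. h x * (\<psi> x \<bullet> normal e))"
      by (intro edge_int_combo edge_integrable_continuous[OF e] continuous_on_mult c cn)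
    then show "edge_int e (\<lambda>x. (a * g x + h x) * (\<psi> x \<bullet> normal e))
        = a * edge_int e (\<lambda>x. g x * (\<psi> x \<bullet> normal e)) + edge_int e (\<lambda>x. h x * (\<psi> x \<bullet> normal e))"
      by (simp add: algebra_simps)
  qed
  have "l2 (region P) D (cdiv \<psi>) + l2 (region P) (wgrad (region P) D) \<psi> = (\<Sum>e\<in>edges P. edge_int e (\<lambda>x. g x * (\<psi> x \<bullet> normal e)))"
    "l2 (region P) E (cdiv \<psi>) + l2 (region P) (wgrad (region P) E) \<psi> = (\<Sum>e\<in>edges P. edge_int e (\<lambda>x. h x * (\<psi> x \<bullet> normal e)))"
    using assms \<psi> by (simp_all add: is_trace_def)
  note T = this[symmetric]
  show "l2 (region P) (\<lambda>x. a * D x + E x) (cdiv \<psi>) + l2 (region P) (wgrad (region P) (\<lambda>x. a * D x + E x)) \<psi>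
      = (\<Sum>e\<in>edges P. edge_int e (\<lambda>x. (a * g x + h x) * (\<psi> x \<bullet> normal e)))"
    unfolding A1 A2 A3 T by (simp add: algebra_simps)
qed

lemma is_trace_vec_combo:
  assumes "is_trace_vec P v g" "is_trace_vec P w h"
  shows "is_trace_vec P (\<lambda>x. a *\<^sub>R v x + w x) (\<lambda>x. a *\<^sub>R g x + h x)"
  using assms is_trace_combo[of P "\<lambda>x. v x $ i" "\<lambda>x. g x $ i" "\<lambda>x. w x $ i" "\<lambda>x. h x $ i" a for i]
  by (simp add: is_trace_vec_def)

lemma is_normal_trace_combo:
  assumes "is_normal_trace P C g" "is_normal_trace P C' h"
  shows "is_normal_trace P (\<lambda>x. a *\<^sub>R C x + C' x) (\<lambda>e x. a * g e x + h e x)"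
  unfolding is_normal_trace_def
proof (intro conjI allI impI ballI)
  have H: "C \<in> Hdiv (region P)" "C' \<in> Hdiv (region P)"
    and i: "\<And>e. e \<in> edges P \<Longrightarrow> edge_integrable e (g e)" "\<And>e. e \<in> edges P \<Longrightarrow> edge_integrable e (h e)"
    using assms by (auto simp: is_normal_trace_def)
  note H1 = Hdiv_combo[OF open_region bounded_region H, of a]
  show "(\<lambda>x. a *\<^sub>R C x + C' x) \<in> Hdiv (region P)" by (rule H1)
  show "edge_integrable e (\<lambda>x. a * g e x + h e x)" if "e \<in> edges P" for e
    using i that by (intro edge_integrable_combo)
  fix \<phi> assume \<phi>: "smooth \<phi>"
  have L: "L2 (region P) C" "L2 (region P) C'" "L2 (region P) (wdiv (region P) C)" "L2 (region P) (wdiv (region P) C')"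
      "L2 (region P) (grad \<phi>)" "L2 (region P) \<phi>"
    using H wdiv_spec[OF H(1)] wdiv_spec[OF H(2)] L2_smooth[OF \<phi>] L2_smooth_vec[OF smooth_vec_grad[OF \<phi>]]
    by (auto simp: Hdiv_def)
  have A1: "l2 (region P) (\<lambda>x. a *\<^sub>R C x + C' x) (grad \<phi>) = a * l2 (region P) C (grad \<phi>) + l2 (region P) C' (grad \<phi>)"
    by (rule l2_combo_left[OF L(1,2,5)])
  have A2: "l2 (region P) (wdiv (region P) (\<lambda>x. a *\<^sub>R C x + C' x)) \<phi>
      = a * l2 (region P) (wdiv (region P) C) \<phi> + l2 (region P) (wdiv (region P) C') \<phi>"
    using l2_combo_left[OF L(3,4,6), of a] ae_eq_l2[OF H1(2) ae_eq_refl, of \<phi>] by simp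
  have A3: "(\<Sum>e\<in>edges P. edge_int e (\<lambda>x. (a * g e x + h e x) * \<phi> x))
      = a * (\<Sum>e\<in>edges P. edge_int e (\<lambda>x. g e x * \<phi> x)) + (\<Sum>e\<in>edges P. edge_int e (\<lambda>x. h e x * \<phi> x))"
    unfolding sum_distrib_left sum.distrib[symmetric]
  proof (rule sum.cong[OF refl])
    fix e assume e: "e \<in> edges P"
    have "edge_int e (\<lambda>x. a * (g e x * \<phi> x) + h e x * \<phi> x)
        = a * edge_int e (\<lambda>x. g e x * \<phi> x) + edge_int e (\<lambda>x. h e x * \<phi> x)"
      using i[OF e] smooth_continuous[OF \<phi>] by (intro edge_int_combo edge_integrable_mult_continuous)
    then show "edge_int e (\<lambda>x. (a * g e x + h e x) * \<phi> x)
        = a * edge_int e (\<lambda>x. g e x * \<phi> x) + edge_int e (\<lambda>x. h e x * \<phi> x)"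
      by (simp add: algebra_simps)
  qed
  have "l2 (region P) C (grad \<phi>) + l2 (region P) (wdiv (region P) C) \<phi> = (\<Sum>e\<in>edges P. edge_int e (\<lambda>x. g e x * \<phi> x))"
    "l2 (region P) C' (grad \<phi>) + l2 (region P) (wdiv (region P) C') \<phi> = (\<Sum>e\<in>edges P. edge_int e (\<lambda>x. h e x * \<phi> x))"
    using assms \<phi> by (simp_all add: is_normal_trace_def)
  note T = this[symmetric]
  show "l2 (region P) (\<lambda>x. a *\<^sub>R C x + C' x) (grad \<phi>) + l2 (region P) (wdiv (region P) (\<lambda>x. a *\<^sub>R C x + C' x)) \<phi>
      = (\<Sum>e\<in>edges P. edge_int e (\<lambda>x. (a * g e x + h e x) * \<phi> x))"
    unfolding A1 A2 A3 T by (simp add: algebra_simps)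
qed

lemma edge_poly_combo:
  assumes "edge_poly k e f" "edge_poly k e g"
  shows "edge_poly k e (\<lambda>x. a * f x + g x)"
proof -
  obtain p q where e: "e = (p, q)" by (cases e)
  obtain c d where "\<forall>t\<in>{0..1}. f (linepath p q t) = (\<Sum>i\<le>k. c i * t ^ i)" "\<forall>t\<in>{0..1}. g (linepath p q t) = (\<Sum>i\<le>k. d i * t ^ i)"
    using assms by (auto simp: e edge_poly_def)
  then have "\<forall>t\<in>{0..1}. a * f (linepath p q t) + g (linepath p q t) = (\<Sum>i\<le>k. (a * c i + d i) * t ^ i)"
    by (simp add: sum_distrib_left sum.distrib algebra_simps)
  then show ?thesis by (auto simp: e edge_poly_def)
qed

section \<open>Linearity of the local spaces\<close>

lemma VhP_combo:
  assumes "D \<in> VhP P" "E \<in> VhP P"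
  shows "(\<lambda>x. a * D x + E x) \<in> VhP P"
proof -
  have H: "D \<in> Hrotv (region P)" "E \<in> Hrotv (region P)" using assms by (auto simp: VhP_def)
  note H1 = Hrotv_combo[OF open_region bounded_region H, of a]
  obtain g h where gh: "is_trace P D g" "\<forall>e\<in>edges P. edge_poly 1 e g" "is_trace P E h" "\<forall>e\<in>edges P. edge_poly 1 e h"
    using assms by (auto simp: VhP_def)
  have "\<exists>g. is_trace P (\<lambda>x. a * D x + E x) g \<and> (\<forall>e\<in>edges P. edge_poly 1 e g)"
    using gh is_trace_combo[OF gh(1,3), of a] edge_poly_combo[of 1 _ g h a] by (intro exI[of _ "\<lambda>x. a * g x + h x"]) auto
  moreover have "weak_rot (region P) (\<lambda>x. a *\<^sub>R wrotv (region P) D x + wrotv (region P) E x) (\<lambda>x. a * 0 + 0)"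
    using assms wrotv_spec[OF H(1)] wrotv_spec[OF H(2)]
    by (intro weak_rot_combo[OF open_region bounded_region]) (auto simp: VhP_def)
  then have "weak_rot (region P) (wrotv (region P) (\<lambda>x. a * D x + E x)) (\<lambda>_. 0)"
    using weak_rot_cong[OF H1(2) ae_eq_refl, of "\<lambda>_. 0"] by simp
  ultimately show ?thesis using H1(1) by (simp add: VhP_def)
qed

lemma EhP_combo:
  assumes "C \<in> EhP P" "C' \<in> EhP P"
  shows "(\<lambda>x. a *\<^sub>R C x + C' x) \<in> EhP P"
proof -
  have H: "C \<in> Hdiv (region P)" "C' \<in> Hdiv (region P)" "C \<in> Hrot (region P)" "C' \<in> Hrot (region P)"
    using assms by (auto simp: EhP_def)
  have L: "L2 (region P) C" "L2 (region P) C'" using H by (auto simp: Hdiv_def)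
  obtain c d g h where w: "weak_div (region P) C (\<lambda>_. c)" "weak_div (region P) C' (\<lambda>_. d)"
      "weak_rot (region P) C (\<lambda>_. 0)" "weak_rot (region P) C' (\<lambda>_. 0)"
    and n: "is_normal_trace P C (\<lambda>e _. g e)" "is_normal_trace P C' (\<lambda>e _. h e)"
    using assms by (auto simp: EhP_def)
  have "weak_div (region P) (\<lambda>x. a *\<^sub>R C x + C' x) (\<lambda>x. a * c + d)"
    using w L by (intro weak_div_combo[OF open_region bounded_region]) (auto simp: L2_const)
  moreover have "weak_rot (region P) (\<lambda>x. a *\<^sub>R C x + C' x) (\<lambda>x. a * 0 + 0)"
    using w L by (intro weak_rot_combo[OF open_region bounded_region]) (auto simp: L2_const)
  moreover have "is_normal_trace P (\<lambda>x. a *\<^sub>R C x + C' x) (\<lambda>e _. a * g e + h e)"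
    using is_normal_trace_combo[OF n] .
  then have "\<exists>c :: edge \<Rightarrow> real. is_normal_trace P (\<lambda>x. a *\<^sub>R C x + C' x) (\<lambda>e _. c e)"
    by (rule exI[where x = "\<lambda>e. a * g e + h e"])
  ultimately show ?thesis
    using Hdiv_combo(1)[OF open_region bounded_region H(1,2)] Hrot_combo[OF open_region bounded_region H(3,4)]
    by (auto simp: EhP_def)
qed

lemma H1_vec_combo:
  assumes U: "open U" "bounded U" and "v \<in> H1_vec U" "w \<in> H1_vec U"
  shows "(\<lambda>x. a *\<^sub>R v x + w x) \<in> H1_vec U"
    and "ae_eq U (wjac U (\<lambda>x. a *\<^sub>R v x + w x)) (\<lambda>x. a *\<^sub>R wjac U v x + wjac U w x)"
proof -
  have H: "(\<lambda>x. v x $ i) \<in> H1 U" "(\<lambda>x. w x $ i) \<in> H1 U" for i using assms by (auto simp: H1_vec_def)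
  note H1 = H1_combo[OF U H, of a]
  show "(\<lambda>x. a *\<^sub>R v x + w x) \<in> H1_vec U" using H1(1) by (simp add: H1_vec_def)
  show "ae_eq U (wjac U (\<lambda>x. a *\<^sub>R v x + w x)) (\<lambda>x. a *\<^sub>R wjac U v x + wjac U w x)"
    using H1(2)[of 1 1] H1(2)[of 2 2] unfolding ae_eq_def
    by eventually_elim (auto simp: vec_eq_iff forall_2 wjac_def)
qed

lemma L2_wjac: "v \<in> H1_vec U \<Longrightarrow> L2 U (wjac U v)"
  by (rule L2_vec) (use wgrad_spec in \<open>simp add: wjac_def H1_vec_def\<close>)

lemma L2_jac: "smooth_vec v \<Longrightarrow> open U \<Longrightarrow> bounded U \<Longrightarrow> L2 U (jac v)"
  by (rule L2_vec) (simp add: jac_def L2_smooth_vec smooth_vec_grad smooth_vec_smooth)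

lemma L2_H1_vec: "v \<in> H1_vec U \<Longrightarrow> L2 U v"
  by (rule L2_vec) (auto simp: H1_vec_def H1_def)

lemma poly2_combo:
  assumes "f \<in> poly2 k" "g \<in> poly2 k"
  shows "(\<lambda>x. a * f x + g x) \<in> poly2 k"
proof -
  obtain p q where p: "f = (\<lambda>x. \<Sum>i\<le>k. \<Sum>j\<le>k - i. p i j * (x $ 1) ^ i * (x $ 2) ^ j)"
      and q: "g = (\<lambda>x. \<Sum>i\<le>k. \<Sum>j\<le>k - i. q i j * (x $ 1) ^ i * (x $ 2) ^ j)"
    using assms by (auto simp: poly2_def)
  have "(\<lambda>x. a * f x + g x) = (\<lambda>x. \<Sum>i\<le>k. \<Sum>j\<le>k - i. (a * p i j + q i j) * (x $ 1) ^ i * (x $ 2) ^ j)"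
    unfolding p q by (simp add: sum_distrib_left sum.distrib algebra_simps)
  then show ?thesis unfolding poly2_def by (intro CollectI exI[of _ "\<lambda>i j. a * p i j + q i j"])
qed

lemma poly2_vec_smooth: "q \<in> poly2_vec k \<Longrightarrow> smooth_vec q"
  by (auto simp: poly2_vec_def smooth_vec_def intro: poly2_smooth)

lemma smooth_vec_differentiable: "smooth_vec q \<Longrightarrow> (\<lambda>x. q x $ i) differentiable (at x)"
  by (auto simp: smooth_vec_def intro: smooth_differentiable)

lemma pd_combo_vec:
  assumes "smooth_vec q" "smooth_vec r"
  shows "pd j (\<lambda>y. (a *\<^sub>R q y + r y) $ i) x = a * pd j (\<lambda>y. q y $ i) x + pd j (\<lambda>y. r y $ i) x"
  using pd_combo[OF smooth_vec_differentiable[OF assms(1)] smooth_vec_differentiable[OF assms(2)]] by simp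

lemma jac_combo:
  "smooth_vec q \<Longrightarrow> smooth_vec r \<Longrightarrow> jac (\<lambda>x. a *\<^sub>R q x + r x) = (\<lambda>x. a *\<^sub>R jac q x + jac r x)"
  using pd_combo_vec[of q r _ a] by (auto simp: fun_eq_iff jac_def vec_eq_iff)

lemma PP_combo:
  assumes "q \<in> PP" "r \<in> PP"
  shows "(\<lambda>x. a *\<^sub>R q x + r x) \<in> PP"
proof -
  have s: "smooth_vec q" "smooth_vec r" using assms poly2_vec_smooth by (auto simp: PP_def)
  have "cdiv (\<lambda>x. a *\<^sub>R q x + r x) = (\<lambda>x. a * cdiv q x + cdiv r x)"
    unfolding cdiv_def[abs_def] pd_combo_vec[OF s] by (simp add: fun_eq_iff algebra_simps)
  then show ?thesis using assms poly2_combo[of "cdiv q" 0 "cdiv r" a] poly2_combo[of "\<lambda>x. q x $ i" 2 "\<lambda>x. r x $ i" a for i]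
    by (simp add: PP_def poly2_vec_def)
qed

lemma is_PiNabla_combo:
  assumes v: "v \<in> H1_vec (region P)" "w \<in> H1_vec (region P)" and "is_PiNabla P v q" "is_PiNabla P w r"
  shows "is_PiNabla P (\<lambda>x. a *\<^sub>R v x + w x) (\<lambda>x. a *\<^sub>R q x + r x)"
  unfolding is_PiNabla_def
proof (intro conjI ballI)
  have qr: "q \<in> PP" "r \<in> PP" using assms by (auto simp: is_PiNabla_def)
  then show "(\<lambda>x. a *\<^sub>R q x + r x) \<in> PP" by (rule PP_combo)
  have s: "smooth_vec p" if "p \<in> PP" for p using that poly2_vec_smooth by (auto simp: PP_def)
  fix p assume p: "p \<in> PP"
  have L: "L2 (region P) (jac q)" "L2 (region P) (jac r)" "L2 (region P) (jac p)"
    using s qr p by (simp_all add: L2_jac)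
  have "l2 (region P) (jac (\<lambda>x. a *\<^sub>R q x + r x)) (jac p) = a * l2 (region P) (jac q) (jac p) + l2 (region P) (jac r) (jac p)"
    unfolding jac_combo[OF s[OF qr(1)] s[OF qr(2)]] by (rule l2_combo_left[OF L])
  also have "\<dots> = a * l2 (region P) (wjac (region P) v) (jac p) + l2 (region P) (wjac (region P) w) (jac p)"
    using assms p by (simp add: is_PiNabla_def)
  also have "\<dots> = l2 (region P) (\<lambda>x. a *\<^sub>R wjac (region P) v x + wjac (region P) w x) (jac p)"
    using l2_combo_left[OF L2_wjac[OF v(1)] L2_wjac[OF v(2)] L(3)] by simp
  also have "\<dots> = l2 (region P) (wjac (region P) (\<lambda>x. a *\<^sub>R v x + w x)) (jac p)"
    by (rule ae_eq_l2[OF ae_eq_sym[OF H1_vec_combo(2)[OF open_region bounded_region v]] ae_eq_refl])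
  finally show "l2 (region P) (jac (\<lambda>x. a *\<^sub>R q x + r x)) (jac p) = l2 (region P) (wjac (region P) (\<lambda>x. a *\<^sub>R v x + w x)) (jac p)" .
next
  obtain g h where g: "is_trace_vec P v g" "(\<Sum>x\<in>nodes P. q x) = (\<Sum>x\<in>nodes P. g x)"
     "is_trace_vec P w h" "(\<Sum>x\<in>nodes P. r x) = (\<Sum>x\<in>nodes P. h x)"
    using assms by (auto simp: is_PiNabla_def)
  then show "\<exists>g. is_trace_vec P (\<lambda>x. a *\<^sub>R v x + w x) g \<and> (\<Sum>x\<in>nodes P. a *\<^sub>R q x + r x) = (\<Sum>x\<in>nodes P. g x)"
    using is_trace_vec_combo[OF g(1,3), of a]
    by (intro exI[of _ "\<lambda>x. a *\<^sub>R g x + h x"]) (simp add: sum.distrib flip: scaleR_sum_right)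
qed

lemma Gperp_smooth: "g \<in> Gperp P \<Longrightarrow> smooth_vec g"
  by (auto simp: Gperp_def intro: poly2_vec_smooth)

lemma Gperp_combo:
  assumes "g \<in> Gperp P" "h \<in> Gperp P"
  shows "(\<lambda>x. a *\<^sub>R g x + h x) \<in> Gperp P"
proof -
  have "l2 (region P) (\<lambda>x. a *\<^sub>R g x + h x) (grad p) = 0" if "p \<in> poly2 3" for p
    using l2_combo_left[of "region P" g h "grad p" a] assms that
      L2_smooth_vec[OF Gperp_smooth[OF assms(1)], of "region P"] L2_smooth_vec[OF Gperp_smooth[OF assms(2)], of "region P"]
      L2_smooth_vec[OF smooth_vec_grad[OF poly2_smooth[OF that]], of "region P"]
    by (simp add: Gperp_def)
  then show ?thesis using assms poly2_combo[of "\<lambda>x. g x $ i" 2 "\<lambda>x. h x $ i" a for i]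
    by (simp add: Gperp_def poly2_vec_def)
qed

lemma UhP_combo:
  assumes "v \<in> UhP P" "w \<in> UhP P"
  shows "(\<lambda>x. a *\<^sub>R v x + w x) \<in> UhP P"
proof -
  let ?R = "region P"
  have H: "v \<in> H1_vec ?R" "w \<in> H1_vec ?R" using assms by (auto simp: UhP_def)
  note H1 = H1_vec_combo[OF open_region bounded_region H, of a]
  obtain g h where g: "is_trace_vec P v g" "\<forall>e\<in>edges P. \<forall>i. edge_poly 2 e (\<lambda>x. g x $ i)"
     "is_trace_vec P w h" "\<forall>e\<in>edges P. \<forall>i. edge_poly 2 e (\<lambda>x. h x $ i)"
    using assms by (auto simp: UhP_def)
  have 1: "\<exists>g. is_trace_vec P (\<lambda>x. a *\<^sub>R v x + w x) g \<and> (\<forall>e\<in>edges P. \<forall>i. edge_poly 2 e (\<lambda>x. g x $ i))"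
    using g is_trace_vec_combo[OF g(1,3), of a] edge_poly_combo[of 2 _ "\<lambda>x. g x $ i" "\<lambda>x. h x $ i" a for i]
    by (intro exI[of _ "\<lambda>x. a *\<^sub>R g x + h x"]) simp
  obtain c d where "weak_div ?R v (\<lambda>_. c)" "weak_div ?R w (\<lambda>_. d)" using assms by (auto simp: UhP_def)
  then have "weak_div ?R (\<lambda>x. a *\<^sub>R v x + w x) (\<lambda>_. a * c + d)"
    by (intro weak_div_combo[OF open_region bounded_region] L2_H1_vec H) (simp_all add: L2_const)
  then have 2: "\<exists>c. weak_div ?R (\<lambda>x. a *\<^sub>R v x + w x) (\<lambda>_. c)" by blast
  obtain s g' where s: "L2 ?R s" "(LINT x:?R|lebesgue. s x) = 0" "g' \<in> Gperp P"
     and sw: "\<And>\<psi>. test_vec ?R \<psi> \<Longrightarrow> l2 ?R (wjac ?R v) (jac \<psi>) + l2 ?R s (cdiv \<psi>) = l2 ?R g' \<psi>"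
    using assms(1) unfolding UhP_def by blast
  obtain t h' where t: "L2 ?R t" "(LINT x:?R|lebesgue. t x) = 0" "h' \<in> Gperp P"
     and tw: "\<And>\<psi>. test_vec ?R \<psi> \<Longrightarrow> l2 ?R (wjac ?R w) (jac \<psi>) + l2 ?R t (cdiv \<psi>) = l2 ?R h' \<psi>"
    using assms(2) unfolding UhP_def by blast
  have st: "L2 ?R (\<lambda>x. a * s x + t x)" using L2_combo[OF s(1) t(1), of a] by simp
  have "(LINT x:?R|lebesgue. a * s x + t x) = l2 ?R (\<lambda>x. a *\<^sub>R s x + t x) (\<lambda>_. 1)" by (simp add: l2_def)
  also have "\<dots> = a * l2 ?R s (\<lambda>_. 1) + l2 ?R t (\<lambda>_. 1)" by (rule l2_combo_left[OF s(1) t(1)]) (simp add: L2_const)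
  also have "\<dots> = 0" using s t by (simp add: l2_def)
  finally have mean: "(LINT x:?R|lebesgue. a * s x + t x) = 0" .
  have eq: "l2 ?R (wjac ?R (\<lambda>x. a *\<^sub>R v x + w x)) (jac \<psi>) + l2 ?R (\<lambda>x. a * s x + t x) (cdiv \<psi>) = l2 ?R (\<lambda>x. a *\<^sub>R g' x + h' x) \<psi>"
    if "test_vec ?R \<psi>" for \<psi>
  proof -
    have sm: "smooth_vec \<psi>" by (rule test_vec_smooth[OF that])
    have L: "L2 ?R (jac \<psi>)" "L2 ?R (cdiv \<psi>)" "L2 ?R \<psi>" "L2 ?R g'" "L2 ?R h'"
      using sm s t by (auto intro: L2_jac L2_smooth smooth_cdiv L2_smooth_vec Gperp_smooth)
    have "l2 ?R (wjac ?R (\<lambda>x. a *\<^sub>R v x + w x)) (jac \<psi>) = a * l2 ?R (wjac ?R v) (jac \<psi>) + l2 ?R (wjac ?R w) (jac \<psi>)"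
      using ae_eq_l2[OF H1(2) ae_eq_refl, of "jac \<psi>"] l2_combo_left[OF L2_wjac[OF H(1)] L2_wjac[OF H(2)] L(1)] by simp
    moreover have "l2 ?R (\<lambda>x. a * s x + t x) (cdiv \<psi>) = a * l2 ?R s (cdiv \<psi>) + l2 ?R t (cdiv \<psi>)"
      using l2_combo_left[OF s(1) t(1) L(2), of a] by simp
    moreover have "l2 ?R (\<lambda>x. a *\<^sub>R g' x + h' x) \<psi> = a * l2 ?R g' \<psi> + l2 ?R h' \<psi>"
      by (rule l2_combo_left[OF L(4,5,3)])
    ultimately show ?thesis using sw[OF that, symmetric] tw[OF that, symmetric] by (simp add: algebra_simps)
  qed
  have 3: "\<exists>s g. L2 ?R s \<and> (LINT x:?R|lebesgue. s x) = 0 \<and> g \<in> Gperp P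
          \<and> (\<forall>\<psi>. test_vec ?R \<psi> \<longrightarrow>
                l2 ?R (wjac ?R (\<lambda>x. a *\<^sub>R v x + w x)) (jac \<psi>) + l2 ?R s (cdiv \<psi>) = l2 ?R g \<psi>)"
    using st mean Gperp_combo[OF s(3) t(3), of a] eq
    by (intro exI[of _ "\<lambda>x. a * s x + t x"] exI[of _ "\<lambda>x. a *\<^sub>R g' x + h' x"]) blast
  show ?thesis using H1(1) 1 2 3 by (simp add: UhP_def)
qed

lemma TVhP_combo:
  assumes "v \<in> TVhP P" "w \<in> TVhP P"
  shows "(\<lambda>x. a *\<^sub>R v x + w x) \<in> TVhP P"
proof -
  have U: "v \<in> UhP P" "w \<in> UhP P" using assms by (auto simp: TVhP_def)
  then have H: "v \<in> H1_vec (region P)" "w \<in> H1_vec (region P)" by (auto simp: UhP_def)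
  obtain q r where q: "is_PiNabla P v q" "\<forall>g\<in>Gperp P. l2 (region P) (\<lambda>x. v x - q x) g = 0"
     "is_PiNabla P w r" "\<forall>g\<in>Gperp P. l2 (region P) (\<lambda>x. w x - r x) g = 0"
    using assms by (auto simp: TVhP_def)
  have s: "smooth_vec q" "smooth_vec r" using q poly2_vec_smooth by (auto simp: is_PiNabla_def PP_def)
  have "l2 (region P) (\<lambda>x. (a *\<^sub>R v x + w x) - (a *\<^sub>R q x + r x)) g = 0" if "g \<in> Gperp P" for g
  proof -
    have "(\<lambda>x. (a *\<^sub>R v x + w x) - (a *\<^sub>R q x + r x)) = (\<lambda>x. a *\<^sub>R (v x - q x) + (w x - r x))"
      by (simp add: algebra_simps)
    then show ?thesis
      using l2_combo_left[of "region P" "\<lambda>x. v x - q x" "\<lambda>x. w x - r x" g a] q that s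
        L2_diff[OF L2_H1_vec[OF H(1)] L2_smooth_vec[OF s(1)]] L2_diff[OF L2_H1_vec[OF H(2)] L2_smooth_vec[OF s(2)]]
        L2_smooth_vec[OF Gperp_smooth[OF that], of "region P"]
      by simp
  qed
  then show ?thesis
    using UhP_combo[OF U] is_PiNabla_combo[OF H q(1,3)] unfolding TVhP_def by blast
qed

section \<open>Linearity of the global spaces\<close>

lemma Vh_combo:
  assumes "open U" "bounded U" "D \<in> Vh U T" "E \<in> Vh U T"
  shows "(\<lambda>x. a * D x + E x) \<in> Vh U T"
  using assms Hrotv_combo(1)[OF assms(1,2), of D E a] VhP_combo[of D _ E a] by (simp add: Vh_def)

lemma Vh0_combo:
  assumes "open U" "bounded U" "D \<in> Vh0 U T" "E \<in> Vh0 U T"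
  shows "(\<lambda>x. a * D x + E x) \<in> Vh0 U T"
proof -
  have "\<exists>g. is_trace P (\<lambda>x. a * D x + E x) g \<and> (\<forall>x\<in>bdry P \<inter> frontier U. g x = 0)" if P: "P \<in> T" for P
  proof -
    obtain g h where "is_trace P D g" "\<forall>x\<in>bdry P \<inter> frontier U. g x = 0"
       "is_trace P E h" "\<forall>x\<in>bdry P \<inter> frontier U. h x = 0"
      using assms P unfolding Vh0_def by blast
    then show ?thesis using is_trace_combo[of P D g E h a] by (intro exI[of _ "\<lambda>x. a * g x + h x"]) simp
  qed
  moreover have "(\<lambda>x. a * D x + E x) \<in> Vh U T" using assms by (intro Vh_combo) (auto simp: Vh0_def)
  ultimately show ?thesis by (simp add: Vh0_def)
qed

lemma Eh_combo:
  assumes "open U" "bounded U" "C \<in> Eh U T" "C' \<in> Eh U T"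
  shows "(\<lambda>x. a *\<^sub>R C x + C' x) \<in> Eh U T"
  using assms Hdiv_combo(1)[OF assms(1,2), of C C' a] EhP_combo[of C _ C' a] by (simp add: Eh_def)

lemma TVh_combo:
  assumes "open U" "bounded U" "v \<in> TVh U T" "w \<in> TVh U T"
  shows "(\<lambda>x. a *\<^sub>R v x + w x) \<in> TVh U T"
  using assms H1_vec_combo(1)[OF assms(1,2), of v w a] TVhP_combo[of v _ w a] by (simp add: TVh_def)

lemma TVh0_combo:
  assumes "open U" "bounded U" "v \<in> TVh0 U T" "w \<in> TVh0 U T"
  shows "(\<lambda>x. a *\<^sub>R v x + w x) \<in> TVh0 U T"
proof -
  have "\<exists>g. is_trace_vec P (\<lambda>x. a *\<^sub>R v x + w x) g \<and> (\<forall>x\<in>bdry P \<inter> frontier U. g x = 0)" if P: "P \<in> T" for P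
  proof -
    obtain g h where "is_trace_vec P v g" "\<forall>x\<in>bdry P \<inter> frontier U. g x = 0"
       "is_trace_vec P w h" "\<forall>x\<in>bdry P \<inter> frontier U. h x = 0"
      using assms P unfolding TVh0_def by blast
    then show ?thesis using is_trace_vec_combo[of P v g w h a] by (intro exI[of _ "\<lambda>x. a *\<^sub>R g x + h x"]) simp
  qed
  moreover have "(\<lambda>x. a *\<^sub>R v x + w x) \<in> TVh U T" using assms by (intro TVh_combo) (auto simp: TVh0_def)
  ultimately show ?thesis by (simp add: TVh0_def)
qed

lemma integral_combo:
  assumes "open U" "bounded U" "L2 U f" "L2 U g"
  shows "(LINT x:U|lebesgue. a * f x + g x) = a * (LINT x:U|lebesgue. f x) + (LINT x:U|lebesgue. g x :: real)"
  using l2_combo_left[OF assms(3,4), of "\<lambda>_. 1" a] L2_const[OF assms(1,2), of "1 :: real"] by (simp add: l2_def)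

lemma Ph0_combo:
  assumes "open U" "bounded U" "p \<in> Ph0 U T" "q \<in> Ph0 U T"
  shows "(\<lambda>x. a * p x + q x) \<in> Ph0 U T"
proof -
  have L: "L2 U p" "L2 U q" using assms by (auto simp: Ph0_def)
  have "\<exists>c. AE x in lebesgue. x \<in> region P \<longrightarrow> a * p x + q x = c" if P: "P \<in> T" for P
  proof -
    obtain c d where "AE x in lebesgue. x \<in> region P \<longrightarrow> p x = c" "AE x in lebesgue. x \<in> region P \<longrightarrow> q x = d"
      using assms P unfolding Ph0_def Ph_def by blast
    then have "AE x in lebesgue. x \<in> region P \<longrightarrow> a * p x + q x = a * c + d" by eventually_elim auto
    then show ?thesis by blast
  qed
  moreover have "(LINT x:U|lebesgue. a * p x + q x) = 0"
    using integral_combo[OF assms(1,2) L, of a] assms by (simp add: Ph0_def)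
  moreover have "L2 U (\<lambda>x. a * p x + q x)" using L2_combo[OF L, of a] by simp
  ultimately show ?thesis by (simp add: Ph0_def Ph_def)
qed

lemma vertex_values_combo:
  assumes "vertex_values T D d" "vertex_values T E e"
  shows "vertex_values T (\<lambda>x. a * D x + E x) (\<lambda>x. a * d x + e x)"
  unfolding vertex_values_def
proof
  fix P assume P: "P \<in> T"
  obtain g h where "is_trace P D g" "\<forall>x\<in>set P. g x = d x" "is_trace P E h" "\<forall>x\<in>set P. h x = e x"
    using assms P unfolding vertex_values_def by blast
  then show "\<exists>g. is_trace P (\<lambda>x. a * D x + E x) g \<and> (\<forall>x\<in>set P. g x = a * d x + e x)"
    using is_trace_combo[of P D g E h a] by (intro exI[of _ "\<lambda>x. a * g x + h x"]) simp
qed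

lemma node_values_combo:
  assumes "node_values T v d" "node_values T w e"
  shows "node_values T (\<lambda>x. a *\<^sub>R v x + w x) (\<lambda>x. a *\<^sub>R d x + e x)"
  unfolding node_values_def
proof
  fix P assume P: "P \<in> T"
  obtain g h where "is_trace_vec P v g" "\<forall>x\<in>nodes P. g x = d x" "is_trace_vec P w h" "\<forall>x\<in>nodes P. h x = e x"
    using assms P unfolding node_values_def by blast
  then show "\<exists>g. is_trace_vec P (\<lambda>x. a *\<^sub>R v x + w x) g \<and> (\<forall>x\<in>nodes P. g x = a *\<^sub>R d x + e x)"
    using is_trace_vec_combo[of P v g w h a] by (intro exI[of _ "\<lambda>x. a *\<^sub>R g x + h x"]) simp
qed

lemma edge_fluxes_combo:
  assumes "edge_fluxes T C d" "edge_fluxes T C' e"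
  shows "edge_fluxes T (\<lambda>x. a *\<^sub>R C x + C' x) (\<lambda>i. a * d i + e i)"
  unfolding edge_fluxes_def
proof
  fix P assume P: "P \<in> T"
  obtain g h where gh: "is_normal_trace P C g" "\<forall>i\<in>edges P. edge_int i (g i) = d i"
     "is_normal_trace P C' h" "\<forall>i\<in>edges P. edge_int i (h i) = e i"
    using assms P unfolding edge_fluxes_def by blast
  then have "\<forall>i\<in>edges P. edge_int i (\<lambda>x. a * g i x + h i x) = a * d i + e i"
    using edge_int_combo[of _ "g _" "h _" a] by (simp add: is_normal_trace_def)
  then show "\<exists>g. is_normal_trace P (\<lambda>x. a *\<^sub>R C x + C' x) g \<and> (\<forall>i\<in>edges P. edge_int i (g i) = a * d i + e i)"
    using is_normal_trace_combo[OF gh(1,3), of a] by (intro exI[of _ "\<lambda>i x. a * g i x + h i x"]) simp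
qed

lemma edge_avg_combo: "edge_avg (\<lambda>i. a * x i + y i) e = a * edge_avg x e + edge_avg y e"
  by (cases e) (simp add: edge_avg_def)

section \<open>Linearity of the vectors of degrees of freedom\<close>

lemma corr_combo:
  assumes U: "open (Om s)" "bounded (Om s)" and T: "\<And>P. P \<in> msh s \<Longrightarrow> region P \<subseteq> Om s"
    and x: "corr s x (u, B, E, p)" and y: "corr s y (v, C, D, q)"
  shows "corr s (\<lambda>i. a * x i + y i)
    (\<lambda>z. a *\<^sub>R u z + v z, \<lambda>z. a *\<^sub>R B z + C z, \<lambda>z. a * E z + D z, \<lambda>z. a * p z + q z)"
proof -
  have m: "u \<in> TVh0 (Om s) (msh s)" "B \<in> Eh (Om s) (msh s)" "E \<in> Vh0 (Om s) (msh s)" "p \<in> Ph0 (Om s) (msh s)"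
    "v \<in> TVh0 (Om s) (msh s)" "C \<in> Eh (Om s) (msh s)" "D \<in> Vh0 (Om s) (msh s)" "q \<in> Ph0 (Om s) (msh s)"
    using x y by (auto simp: corr_def states_def)
  have 1: "node_values (msh s) (\<lambda>z. a *\<^sub>R u z + v z) (\<lambda>z. \<chi> i. a * x (TV_dof z i) + y (TV_dof z i))"
  proof -
    have "(\<lambda>z. a *\<^sub>R (\<chi> i. x (TV_dof z i)) + (\<chi> i. y (TV_dof z i))) = (\<lambda>z. \<chi> i. a * x (TV_dof z i) + y (TV_dof z i))"
      by (simp add: fun_eq_iff vec_eq_iff)
    then show ?thesis
      using node_values_combo[of "msh s" u _ v _ a] x y by (fastforce simp: corr_def)
  qed
  have 2: "edge_fluxes (msh s) (\<lambda>z. a *\<^sub>R B z + C z) (\<lambda>e. edge_length e * edge_avg (\<lambda>i. a * x i + y i) e)"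
  proof -
    have "(\<lambda>e. edge_length e * edge_avg (\<lambda>i. a * x i + y i) e)
        = (\<lambda>e. a * (edge_length e * edge_avg x e) + edge_length e * edge_avg y e)"
      unfolding edge_avg_combo by (simp add: algebra_simps)
    then show ?thesis
      using edge_fluxes_combo[of "msh s" B _ C _ a] x y by (simp add: corr_def)
  qed
  have 3: "vertex_values (msh s) (\<lambda>z. a * E z + D z) (\<lambda>z. a * x (V_dof z) + y (V_dof z))"
    using vertex_values_combo[of "msh s" E _ D _ a] x y by (simp add: corr_def)
  have 4: "(LINT z:region P|lebesgue. a * p z + q z) = a * x (P_dof P) + y (P_dof P)" if P: "P \<in> msh s" for P
  proof -
    have "L2 (region P) p" "L2 (region P) q"
      using m T[OF P] by (auto simp: Ph0_def intro: L2_subset)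
    then show ?thesis using integral_combo[OF open_region bounded_region] x y P by (simp add: corr_def)
  qed
  show ?thesis
    using 1 2 3 4 x y TVh0_combo[OF U m(1,5), of a] Eh_combo[OF U m(2,6), of a] Vh0_combo[OF U m(3,7), of a] Ph0_combo[OF U m(4,8), of a]
    by (simp add: corr_def states_def)
qed

lemma lex_total: "a \<noteq> b \<Longrightarrow> lex_less a b \<or> lex_less b a"
  by (auto simp: lex_less_def vec_eq_iff forall_2)

text \<open>Degrees of freedom are averages, hence the division by the length.\<close>

definition flux_dofs :: "scheme \<Rightarrow> vect \<Rightarrow> dofvec" where
  "flux_dofs s Z i = (if i \<in> dofs (msh s) then (case i of E_dof e \<Rightarrow> flux s Z e / edge_length e | _ \<Rightarrow> 0) else 0)"

text \<open>The two directions of an edge carry opposite fluxes, so that one degree of freedom serves the cells on both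
  sides.\<close>

lemma flux_dofs_avg:
  assumes "flux_functional (Om s) (msh s) (flux s)" "Z \<in> Hdiv (Om s)"
    and P: "P \<in> msh s" "polygon P" and e: "e \<in> edges P"
  shows "edge_length e * edge_avg (flux_dofs s Z) e = flux s Z e"
proof -
  obtain a b where ab: "e = (a, b)" by (cases e)
  have ne: "a \<noteq> b" using edges_distinct[OF P(2)] e ab by blast
  have anti: "flux s Z (b, a) = - flux s Z (a, b)"
    using assms(1,2) P(1) e unfolding flux_functional_def ab by blast
  show ?thesis
  proof (cases "lex_less a b")
    case True
    then have "E_dof (a, b) \<in> dofs (msh s)" using P(1) e unfolding dofs_def ab by blast
    then show ?thesis using True ne by (simp add: ab edge_avg_def flux_dofs_def edge_length_def)
  next
    case False
    then have "lex_less b a" using lex_total[OF ne] by blast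
    then have "E_dof (b, a) \<in> dofs (msh s)" using P(1) e unfolding dofs_def ab by blast
    then show ?thesis using False ne anti by (simp add: ab edge_avg_def flux_dofs_def edge_length_def dist_commute)
  qed
qed

lemma edge_fluxes_flux:
  assumes "flux_functional (Om s) (msh s) (flux s)" "Z \<in> Eh (Om s) (msh s)"
  shows "edge_fluxes (msh s) Z (flux s Z)"
  unfolding edge_fluxes_def
proof
  fix P assume P: "P \<in> msh s"
  have Z: "Z \<in> Hdiv (Om s)" "Z \<in> EhP P" using assms(2) P by (auto simp: Eh_def)
  then obtain c where c: "is_normal_trace P Z (\<lambda>e _. c e)" by (auto simp: EhP_def)
  with assms(1) Z(1) P have "\<forall>e\<in>edges P. flux s Z e = edge_int e (\<lambda>_. c e)"
    unfolding flux_functional_def by blast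
  with c show "\<exists>g. is_normal_trace P Z g \<and> (\<forall>e\<in>edges P. edge_int e (g e) = flux s Z e)"
    by (intro exI[of _ "\<lambda>e _. c e"]) simp
qed

lemma edge_fluxes_cong:
  "(\<And>P e. P \<in> T \<Longrightarrow> e \<in> edges P \<Longrightarrow> d e = d' e) \<Longrightarrow> edge_fluxes T C d \<longleftrightarrow> edge_fluxes T C d'"
  unfolding edge_fluxes_def by (metis (no_types, lifting))

lemma corr_add_field:
  assumes U: "open (Om s)" "bounded (Om s)" and T: "\<And>P. P \<in> msh s \<Longrightarrow> polygon P"
    and fl: "flux_functional (Om s) (msh s) (flux s)"
    and x: "corr s x (u, B, E, p)" and Z: "Z \<in> Eh (Om s) (msh s)"
  shows "corr s (\<lambda>i. flux_dofs s Z i + x i) (u, \<lambda>z. Z z + B z, E, p)"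
proof -
  have B: "B \<in> Eh (Om s) (msh s)" using x by (auto simp: corr_def states_def)
  have ZH: "Z \<in> Hdiv (Om s)" using Z by (simp add: Eh_def)
  have "edge_fluxes (msh s) Z (\<lambda>e. edge_length e * edge_avg (flux_dofs s Z) e)"
    using edge_fluxes_flux[OF fl Z] edge_fluxes_cong[of "msh s" "\<lambda>e. edge_length e * edge_avg (flux_dofs s Z) e" "flux s Z" Z]
      flux_dofs_avg[OF fl ZH] T by blast
  then have "edge_fluxes (msh s) (\<lambda>z. 1 *\<^sub>R Z z + B z)
      (\<lambda>e. 1 * (edge_length e * edge_avg (flux_dofs s Z) e) + edge_length e * edge_avg x e)"
    using x by (intro edge_fluxes_combo) (auto simp: corr_def)
  then have "edge_fluxes (msh s) (\<lambda>z. Z z + B z) (\<lambda>e. edge_length e * edge_avg (\<lambda>i. flux_dofs s Z i + x i) e)"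
    using edge_avg_combo[of 1 "flux_dofs s Z" x] by (simp add: algebra_simps)
  moreover have "(\<lambda>z. Z z + B z) \<in> Eh (Om s) (msh s)" using Eh_combo[OF U Z B, of 1] by simp
  moreover have "flux_dofs s Z (TV_dof z i) = 0" "flux_dofs s Z (V_dof z) = 0" "flux_dofs s Z (P_dof P) = 0" for z i P
    by (simp_all add: flux_dofs_def)
  moreover have "flux_dofs s Z i = 0" if "i \<notin> dofs (msh s)" for i using that by (simp add: flux_dofs_def)
  ultimately show ?thesis using x by (simp add: corr_def states_def)
qed

section \<open>The divergence is determined by the edge fluxes\<close>

text \<open>The cells cover the domain up to their boundaries, which are null sets.\<close>

lemma mesh_ae_eq:
  assumes "mesh_of U \<rho> T" "\<And>P. P \<in> T \<Longrightarrow> ae_eq (region P) f g"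
  shows "ae_eq U f g"
proof -
  have T: "finite T" "closure U = (\<Union>P\<in>T. closure (region P))" using assms(1) by (auto simp: mesh_of_def)
  have "AE x in lebesgue. \<forall>P\<in>T. x \<in> region P \<longrightarrow> f x = g x"
    using assms(2) T(1) by (intro AE_finite_allI) (auto simp: ae_eq_def)
  moreover have "AE x in lebesgue. \<forall>P\<in>T. x \<notin> bdry P"
    using T(1) bdry_negligible by (intro AE_finite_allI AE_not_in) (auto simp: negligible_iff_null_sets)
  ultimately show ?thesis
    unfolding ae_eq_def
  proof eventually_elim
    case (elim x)
    show ?case
    proof
      assume "x \<in> U"
      then obtain P where P: "P \<in> T" "x \<in> closure (region P)" using T(2) closure_subset by blast
      then have "x \<in> region P"
        using closure_inside_subset[OF bdry_closed[of P]] elim(2) by (auto simp: region_def)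
      with elim(1) P(1) show "f x = g x" by blast
    qed
  qed
qed

text \<open>Green's formula for the normal trace, tested with the constant \<open>1\<close>.\<close>

lemma polygon_mean_divergence:
  assumes "is_normal_trace P B g" "weak_div (region P) B (\<lambda>_. c)"
  shows "c * measure lebesgue (region P) = (\<Sum>e\<in>edges P. edge_int e (g e))"
proof -
  let ?R = "region P"
  have B: "B \<in> Hdiv ?R" using assms by (simp add: is_normal_trace_def)
  have "ae_eq ?R (wdiv ?R B) (\<lambda>_. c)"
    using assms(2) by (intro wdiv_unique) (auto simp: L2_const)
  then have "l2 ?R (wdiv ?R B) (\<lambda>_. 1) = l2 ?R (\<lambda>_. c) (\<lambda>_. 1)" by (intro ae_eq_l2) auto
  also have "\<dots> = c * measure lebesgue ?R" by (simp add: l2_def set_lebesgue_integral_def mult.commute)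
  finally have "l2 ?R (wdiv ?R B) (\<lambda>_. 1) = c * measure lebesgue ?R" .
  moreover have "grad (\<lambda>_. 1) = (\<lambda>_. 0)" by (simp add: fun_eq_iff vec_eq_iff)
  moreover have "l2 ?R B (grad (\<lambda>_. 1)) + l2 ?R (wdiv ?R B) (\<lambda>_. 1) = (\<Sum>e\<in>edges P. edge_int e (\<lambda>x. g e x * 1))"
    using assms(1) smooth_const[of 1] unfolding is_normal_trace_def by blast
  ultimately show ?thesis by simp
qed

text \<open>On every cell the divergence of an edge field is a constant, which is the total flux through the boundary
  divided by the area. By uniqueness of weak divergences the global one agrees with these constants.\<close>

lemma solenoidal_iff_fluxes:
  assumes U: "open U" "bounded U" and T: "mesh_of U \<rho> T" and B: "B \<in> Eh U T" and d: "edge_fluxes T B d"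
  shows "weak_div U B (\<lambda>_. 0) \<longleftrightarrow> (\<forall>P\<in>T. (\<Sum>e\<in>edges P. d e) = 0)"
proof
  have P: "polygon P" "region P \<subseteq> U" if "P \<in> T" for P using T that by (auto simp: mesh_of_def)
  have mean: "c * measure lebesgue (region P) = (\<Sum>e\<in>edges P. d e)" if "P \<in> T" "weak_div (region P) B (\<lambda>_. c)" for P c
  proof -
    obtain g where "is_normal_trace P B g" "\<forall>e\<in>edges P. edge_int e (g e) = d e"
      using d \<open>P \<in> T\<close> unfolding edge_fluxes_def by blast
    with polygon_mean_divergence[OF this(1) that(2)] show ?thesis by simp
  qed
  {
    assume w: "weak_div U B (\<lambda>_. 0)"
    show "\<forall>P\<in>T. (\<Sum>e\<in>edges P. d e) = 0"
      using mean[of _ 0] weak_div_restrict[OF w P(2)] by simp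
  next
    assume z: "\<forall>P\<in>T. (\<Sum>e\<in>edges P. d e) = 0"
    have H: "B \<in> Hdiv U" using B by (simp add: Eh_def)
    note D = wdiv_spec[OF H]
    have "ae_eq U (wdiv U B) (\<lambda>_. 0)"
    proof (rule mesh_ae_eq[OF T])
      fix P assume PT: "P \<in> T"
      obtain c where c: "weak_div (region P) B (\<lambda>_. c)" using B PT by (auto simp: Eh_def EhP_def)
      have "c = 0" using mean[OF PT c] z PT polygon_integral_pos(1)[OF P(1)[OF PT]] by simp
      have "L2 (region P) (wdiv U B)" "weak_div (region P) B (wdiv U B)"
        using D P(2)[OF PT] by (auto intro: L2_subset weak_div_restrict)
      with c \<open>c = 0\<close> show "ae_eq (region P) (wdiv U B) (\<lambda>_. 0)"
        by (intro weak_div_unique[of "region P" _ _ B]) (auto simp: L2_const)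
    qed
    then show "weak_div U B (\<lambda>_. 0)" using D weak_div_cong[OF ae_eq_refl] by blast
  }
qed

section \<open>Rotations of the vertex space\<close>

text \<open>On an edge the normal component of the rotation of \<open>\<phi>\<close> is the tangential derivative of \<open>\<phi>\<close>; integration by
  parts moves the derivative onto the affine function \<open>g\<close>.\<close>

lemma edge_int_tangential:
  assumes ne: "a \<noteq> b" and g: "edge_poly 1 (a, b) g" and \<phi>: "smooth \<phi>"
  shows "edge_int (a, b) (\<lambda>x. g x * (crotv \<phi> x \<bullet> normal (a, b)))
    = (g b * \<phi> b - g a * \<phi> a) - edge_int (a, b) (\<lambda>x. (g b - g a) / dist a b * \<phi> x)"
proof -
  let ?l = "linepath a b" and ?h = "\<lambda>t. \<phi> (linepath a b t)"
  let ?h' = "\<lambda>t. (b - a) $ 1 * pd 1 \<phi> (linepath a b t) + (b - a) $ 2 * pd 2 \<phi> (linepath a b t)"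
  have lp: "linepath a b t = a + t *\<^sub>R (b - a)" for t by (simp add: linepath_def algebra_simps)
  obtain c where c: "\<And>t. t \<in> {0..1} \<Longrightarrow> g (?l t) = (\<Sum>i\<le>1. c i * t ^ i)"
    using g by (auto simp: edge_poly_def)
  then have gl: "g (?l t) = c 0 + c 1 * t" if "t \<in> {0..1}" for t using that by simp
  have ga: "g a = c 0" "g b = c 0 + c 1" using gl[of 0] gl[of 1] by (simp_all add: linepath_def)
  have hd: "(?h has_real_derivative ?h' t) (at t within S)" for t S
    unfolding lp by (rule line_derivative[OF smooth_differentiable[OF \<phi>]])
  have lc: "continuous_on {0..1} (\<lambda>t. f (?l t))" if "smooth f" for f
    by (rule continuous_on_compose2[OF smooth_continuous[OF that, of UNIV] continuous_on_linepath]) simp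
  have hc: "continuous_on {0..1} ?h" by (rule lc[OF \<phi>])
  have h'c: "continuous_on {0..1} ?h'"
    by (intro continuous_on_add continuous_on_mult continuous_on_const lc smooth_pd \<phi>)
  have "(LINT t|lborel. indicat_real {0..1} t *\<^sub>R (c 1 * ?h t + (c 0 + c 1 * t) * ?h' t))
      = (c 0 + c 1 * 1) * ?h 1 - (c 0 + c 1 * 0) * ?h 0"
  proof (rule integral_FTC_atLeastAtMost)
    show "((\<lambda>t. (c 0 + c 1 * t) * ?h t) has_vector_derivative c 1 * ?h t + (c 0 + c 1 * t) * ?h' t) (at t within {0..1})" for t
    proof -
      have "((\<lambda>t. c 0 + c 1 * t) has_real_derivative c 1) (at t within {0..1})"
        by (auto intro!: derivative_eq_intros)
      from DERIV_mult[OF this hd] show ?thesis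
        by (simp add: has_real_derivative_iff_has_vector_derivative algebra_simps)
    qed
    show "continuous_on {0..1} (\<lambda>t. c 1 * ?h t + (c 0 + c 1 * t) * ?h' t)"
      by (intro continuous_on_add continuous_on_mult continuous_on_const continuous_on_id hc h'c)
  qed simp
  then have FTC: "(LINT t:{0..1}|lborel. c 1 * ?h t + (c 0 + c 1 * t) * ?h' t) = g b * \<phi> b - g a * \<phi> a"
    by (simp add: set_lebesgue_integral_def ga linepath_def)
  have "(LINT t:{0..1}|lborel. c 1 * ?h t + (c 0 + c 1 * t) * ?h' t)
      = (LINT t:{0..1}|lborel. c 1 * ?h t) + (LINT t:{0..1}|lborel. (c 0 + c 1 * t) * ?h' t)"
    by (intro set_integral_add borel_integrable_atLeastAtMost' continuous_on_add continuous_on_mult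
        continuous_on_const continuous_on_id hc h'c)
  moreover have "edge_int (a, b) (\<lambda>x. g x * (crotv \<phi> x \<bullet> normal (a, b))) = (LINT t:{0..1}|lborel. (c 0 + c 1 * t) * ?h' t)"
  proof -
    have n: "crotv \<phi> x \<bullet> normal (a, b) = ((b - a) $ 1 * pd 1 \<phi> x + (b - a) $ 2 * pd 2 \<phi> x) / dist a b" for x
    proof -
      have "crotv \<phi> x \<bullet> vector [b $ 2 - a $ 2, a $ 1 - b $ 1] = (b - a) $ 1 * pd 1 \<phi> x + (b - a) $ 2 * pd 2 \<phi> x"
        by (simp add: inner_vec_def sum_2 algebra_simps)
      then show ?thesis by (simp add: normal_def)
    qed
    have "(LINT t:{0..1}|lborel. g (?l t) * (crotv \<phi> (?l t) \<bullet> normal (a, b)))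
        = (LINT t:{0..1}|lborel. ((c 0 + c 1 * t) * ?h' t) / dist a b)"
      by (intro set_lebesgue_integral_cong) (auto simp: gl n)
    then show ?thesis using ne by (simp add: edge_int_def)
  qed
  moreover have "edge_int (a, b) (\<lambda>x. (g b - g a) / dist a b * \<phi> x) = (LINT t:{0..1}|lborel. c 1 * ?h t)"
    using ne by (simp add: edge_int_def ga)
  ultimately show ?thesis using FTC by simp
qed

text \<open>Green's formula for the trace of \<open>D\<close>, tested with the rotation of a smooth function, which is divergence
  free. After integration by parts along the edges the values at the vertices telescope, and the slopes of the
  trace remain as the normal components.\<close>

lemma rotated_normal_trace:
  assumes P: "polygon P" and D: "D \<in> VhP P" and F: "F \<in> Hdiv (region P)" "weak_rotv (region P) D F"
  obtains c :: "edge \<Rightarrow> real" where "is_normal_trace P F (\<lambda>e _. c e)"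
proof -
  let ?R = "region P"
  obtain g where g: "is_trace P D g" "\<forall>e\<in>edges P. edge_poly 1 e g" using D by (auto simp: VhP_def)
  have H1: "D \<in> H1 ?R" using g(1) by (simp add: is_trace_def)
  let ?G = "wgrad ?R D"
  have G: "L2 ?R ?G" "weak_grad ?R D ?G" using wgrad_spec[OF H1] by auto
  have LF: "L2 ?R F" using F by (simp add: Hdiv_def)
  have LG: "L2 ?R (\<lambda>x. vector [?G x $ 2, - (?G x $ 1)] :: real^2)"
  proof (rule L2_vec)
    fix i :: 2
    have "L2 ?R (\<lambda>x. - (?G x $ 1))" using L2_scaleR[OF L2_component[OF G(1)], of "-1" 1] by simp
    then show "L2 ?R (\<lambda>x. (vector [?G x $ 2, - (?G x $ 1)] :: real^2) $ i)"
      using exhaust_2[of i] L2_component[OF G(1), of 2] by auto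
  qed
  have FG: "ae_eq ?R F (\<lambda>x. vector [?G x $ 2, - (?G x $ 1)])"
    by (rule weak_rotv_unique[OF open_region bounded_region LF LG F(2) weak_rotv_of_weak_grad[OF open_region bounded_region G]])
  have div0: "ae_eq ?R (wdiv ?R F) (\<lambda>_. 0)"
    by (intro wdiv_unique weak_div_of_weak_rotv[OF F(2)]) auto
  let ?c = "\<lambda>e. (g (snd e) - g (fst e)) / dist (fst e) (snd e)"
  have "l2 ?R F (grad \<phi>) + l2 ?R (wdiv ?R F) \<phi> = (\<Sum>e\<in>edges P. edge_int e (\<lambda>x. ?c e * \<phi> x))"
    if \<phi>: "smooth \<phi>" for \<phi>
  proof -
    have "l2 ?R F (grad \<phi>) = l2 ?R (\<lambda>x. vector [?G x $ 2, - (?G x $ 1)]) (grad \<phi>)"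
      by (rule ae_eq_l2[OF FG ae_eq_refl])
    also have "\<dots> = - l2 ?R ?G (crotv \<phi>)"
    proof -
      have e: "vector [?G x $ 2, - (?G x $ 1)] \<bullet> grad \<phi> x = - (?G x \<bullet> crotv \<phi> x)" for x
        by (simp add: inner_vec_def sum_2)
      show ?thesis by (simp add: l2_def e set_lebesgue_integral_def)
    qed
    also have "l2 ?R ?G (crotv \<phi>) = (\<Sum>e\<in>edges P. edge_int e (\<lambda>x. g x * (crotv \<phi> x \<bullet> normal e)))"
    proof -
      have "l2 ?R D (cdiv (crotv \<phi>)) + l2 ?R ?G (crotv \<phi>)
          = (\<Sum>e\<in>edges P. edge_int e (\<lambda>x. g x * (crotv \<phi> x \<bullet> normal e)))"
        using g(1) smooth_vec_crotv[OF \<phi>] unfolding is_trace_def by blast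
      then show ?thesis by (simp add: cdiv_crotv[OF \<phi>])
    qed
    also have "\<dots> = (\<Sum>(a, b)\<in>edges P. g b * \<phi> b - g a * \<phi> a) - (\<Sum>e\<in>edges P. edge_int e (\<lambda>x. ?c e * \<phi> x))"
      unfolding sum_subtractf[symmetric]
    proof (rule sum.cong[OF refl])
      fix e assume e: "e \<in> edges P"
      obtain a b where ab: "e = (a, b)" by (cases e)
      have "a \<noteq> b" using edges_distinct[OF P] e ab by blast
      from edge_int_tangential[OF this _ \<phi>] g(2) e
      show "edge_int e (\<lambda>x. g x * (crotv \<phi> x \<bullet> normal e))
          = (case e of (a, b) \<Rightarrow> g b * \<phi> b - g a * \<phi> a) - edge_int e (\<lambda>x. ?c e * \<phi> x)"
        unfolding ab by simp
    qed
    also have "(\<Sum>(a, b)\<in>edges P. g b * \<phi> b - g a * \<phi> a) = 0"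
      using P by (intro sum_edges_telescope[of P "\<lambda>a. g a * \<phi> a"]) (simp add: polygon_def)
    finally show ?thesis
      using ae_eq_l2[OF div0 ae_eq_refl, of \<phi>] by simp
  qed
  then have "is_normal_trace P F (\<lambda>e _. ?c e)" using F(1) by (simp add: is_normal_trace_def)
  then show ?thesis by (rule that)
qed

text \<open>The strong form of the discrete Faraday law needs the rotations of the vertex space among the fields that
  the law can be tested with.\<close>

theorem wrotv_in_Eh:
  assumes T: "mesh_of U \<rho> T" and D: "D \<in> Vh U T"
  shows "wrotv U D \<in> Eh U T" and "weak_div U (wrotv U D) (\<lambda>_. 0)"
proof -
  let ?F = "wrotv U D"
  have H: "D \<in> Hrotv U" using D by (simp add: Vh_def)
  have F: "L2 U ?F" "weak_rotv U D ?F" using wrotv_spec[OF H] by auto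
  show div: "weak_div U ?F (\<lambda>_. 0)" by (rule weak_div_of_weak_rotv[OF F(2)])
  have "?F \<in> Hdiv U" using F div by (auto simp: Hdiv_def intro!: exI[of _ "\<lambda>_. 0"])
  moreover have "?F \<in> EhP P" if PT: "P \<in> T" for P
  proof -
    let ?R = "region P"
    have P: "polygon P" "?R \<subseteq> U" using T PT by (auto simp: mesh_of_def)
    have DP: "D \<in> VhP P" using D PT by (simp add: Vh_def)
    have HP: "D \<in> Hrotv ?R" using DP by (simp add: VhP_def)
    have FR: "L2 ?R ?F" "weak_rotv ?R D ?F" using F P(2) by (auto intro: L2_subset weak_rotv_restrict)
    have dR: "weak_div ?R ?F (\<lambda>_. 0)" by (rule weak_div_of_weak_rotv[OF FR(2)])
    have "ae_eq ?R (wrotv ?R D) ?F" by (rule wrotv_unique[OF open_region bounded_region FR])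
    then have rR: "weak_rot ?R ?F (\<lambda>_. 0)"
      using DP weak_rot_cong[OF _ ae_eq_refl, of ?R "wrotv ?R D" ?F "\<lambda>_. 0"] by (simp add: VhP_def)
    have Hd: "?F \<in> Hdiv ?R" using FR dR by (auto simp: Hdiv_def intro!: exI[of _ "\<lambda>_. 0"])
    have Hr: "?F \<in> Hrot ?R" using FR rR by (auto simp: Hrot_def intro!: exI[of _ "\<lambda>_. 0"])
    obtain c :: "edge \<Rightarrow> real" where "is_normal_trace P ?F (\<lambda>e _. c e)"
      using rotated_normal_trace[OF P(1) DP Hd FR(2)] .
    then have "\<exists>c :: edge \<Rightarrow> real. is_normal_trace P ?F (\<lambda>e _. c e)" by (rule exI[where x = c])
    then show ?thesis using Hd Hr dR rR by (auto simp: EhP_def)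
  qed
  ultimately show "?F \<in> Eh U T" by (simp add: Eh_def)
qed

section \<open>The inner product on the edge space\<close>

text \<open>Defined by pairings with constants, so that linearity and independence of the representative are inherited
  from \<open>l2\<close>.\<close>

definition mean :: "pt set \<Rightarrow> vect \<Rightarrow> real^2" where
  "mean U f = (\<chi> i. l2 U f (\<lambda>_. axis i 1) / measure lebesgue U)"

context
  fixes U :: "pt set"
  assumes U: "open U" "bounded U"
begin

lemma l2_const_right:
  fixes f :: vect
  assumes "L2 U f"
  shows "l2 U f (\<lambda>_. r) = r $ 1 * l2 U f (\<lambda>_. axis 1 1) + r $ 2 * l2 U f (\<lambda>_. axis 2 1)"
proof -
  have r: "r = r $ 1 *\<^sub>R axis 1 1 + (r $ 2 *\<^sub>R axis 2 1 + 0)" by (auto simp: vec_eq_iff forall_2 axis_def)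
  have c: "L2 U (\<lambda>_. c :: real^2)" for c using U by (rule L2_const)
  have "l2 U f (\<lambda>_. r $ 1 *\<^sub>R axis 1 1 + (r $ 2 *\<^sub>R axis 2 1 + 0))
      = r $ 1 * l2 U f (\<lambda>_. axis 1 1) + (r $ 2 * l2 U f (\<lambda>_. axis 2 1) + l2 U f (\<lambda>_. 0))"
    using l2_combo_right[OF c c assms] by metis
  then show ?thesis using r by simp
qed

lemma l2_consts: "l2 U (\<lambda>_. c) (\<lambda>_. r) = (c \<bullet> r) * measure lebesgue U"
  by (simp add: l2_def set_lebesgue_integral_def mult.commute)

lemma l2proj_mean:
  assumes f: "L2 U f" and m: "measure lebesgue U > 0"
  shows "l2proj U consts0 f = (\<lambda>_. mean U f)"
  unfolding l2proj_def
proof (rule the_equality)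
  have "l2 U (\<lambda>_. mean U f) (\<lambda>_. r) = l2 U f (\<lambda>_. r)" for r
    unfolding l2_consts l2_const_right[OF f, of r] using m
    by (simp add: mean_def inner_vec_def sum_2 field_simps)
  then show "(\<lambda>_. mean U f) \<in> consts0 \<and> (\<forall>r\<in>consts0. l2 U (\<lambda>_. mean U f) r = l2 U f r)"
    by (auto simp: consts0_def)
next
  fix q assume q: "q \<in> consts0 \<and> (\<forall>r\<in>consts0. l2 U q r = l2 U f r)"
  then obtain c where c: "q = (\<lambda>_. c)" by (auto simp: consts0_def)
  have "(c \<bullet> axis i 1) * measure lebesgue U = l2 U f (\<lambda>_. axis i 1)" for i
    using q unfolding c l2_consts[symmetric] by (auto simp: consts0_def)
  then have "c = mean U f"
    using m by (simp add: mean_def vec_eq_iff inner_axis field_simps)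
  then show "q = (\<lambda>_. mean U f)" by (simp add: c)
qed

lemma mean_combo:
  assumes "L2 U f" "L2 U g"
  shows "mean U (\<lambda>x. a *\<^sub>R f x + g x) = a *\<^sub>R mean U f + mean U g"
  using l2_combo_left[OF assms L2_const[OF U]]
  by (simp add: mean_def vec_eq_iff add_divide_distrib)

lemma mean_const: "measure lebesgue U > 0 \<Longrightarrow> mean U (\<lambda>_. c) = c"
  by (simp add: mean_def vec_eq_iff l2_consts inner_axis)

lemma mean_cong: "ae_eq U f g \<Longrightarrow> mean U f = mean U g"
  by (simp add: mean_def ae_eq_l2[OF _ ae_eq_refl])

end

text \<open>The contribution of a single cell, with the projection written as the mean value.\<close>

definition ip_cell :: "cell \<Rightarrow> (vect \<Rightarrow> vect \<Rightarrow> real) \<Rightarrow> vect \<Rightarrow> vect \<Rightarrow> real" where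
  "ip_cell P S B C = l2 (region P) (\<lambda>_. mean (region P) B) (\<lambda>_. mean (region P) C)
     + S (\<lambda>x. B x - mean (region P) B) (\<lambda>x. C x - mean (region P) C)"

lemma EhP_L2: "C \<in> EhP P \<Longrightarrow> L2 (region P) C" by (simp add: EhP_def Hdiv_def)

lemma EhP_fluctuation:
  assumes "polygon P" "C \<in> EhP P"
  shows "(\<lambda>x. C x - mean (region P) C) \<in> EhP P"
  using EhP_combo[OF constants_in_EhP[OF assms(1)] assms(2), of "-1" "mean (region P) C"] by simp

context
  fixes P S lo hi
  assumes P: "polygon P"
    and S: "stabilising (region P) (EhP P) {C \<in> EhP P. l2proj (region P) consts0 C = (\<lambda>_. 0)} lo hi S"
begin

lemma S_combo:
  assumes "f \<in> EhP P" "g \<in> EhP P" "k \<in> EhP P"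
  shows "S (\<lambda>x. a *\<^sub>R f x + g x) k = a * S f k + S g k" "S k (\<lambda>x. a *\<^sub>R f x + g x) = a * S k f + S k g"
proof -
  have b: "bilinear_on (EhP P) S" using S by (simp add: stabilising_def)
  show "S (\<lambda>x. a *\<^sub>R f x + g x) k = a * S f k + S g k" using b assms unfolding bilinear_on_def by blast
  show "S k (\<lambda>x. a *\<^sub>R f x + g x) = a * S k f + S k g" using b assms unfolding bilinear_on_def by blast
qed

lemma fluctuation_combo:
  assumes "B \<in> EhP P" "B' \<in> EhP P"
  shows "(\<lambda>x. (a *\<^sub>R B x + B' x) - mean (region P) (\<lambda>x. a *\<^sub>R B x + B' x))
    = (\<lambda>x. a *\<^sub>R (B x - mean (region P) B) + (B' x - mean (region P) B'))"
  using mean_combo[OF open_region bounded_region EhP_L2[OF assms(1)] EhP_L2[OF assms(2)], of a] by (simp add: algebra_simps)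

lemma ip_cell_combo:
  assumes "B \<in> EhP P" "B' \<in> EhP P" "C \<in> EhP P"
  shows "ip_cell P S (\<lambda>x. a *\<^sub>R B x + B' x) C = a * ip_cell P S B C + ip_cell P S B' C"
    and "ip_cell P S C (\<lambda>x. a *\<^sub>R B x + B' x) = a * ip_cell P S C B + ip_cell P S C B'"
proof -
  note fl = EhP_fluctuation[OF P assms(1)] EhP_fluctuation[OF P assms(2)] EhP_fluctuation[OF P assms(3)]
  note mc = mean_combo[OF open_region bounded_region EhP_L2[OF assms(1)] EhP_L2[OF assms(2)], of a]
  let ?f = "\<lambda>x. (a *\<^sub>R B x + B' x) - mean (region P) (\<lambda>x. a *\<^sub>R B x + B' x)"
    and ?g = "\<lambda>B x. B x - mean (region P) B"
  have S1: "S ?f (?g C) = a * S (?g B) (?g C) + S (?g B') (?g C)"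
    unfolding fluctuation_combo[OF assms(1,2)] by (rule S_combo(1)[OF fl])
  have S2: "S (?g C) ?f = a * S (?g C) (?g B) + S (?g C) (?g B')"
    unfolding fluctuation_combo[OF assms(1,2)] by (rule S_combo(2)[OF fl])
  show "ip_cell P S (\<lambda>x. a *\<^sub>R B x + B' x) C = a * ip_cell P S B C + ip_cell P S B' C"
    unfolding ip_cell_def S1 unfolding mc l2_consts[OF open_region bounded_region]
    by (simp add: inner_add_left algebra_simps)
  show "ip_cell P S C (\<lambda>x. a *\<^sub>R B x + B' x) = a * ip_cell P S C B + ip_cell P S C B'"
    unfolding ip_cell_def S2 unfolding mc l2_consts[OF open_region bounded_region]
    by (simp add: inner_add_right algebra_simps)
qed

text \<open>Continuity makes the form insensitive to the choice of a representative.\<close>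

lemma ip_cell_cong:
  assumes "B \<in> EhP P" "B' \<in> EhP P" "C \<in> EhP P" "ae_eq (region P) B B'"
  shows "ip_cell P S B C = ip_cell P S B' C"
proof -
  let ?f = "\<lambda>x. B x - mean (region P) B" and ?f' = "\<lambda>x. B' x - mean (region P) B'" and ?k = "\<lambda>x. C x - mean (region P) C"
  note fl = EhP_fluctuation[OF P assms(1)] EhP_fluctuation[OF P assms(2)] EhP_fluctuation[OF P assms(3)]
  have m: "mean (region P) B = mean (region P) B'" by (rule mean_cong[OF open_region bounded_region assms(4)])
  let ?N = "\<lambda>x. -1 *\<^sub>R ?f' x + ?f x"
  have "ae_eq (region P) ?N (\<lambda>_. 0)" using assms(4) unfolding ae_eq_def m by eventually_elim auto
  from ae_eq_l2[OF this this] have "l2norm (region P) ?N = 0" by (simp add: l2norm_def)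
  moreover obtain M where "\<And>f g. f \<in> EhP P \<Longrightarrow> g \<in> EhP P \<Longrightarrow> \<bar>S f g\<bar> \<le> M * l2norm (region P) f * l2norm (region P) g"
    using S unfolding stabilising_def by blast
  then have "\<bar>S ?N ?k\<bar> \<le> M * l2norm (region P) ?N * l2norm (region P) ?k"
    using EhP_combo[OF fl(2,1), of "-1"] fl(3) by blast
  ultimately have "S ?N ?k = 0" by simp
  then have "S ?f ?k = S ?f' ?k" using S_combo(1)[OF fl(2,1,3), of "-1"] by simp
  then show ?thesis by (simp add: ip_cell_def m)
qed

text \<open>A field is the sum of its mean and a fluctuation in the kernel of the projection, where the stabilising form
  is coercive.\<close>

lemma ip_cell_definite:
  assumes "lo > 0" "C \<in> EhP P"
  shows "0 \<le> ip_cell P S C C" and "ip_cell P S C C = 0 \<Longrightarrow> ae_eq (region P) C (\<lambda>_. 0)"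
proof -
  let ?R = "region P" and ?m = "mean (region P) C"
  let ?f = "\<lambda>x. C x - ?m"
  have pos: "measure lebesgue ?R > 0" by (rule polygon_integral_pos(1)[OF P])
  have fE: "?f \<in> EhP P" by (rule EhP_fluctuation[OF P assms(2)])
  have "mean ?R (\<lambda>x. -1 *\<^sub>R ?m + C x) = -1 *\<^sub>R mean ?R (\<lambda>_. ?m) + ?m"
    by (rule mean_combo) (auto simp: L2_const EhP_L2 assms)
  then have "mean ?R ?f = 0" using mean_const[OF open_region bounded_region pos, of ?m] by simp
  then have "l2proj ?R consts0 ?f = (\<lambda>_. 0)"
    using l2proj_mean[OF open_region bounded_region EhP_L2[OF fE] pos] by simp
  then have "lo * (l2norm ?R ?f)\<^sup>2 \<le> S ?f ?f" using S fE unfolding stabilising_def by blast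
  then have lo: "lo * l2 ?R ?f ?f \<le> S ?f ?f" by (simp add: l2norm_def l2_nonneg)
  have nn: "0 \<le> l2 ?R (\<lambda>_. ?m) (\<lambda>_. ?m)" "0 \<le> lo * l2 ?R ?f ?f"
    using assms(1) by (simp_all add: l2_nonneg)
  with lo show "0 \<le> ip_cell P S C C" by (simp add: ip_cell_def)
  assume "ip_cell P S C C = 0"
  then have "l2 ?R (\<lambda>_. ?m) (\<lambda>_. ?m) + S ?f ?f = 0" by (simp add: ip_cell_def)
  then have z: "l2 ?R (\<lambda>_. ?m) (\<lambda>_. ?m) = 0" "lo * l2 ?R ?f ?f = 0" using lo nn by linarith+
  have "?m = 0" using z(1) pos by (simp add: l2_consts[OF open_region bounded_region])
  moreover have "ae_eq ?R ?f (\<lambda>_. 0)" using z(2) assms by (intro l2_self_eq_0 EhP_L2 fE) simp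
  ultimately show "ae_eq ?R C (\<lambda>_. 0)" by simp
qed

end

section \<open>One Newton step\<close>

lemma admissibleD:
  assumes "admissible s \<rho> c lo hi"
  shows "open (Om s)" "bounded (Om s)" "mesh_of (Om s) \<rho> (msh s)" "finite (msh s)" "Rmag s > 0" "lo > 0"
    and "P \<in> msh s \<Longrightarrow> polygon P" "P \<in> msh s \<Longrightarrow> region P \<subseteq> Om s"
    and "P \<in> msh s \<Longrightarrow>
      stabilising (region P) (EhP P) {C \<in> EhP P. l2proj (region P) consts0 C = (\<lambda>_. 0)} lo hi (SE s P)"
    and "IV s f \<in> Vh (Om s) (msh s)" "flux_functional (Om s) (msh s) (flux s)"
    and "B \<in> Hdiv (Om s) \<Longrightarrow> IE s B \<in> Eh (Om s) (msh s) \<and> edge_fluxes (msh s) (IE s B) (flux s B)"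
  using assms by (simp_all add: admissible_def polygonal_domain_def mesh_of_def)

context
  fixes s \<rho> c lo hi
  assumes adm: "admissible s \<rho> c lo hi"
begin

abbreviation "EE \<equiv> Eh (Om s) (msh s)"

lemma ipE_cells:
  assumes "B \<in> EE" "C \<in> EE"
  shows "ipE s B C = (\<Sum>P\<in>msh s. ip_cell P (SE s P) B C)"
  unfolding ipE_def
proof (rule sum.cong[OF refl])
  fix P assume P: "P \<in> msh s"
  have L: "L2 (region P) B" "L2 (region P) C" using assms P EhP_L2 by (auto simp: Eh_def)
  have m: "measure lebesgue (region P) > 0" by (rule polygon_integral_pos(1)[OF admissibleD(7)[OF adm P]])
  show "(let pr = l2proj (region P) consts0 in
      l2 (region P) (pr B) (pr C) + SE s P (\<lambda>x. B x - pr B x) (\<lambda>x. C x - pr C x)) = ip_cell P (SE s P) B C"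
    using l2proj_mean[OF open_region bounded_region L(1) m] l2proj_mean[OF open_region bounded_region L(2) m]
    by (simp add: ip_cell_def)
qed

lemma ipE_combo:
  assumes "B \<in> EE" "B' \<in> EE" "C \<in> EE"
  shows "ipE s (\<lambda>x. a *\<^sub>R B x + B' x) C = a * ipE s B C + ipE s B' C"
    and "ipE s C (\<lambda>x. a *\<^sub>R B x + B' x) = a * ipE s C B + ipE s C B'"
proof -
  have S: "(\<lambda>x. a *\<^sub>R B x + B' x) \<in> EE" by (rule Eh_combo[OF admissibleD(1,2)[OF adm] assms(1,2)])
  have m: "B \<in> EhP P" "B' \<in> EhP P" "C \<in> EhP P" if "P \<in> msh s" for P using assms that by (auto simp: Eh_def)
  have "ip_cell P (SE s P) (\<lambda>x. a *\<^sub>R B x + B' x) C = a * ip_cell P (SE s P) B C + ip_cell P (SE s P) B' C"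
    if "P \<in> msh s" for P
    by (rule ip_cell_combo(1)[OF admissibleD(7)[OF adm that] admissibleD(9)[OF adm that] m[OF that]])
  then show "ipE s (\<lambda>x. a *\<^sub>R B x + B' x) C = a * ipE s B C + ipE s B' C"
    using assms S by (simp add: ipE_cells sum_distrib_left sum.distrib)
  have "ip_cell P (SE s P) C (\<lambda>x. a *\<^sub>R B x + B' x) = a * ip_cell P (SE s P) C B + ip_cell P (SE s P) C B'"
    if "P \<in> msh s" for P
    by (rule ip_cell_combo(2)[OF admissibleD(7)[OF adm that] admissibleD(9)[OF adm that] m[OF that]])
  then show "ipE s C (\<lambda>x. a *\<^sub>R B x + B' x) = a * ipE s C B + ipE s C B'"
    using assms S by (simp add: ipE_cells sum_distrib_left sum.distrib)
qed

lemma ipE_cong: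
  assumes "B \<in> EE" "B' \<in> EE" "C \<in> EE" "ae_eq (Om s) B B'"
  shows "ipE s B C = ipE s B' C"
proof -
  have "ip_cell P (SE s P) B C = ip_cell P (SE s P) B' C" if P: "P \<in> msh s" for P
    using assms P ae_eq_subset[OF assms(4) admissibleD(8)[OF adm P]]
    by (intro ip_cell_cong[OF admissibleD(7)[OF adm P] admissibleD(9)[OF adm P]]) (auto simp: Eh_def)
  then show ?thesis using assms by (simp add: ipE_cells)
qed

lemma ipE_definite:
  assumes C: "C \<in> EE" and z: "ipE s C C = 0"
  shows "ae_eq (Om s) C (\<lambda>_. 0)"
proof (rule mesh_ae_eq[OF admissibleD(3)[OF adm]])
  fix P assume P: "P \<in> msh s"
  have d: "0 \<le> ip_cell Q (SE s Q) C C" "ip_cell Q (SE s Q) C C = 0 \<Longrightarrow> ae_eq (region Q) C (\<lambda>_. 0)"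
    if Q: "Q \<in> msh s" for Q
    using ip_cell_definite[OF admissibleD(7)[OF adm Q] admissibleD(9)[OF adm Q] admissibleD(6)[OF adm]] C Q
    by (auto simp: Eh_def)
  have "(\<Sum>P\<in>msh s. ip_cell P (SE s P) C C) = 0" using z C by (simp add: ipE_cells)
  then have "ip_cell P (SE s P) C C = 0"
    using sum_nonneg_eq_0_iff[OF admissibleD(4)[OF adm], of "\<lambda>P. ip_cell P (SE s P) C C"] d(1) P by blast
  with d(2)[OF P] show "ae_eq (region P) C (\<lambda>_. 0)" .
qed

lemma EE_scaleR_diff:
  assumes "B \<in> EE" "B' \<in> EE"
  shows "(\<lambda>z. a *\<^sub>R B z) \<in> EE" and "(\<lambda>z. a *\<^sub>R (B z - B' z)) \<in> EE"
proof -
  note U = admissibleD(1,2)[OF adm]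
  have zero: "(\<lambda>_. 0) \<in> EE" using Eh_combo[OF U assms(1,1), of "-1"] by simp
  show "(\<lambda>z. a *\<^sub>R B z) \<in> EE" using Eh_combo[OF U assms(1) zero, of a] by simp
  show "(\<lambda>z. a *\<^sub>R (B z - B' z)) \<in> EE"
    using Eh_combo[OF U Eh_combo[OF U assms(2,1), of "-1"] zero, of a] by simp
qed

lemma Vh_add_IV:
  "E \<in> Vh (Om s) (msh s) \<Longrightarrow> (\<lambda>z. E z + IV s g z) \<in> Vh (Om s) (msh s)"
  using Vh_combo[OF admissibleD(1,2)[OF adm] _ admissibleD(10)[OF adm], of E 1] by simp

text \<open>Of all terms of the residual, only the two of the discrete Faraday law contain the magnetic test field.\<close>

lemma residual_add_field:
  "residual s n un Bn f w (v, \<lambda>z. Z z + C z, D, q) - residual s n un Bn f w (v, C, D, q)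
   = (case w of (uh, B, E, p) \<Rightarrow>
       faraday_factor s * (ipE s (\<lambda>x. (1 / dt s) *\<^sub>R (B x - Bn x)) (\<lambda>z. Z z + C z) - ipE s (\<lambda>x. (1 / dt s) *\<^sub>R (B x - Bn x)) C)
     + faraday_factor s * (ipE s (wrotv (Om s) (\<lambda>x. E x + IV s (Eb s (tn_theta s n)) x)) (\<lambda>z. Z z + C z)
         - ipE s (wrotv (Om s) (\<lambda>x. E x + IV s (Eb s (tn_theta s n)) x)) C))"
  by (cases w) (simp add: residual_def Let_def right_diff_distrib)

lemma corrD:
  assumes "corr s x (u, B, E, p)"
  shows "B \<in> EE" "E \<in> Vh (Om s) (msh s)" "x \<in> Xh0 s"
  using assms by (auto simp: corr_def states_def Vh0_def Xh0_def)

text \<open>Two test vectors that differ by edge degrees of freedom only leave the discrete Faraday law, tested with \<open>Z\<close>: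
  all other terms of the residual cancel.\<close>

lemma G_tested_with_field:
  assumes G: "defines_G s n un Bn f G" and Bn: "Bn \<in> EE"
    and x: "corr s x (u, B, E, p)" and y: "corr s y (v, C, D, q)" and Z: "Z \<in> EE"
  shows "edot s (G x) (\<lambda>i. flux_dofs s Z i + y i) - edot s (G x) y
    = faraday_factor s * (ipE s (\<lambda>x. (1 / dt s) *\<^sub>R (B x - Bn x)) Z
        + ipE s (wrotv (Om s) (\<lambda>x. E x + IV s (Eb s (tn_theta s n)) x)) Z)"
proof -
  let ?A = "\<lambda>x. (1 / dt s) *\<^sub>R (B x - Bn x)" and ?R = "wrotv (Om s) (\<lambda>x. E x + IV s (Eb s (tn_theta s n)) x)"
  note U = admissibleD(1,2)[OF adm]
  have C: "C \<in> EE" by (rule corrD(1)[OF y])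
  have A: "?A \<in> EE" by (rule EE_scaleR_diff(2)[OF corrD(1)[OF x] Bn])
  have R: "?R \<in> EE"
    by (rule wrotv_in_Eh(1)[OF admissibleD(3)[OF adm] Vh_add_IV[OF corrD(2)[OF x]]])
  have c: "corr s (\<lambda>i. flux_dofs s Z i + y i) (v, \<lambda>z. Z z + C z, D, q)"
    by (rule corr_add_field[OF U admissibleD(7)[OF adm] admissibleD(11)[OF adm] y Z])
  have r: "edot s (G x) y' = residual s n un Bn f (u, B, E, p) w'" if "corr s y' w'" for y' w'
    using G corrD(3)[OF x] x that unfolding defines_G_def by blast
  have "edot s (G x) (\<lambda>i. flux_dofs s Z i + y i) - edot s (G x) y
      = residual s n un Bn f (u, B, E, p) (v, \<lambda>z. Z z + C z, D, q) - residual s n un Bn f (u, B, E, p) (v, C, D, q)"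
    unfolding r[OF c] r[OF y] ..
  also have "\<dots> = faraday_factor s * (ipE s ?A Z + ipE s ?R Z)"
    unfolding residual_add_field using ipE_combo(2)[OF Z C A, of 1] ipE_combo(2)[OF Z C R, of 1]
    by (simp add: algebra_simps)
  finally show ?thesis .
qed

text \<open>The Faraday law is affine in the iterate, so the difference quotient in the Newton equation is its exact
  derivative, whatever the size of \<open>fd_eps\<close>. Hence the updated iterate satisfies the law exactly, and its magnetic
  field differs from \<open>Bn\<close> by a multiple of a rotation.\<close>

lemma newton_step_solenoidal:
  assumes dt: "dt s > 0" and \<theta>: "0 \<le> theta s"
    and G: "defines_G s n un Bn f G" and Bn: "Bn \<in> EE"
    and x: "corr s x (u, B, E, p)" and d: "corr s \<delta> (v, C, D, q)"
    and newton: "DG G x \<delta> = (\<lambda>i. - G x i)"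
  shows "weak_div (Om s) (\<lambda>z. C z + (B z - Bn z)) (\<lambda>_. 0)"
proof -
  note U = admissibleD(1,2)[OF adm]
  let ?b = "IV s (Eb s (tn_theta s n))"
  let ?A = "\<lambda>z. (1 / dt s) *\<^sub>R (B z - Bn z)" and ?R = "wrotv (Om s) (\<lambda>z. E z + ?b z)"
  let ?A' = "\<lambda>z. (1 / dt s) *\<^sub>R C z" and ?R' = "wrotv (Om s) D"
  have B: "B \<in> EE" and C: "C \<in> EE" using corrD(1) x d by auto
  note Eb = Vh_add_IV[OF corrD(2)[OF x], of "Eb s (tn_theta s n)"]
  note A = EE_scaleR_diff(2)[OF B Bn, of "1 / dt s"] and A' = EE_scaleR_diff(1)[OF C Bn, of "1 / dt s"]
  note R = wrotv_in_Eh[OF admissibleD(3)[OF adm] Eb]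
  note R' = wrotv_in_Eh[OF admissibleD(3)[OF adm] corrD(2)[OF d]]
  \<comment> \<open>The strong residual of the Faraday law at the updated iterate; it will be tested with itself.\<close>
  define Z where "Z = (\<lambda>z. 1 *\<^sub>R (1 *\<^sub>R ?A z + ?R z) + (1 *\<^sub>R ?A' z + ?R' z))"
  have Z: "Z \<in> EE" unfolding Z_def by (intro Eh_combo U A A' R(1) R'(1))
  let ?y = "\<lambda>i. flux_dofs s Z i + x i" and ?x1 = "\<lambda>i. fd_eps * \<delta> i + x i"
  let ?B1 = "\<lambda>z. fd_eps *\<^sub>R C z + B z" and ?E1 = "\<lambda>z. fd_eps * D z + E z"
  have x1: "corr s ?x1 (\<lambda>z. fd_eps *\<^sub>R v z + u z, ?B1, ?E1, \<lambda>z. fd_eps * q z + p z)"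
    by (rule corr_combo[OF U admissibleD(8)[OF adm] d x])
  have eps: "fd_eps > 0" by (simp add: fd_eps_def)
  have "G ?x1 i = (1 - fd_eps) * G x i" for i
  proof -
    have "(\<lambda>j. x j + fd_eps * \<delta> j) = ?x1" by (rule ext) simp
    then have "(G ?x1 i - G x i) / fd_eps = - G x i"
      using fun_cong[OF newton, of i] by (simp add: DG_def)
    then have "G ?x1 i - G x i = - G x i * fd_eps" using eps by (simp add: divide_eq_eq)
    then show ?thesis by (simp add: algebra_simps)
  qed
  then have Gx1: "edot s (G ?x1) y = (1 - fd_eps) * edot s (G x) y" for y
    by (simp add: edot_def sum_distrib_left mult.assoc)
  have ff: "faraday_factor s \<noteq> 0" using \<theta> admissibleD(5)[OF adm] by (simp add: faraday_factor_def)
  let ?a = "ipE s ?A Z + ipE s ?R Z"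
  have F0: "edot s (G x) ?y - edot s (G x) x = faraday_factor s * ?a"
    by (rule G_tested_with_field[OF G Bn x x Z])
  have F1: "edot s (G ?x1) ?y - edot s (G ?x1) x = faraday_factor s * (ipE s (\<lambda>z. (1 / dt s) *\<^sub>R (?B1 z - Bn z)) Z
        + ipE s (wrotv (Om s) (\<lambda>z. ?E1 z + ?b z)) Z)"
    by (rule G_tested_with_field[OF G Bn x1 x Z])
  have "ipE s (\<lambda>z. (1 / dt s) *\<^sub>R (?B1 z - Bn z)) Z = fd_eps * ipE s ?A' Z + ipE s ?A Z"
  proof -
    have "(\<lambda>z. (1 / dt s) *\<^sub>R (?B1 z - Bn z)) = (\<lambda>z. fd_eps *\<^sub>R ?A' z + ?A z)"
      by (simp add: fun_eq_iff algebra_simps)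
    then show ?thesis using ipE_combo(1)[OF A' A Z, of fd_eps] by simp
  qed
  moreover have "ipE s (wrotv (Om s) (\<lambda>z. ?E1 z + ?b z)) Z = fd_eps * ipE s ?R' Z + ipE s ?R Z"
  proof -
    have e: "(\<lambda>z. ?E1 z + ?b z) = (\<lambda>z. fd_eps * D z + (E z + ?b z))" by (simp add: fun_eq_iff)
    have H: "D \<in> Hrotv (Om s)" "(\<lambda>z. E z + ?b z) \<in> Hrotv (Om s)" using corrD(2)[OF d] Eb by (auto simp: Vh_def)
    have "ipE s (wrotv (Om s) (\<lambda>z. fd_eps * D z + (E z + ?b z))) Z = ipE s (\<lambda>z. fd_eps *\<^sub>R ?R' z + ?R z) Z"
    proof (rule ipE_cong[OF _ _ Z Hrotv_combo(2)[OF U H]])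
      show "wrotv (Om s) (\<lambda>z. fd_eps * D z + (E z + ?b z)) \<in> EE"
        by (intro wrotv_in_Eh(1)[OF admissibleD(3)[OF adm]] Vh_combo[OF U] corrD(2)[OF d] Eb)
      show "(\<lambda>z. fd_eps *\<^sub>R ?R' z + ?R z) \<in> EE" by (intro Eh_combo[OF U] R'(1) R(1))
    qed
    then show ?thesis unfolding e using ipE_combo(1)[OF R'(1) R(1) Z, of fd_eps] by simp
  qed
  ultimately have E1: "edot s (G ?x1) ?y - edot s (G ?x1) x
      = faraday_factor s * (fd_eps * (ipE s ?A' Z + ipE s ?R' Z) + ?a)"
    unfolding F1 by (simp add: distrib_left)
  have E2: "edot s (G ?x1) ?y - edot s (G ?x1) x = (1 - fd_eps) * (faraday_factor s * ?a)"
    unfolding Gx1 F0[symmetric] by (simp add: right_diff_distrib)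
  have cancel: "b + a = 0" if "k * (e * b + a) = (1 - e) * (k * a)" "k \<noteq> 0" "e \<noteq> 0" for a b k e :: real
  proof -
    have "k * e * (b + a) = 0" using that(1) by (simp add: algebra_simps)
    with that(2,3) show ?thesis by simp
  qed
  have sum0: "ipE s ?A' Z + ipE s ?R' Z + ?a = 0"
    by (rule cancel[OF trans[OF E1[symmetric] E2] ff]) (use eps in simp)
  have AR: "(\<lambda>z. 1 *\<^sub>R ?A z + ?R z) \<in> EE" "(\<lambda>z. 1 *\<^sub>R ?A' z + ?R' z) \<in> EE"
    by (intro Eh_combo[OF U] A A' R(1) R'(1))+
  have "ipE s Z Z = ipE s (\<lambda>z. 1 *\<^sub>R (1 *\<^sub>R ?A z + ?R z) + (1 *\<^sub>R ?A' z + ?R' z)) Z" by (simp only: Z_def)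
  also have "\<dots> = 0"
    using ipE_combo(1)[OF AR Z, of 1] ipE_combo(1)[OF A R(1) Z, of 1] ipE_combo(1)[OF A' R'(1) Z, of 1] sum0 by simp
  finally have "ae_eq (Om s) Z (\<lambda>_. 0)" by (rule ipE_definite[OF Z])
  then have eq: "ae_eq (Om s) (\<lambda>z. (- dt s) *\<^sub>R (1 *\<^sub>R ?R z + ?R' z) + 0) (\<lambda>z. C z + (B z - Bn z))"
    unfolding ae_eq_def
  proof eventually_elim
    case (elim z)
    show ?case
    proof
      assume "z \<in> Om s"
      with elim have "dt s *\<^sub>R Z z = 0" by simp
      then show "(- dt s) *\<^sub>R (1 *\<^sub>R ?R z + ?R' z) + 0 = C z + (B z - Bn z)"
        using dt by (simp add: Z_def algebra_simps)
    qed
  qed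
  have L: "L2 (Om s) ?R" "L2 (Om s) ?R'" using R(1) R'(1) by (auto simp: Eh_def Hdiv_def)
  have 1: "weak_div (Om s) (\<lambda>z. 1 *\<^sub>R ?R z + ?R' z) (\<lambda>z. 1 * 0 + 0)"
    by (rule weak_div_combo[OF U L L2_zero L2_zero R(2) R'(2)])
  have "weak_div (Om s) (\<lambda>z. (- dt s) *\<^sub>R (1 *\<^sub>R ?R z + ?R' z) + 0) (\<lambda>z. (- dt s) * 0 + 0)"
  proof (rule weak_div_combo[OF U])
    show "L2 (Om s) (\<lambda>z. 1 *\<^sub>R ?R z + ?R' z)" by (rule L2_combo[OF L])
    show "weak_div (Om s) (\<lambda>z. 1 *\<^sub>R ?R z + ?R' z) (\<lambda>_. 0)" using 1 by simp
    show "weak_div (Om s) (\<lambda>_. 0) (\<lambda>_. 0)" by (simp add: weak_div_def)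
  qed auto
  then show ?thesis using weak_div_cong[OF eq ae_eq_refl, of "\<lambda>_. 0"] by simp
qed

text \<open>An iterate is known through its vector of degrees of freedom, which may represent different fields. The
  condition on the fluxes makes solenoidality a linear property of the vector.\<close>

definition solenoidal_dofs :: "dofvec \<Rightarrow> bool" where
  "solenoidal_dofs x \<longleftrightarrow> (\<forall>P\<in>msh s. (\<Sum>e\<in>edges P. edge_length e * edge_avg x e) = 0)"

lemma solenoidal_dofs_iff: "corr s x (u, B, E, p) \<Longrightarrow> weak_div (Om s) B (\<lambda>_. 0) \<longleftrightarrow> solenoidal_dofs x"
  unfolding solenoidal_dofs_def
  using corrD(1)[of x u B E p]
  by (intro solenoidal_iff_fluxes[OF admissibleD(1,2,3)[OF adm]]) (auto simp: corr_def)

lemma solenoidal_dofs_add: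
  assumes "solenoidal_dofs x" "solenoidal_dofs y"
  shows "solenoidal_dofs (\<lambda>i. x i + y i)"
proof -
  have e: "edge_avg (\<lambda>i. x i + y i) e = edge_avg x e + edge_avg y e" for e
    using edge_avg_combo[of 1 x y e] by simp
  show ?thesis using assms unfolding solenoidal_dofs_def e by (simp add: distrib_left sum.distrib)
qed

text \<open>In \<open>C = (C + (B - Bn)) - (B - Bn)\<close> both terms on the right are solenoidal, the first one by the preceding lemma.\<close>

lemma newton_step_solenoidal_dofs:
  assumes "dt s > 0" "0 \<le> theta s" "defines_G s n un Bn f G" "Bn \<in> EE" "weak_div (Om s) Bn (\<lambda>_. 0)"
    and x: "corr s x w" "solenoidal_dofs x" and d: "\<delta> \<in> Xh0 s" and "DG G x \<delta> = (\<lambda>i. - G x i)"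
  shows "solenoidal_dofs \<delta>"
proof -
  note U = admissibleD(1,2)[OF adm]
  obtain u B E p where w: "w = (u, B, E, p)" by (cases w) auto
  obtain v C D q where d: "corr s \<delta> (v, C, D, q)" using d by (auto simp: Xh0_def)
  have 1: "weak_div (Om s) (\<lambda>z. C z + (B z - Bn z)) (\<lambda>_. 0)"
    using assms x(1) d unfolding w by (intro newton_step_solenoidal)
  have Bw: "weak_div (Om s) B (\<lambda>_. 0)" using solenoidal_dofs_iff x unfolding w by blast
  have L: "L2 (Om s) B" "L2 (Om s) Bn" "L2 (Om s) C"
    using corrD(1)[OF x(1)[unfolded w]] corrD(1)[OF d] assms(4) by (auto simp: Eh_def Hdiv_def)
  have 2: "weak_div (Om s) (\<lambda>z. -1 *\<^sub>R B z + Bn z) (\<lambda>z. -1 * 0 + 0)"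
    by (rule weak_div_combo[OF U L(1,2) L2_zero L2_zero Bw assms(5)])
  have "weak_div (Om s) (\<lambda>z. 1 *\<^sub>R (C z + (B z - Bn z)) + (-1 *\<^sub>R B z + Bn z)) (\<lambda>z. 1 * 0 + 0)"
  proof (rule weak_div_combo[OF U _ _ L2_zero L2_zero 1])
    show "L2 (Om s) (\<lambda>z. C z + (B z - Bn z))"
      using L2_combo[OF L(3) L2_diff[OF L(1,2)], of 1] by simp
    show "L2 (Om s) (\<lambda>z. -1 *\<^sub>R B z + Bn z)" by (rule L2_combo[OF L(1,2)])
    show "weak_div (Om s) (\<lambda>z. -1 *\<^sub>R B z + Bn z) (\<lambda>_. 0)" using 2 by simp
  qed
  then have "weak_div (Om s) C (\<lambda>_. 0)" by simp
  then show ?thesis using solenoidal_dofs_iff[OF d] by simp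
qed

text \<open>Interpolation preserves edge fluxes, and those of a solenoidal field add up to \<open>0\<close> around every cell.\<close>

lemma solenoidal_interpolant:
  assumes B: "B \<in> Hdiv (Om s)" "weak_div (Om s) B (\<lambda>_. 0)"
  shows "weak_div (Om s) (IE s B) (\<lambda>_. 0)"
proof -
  note U = admissibleD(1,2)[OF adm]
  have I: "IE s B \<in> EE" "edge_fluxes (msh s) (IE s B) (flux s B)" using admissibleD(12)[OF adm B(1)] by auto
  have "(\<Sum>e\<in>edges P. flux s B e) = 0" if P: "P \<in> msh s" for P
  proof -
    have "ae_eq (Om s) (wdiv (Om s) B) (\<lambda>_. 0)" by (rule wdiv_unique[OF U L2_zero B(2)])
    then have "ae_eq (region P) (wdiv (Om s) B) (\<lambda>_. 0)" using admissibleD(8)[OF adm P] by (rule ae_eq_subset)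
    then have "(LINT x:region P|lebesgue. wdiv (Om s) B x) = 0"
      using ae_eq_integral[of "region P" "wdiv (Om s) B" "\<lambda>_. 0"] by simp
    moreover have "(\<Sum>e\<in>edges P. flux s B e) = (LINT x:region P|lebesgue. wdiv (Om s) B x)"
      using admissibleD(11)[OF adm] B(1) P unfolding flux_functional_def by blast
    ultimately show ?thesis by simp
  qed
  then show ?thesis using solenoidal_iff_fluxes[OF U admissibleD(3)[OF adm] I] by blast
qed

end

theorem corollary4p4:
  fixes s :: scheme and \<rho> c lo hi :: real and N M :: nat
    and u0 B0 :: vect
    and f :: "nat \<Rightarrow> vect"                      \<comment> \<open>\<open>f n\<close>: discrete load of the step from \<open>n\<close> to \<open>n + 1\<close>\<close>
    and u B :: "nat \<Rightarrow> vect"                    \<comment> \<open>discrete velocity and magnetic field at time level \<open>n\<close>\<close>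
    and Ehat p :: "nat \<Rightarrow> scal"                 \<comment> \<open>\<open>Ehat (Suc n)\<close>, \<open>p (Suc n)\<close>: at time \<open>tn_theta s n\<close>\<close>
    and G :: "nat \<Rightarrow> dofvec \<Rightarrow> dofvec"
    and x \<delta>x :: "nat \<Rightarrow> nat \<Rightarrow> dofvec"          \<comment> \<open>\<open>x (Suc n) m\<close>: iterate \<open>m\<close> of the step from \<open>n\<close> to \<open>n + 1\<close>\<close>
  assumes "admissible s \<rho> c lo hi"
    and "0 \<le> theta s" and "theta s \<le> 1" and "dt s > 0"
    and "B0 \<in> Hdiv (Om s)"
    and "B 0 = IE s B0"
    and "u 0 = ITV s u0"
    and "\<And>n. n < N \<Longrightarrow> f n \<in> TVh (Om s) (msh s)"
    and "\<And>n. n < N \<Longrightarrow> defines_G s n (u n) (B n) (f n) (G n)"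
    and "\<And>n. n < N \<Longrightarrow> corr s (x (Suc n) 0)
           (\<lambda>z. u n z - ITV s (ub s (tn s n)) z, B n,
            if n > 0 then Ehat n else (\<lambda>_. 0), if n > 0 then p n else (\<lambda>_. 0))"
    and "\<And>n m. n < N \<Longrightarrow> m < M \<Longrightarrow> \<delta>x (Suc n) m \<in> Xh0 s"
    and "\<And>n m. n < N \<Longrightarrow> m < M \<Longrightarrow> DG (G n) (x (Suc n) m) (\<delta>x (Suc n) m) = (\<lambda>i. - G n (x (Suc n) m) i)"
    and "\<And>n m. n < N \<Longrightarrow> m < M \<Longrightarrow> x (Suc n) (Suc m) = (\<lambda>i. x (Suc n) m i + \<delta>x (Suc n) m i)"
    and "\<And>n. n < N \<Longrightarrow> corr s (x (Suc n) M)
           (\<lambda>z. u (Suc n) z - ITV s (ub s (tn s (Suc n))) z, B (Suc n), Ehat (Suc n), p (Suc n))"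
    and "weak_div (Om s) B0 (\<lambda>_. 0)"
  shows "(\<forall>n m \<delta>u \<delta>B \<delta>E \<delta>p. 1 \<le> n \<and> n \<le> N \<and> m < M \<and> corr s (\<delta>x n m) (\<delta>u, \<delta>B, \<delta>E, \<delta>p)
             \<longrightarrow> weak_div (Om s) \<delta>B (\<lambda>_. 0))
         \<and> (\<forall>n\<le>N. weak_div (Om s) (B n) (\<lambda>_. 0))"
proof -
  note adm = assms(1)
  note U = admissibleD(1,2)[OF adm]
  have iterates: "(\<exists>w. corr s (x (Suc n) m) w) \<and> solenoidal_dofs s (x (Suc n) m)
      \<and> (\<forall>k<m. solenoidal_dofs s (\<delta>x (Suc n) k))"
    if n: "n < N" and Bn: "weak_div (Om s) (B n) (\<lambda>_. 0)" and m: "m \<le> M" for n m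
    using m
  proof (induction m)
    case 0
    have "solenoidal_dofs s (x (Suc n) 0)"
      using solenoidal_dofs_iff[OF adm assms(10)[OF n]] Bn by blast
    then show ?case using assms(10)[OF n] by blast
  next
    case (Suc m)
    then have m: "m < M" by simp
    obtain w where w: "corr s (x (Suc n) m) w" using Suc by auto
    have sx: "solenoidal_dofs s (x (Suc n) m)" using Suc by simp
    have BE: "B n \<in> Eh (Om s) (msh s)" by (rule corrD(1)[OF adm assms(10)[OF n]])
    have sd: "solenoidal_dofs s (\<delta>x (Suc n) m)"
      by (rule newton_step_solenoidal_dofs[OF adm assms(4,2) assms(9)[OF n] BE Bn w sx assms(11)[OF n m] assms(12)[OF n m]])
    obtain d where d: "corr s (\<delta>x (Suc n) m) d" using assms(11)[OF n m] by (auto simp: Xh0_def)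
    have "\<exists>w. corr s (\<lambda>i. 1 * x (Suc n) m i + \<delta>x (Suc n) m i) w"
      using corr_combo[OF U admissibleD(8)[OF adm], of "x (Suc n) m" _ _ _ _ "\<delta>x (Suc n) m" _ _ _ _ 1] w d
      by (cases w, cases d) blast
    then show ?case
      using solenoidal_dofs_add[OF adm sx sd] sd Suc by (auto simp: assms(13)[OF n m] less_Suc_eq)
  qed
  have levels: "weak_div (Om s) (B n) (\<lambda>_. 0)" if "n \<le> N" for n
    using that
  proof (induction n)
    case 0
    show ?case using solenoidal_interpolant[OF adm assms(5) assms(15)] assms(6) by simp
  next
    case (Suc n)
    then have n: "n < N" by simp
    have "solenoidal_dofs s (x (Suc n) M)" using iterates[OF n _ order_refl] Suc by simp
    then show ?case using solenoidal_dofs_iff[OF adm assms(14)[OF n]] by blast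
  qed
  have "weak_div (Om s) \<delta>B (\<lambda>_. 0)"
    if n: "1 \<le> n" "n \<le> N" and m: "m < M" and d: "corr s (\<delta>x n m) (\<delta>u, \<delta>B, \<delta>E, \<delta>p)" for n m \<delta>u \<delta>B \<delta>E \<delta>p
  proof -
    obtain k where k: "n = Suc k" using n by (cases n) auto
    then have "solenoidal_dofs s (\<delta>x n m)" using iterates[of k M] levels[of k] n m by simp
    then show ?thesis using solenoidal_dofs_iff[OF adm d] by blast
  qed
  with levels show ?thesis by blast
qed

end
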